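(* Let $A$ be a balanced graded complex $C^*$-algebra and let $\xi$ be the character of an $n$-dimensional cycle $(\Omega,d,\int)$ over $A$. Let $\xi^S$ be the character of the suspended cycle over $SA$ and $\beta:DK_e(A)\to DK_{1\hat\otimes\rho}(SA\hat\otimes\mathbb C l_1)$ the suspension isomorphism, where $e$ is a basepoint with $de=0$. Then for all $[x]\in DK_e(A)$ $$\langle\xi^S,\beta[x]\rangle=c_n\,\langle\xi,[x]\rangle,$$ where $$c_n=(-1)^{n+1}\kappa\,\pi\,(n+1)\,\alpha_{n,n},\qquad \alpha_{n,n}=\int_0^1\sin^n(\pi t)\,dt .$$
   Context: Graded algebras. A graded $C^*$-algebra is a $C^*$-algebra with a $*$-automorphism $\gamma$, $\gamma^2=\mathrm{id}$; $a$ is even ($|a|=0$) if $\gamma(a)=a$, odd ($|a|=1$) if $\gamma(a)=-a$; $\gamma$ acts entrywise on matrices and pointwise on functions. An OSU is an odd $x$ with $x=x^*=x^{-1}$; $\mathfrak S(A)$ is the set of OSUs of $A$. $A$ is balanced if it contains an OSU (in particular $A$ is unital). The graded tensor product $\hat\otimes$ has $(1\hat\otimes b)(a\hat\otimes1)=(-1)^{|a||b|}a\hat\otimes b$, $(a\hat\otimes b)^*=(-1)^{|a||b|}a^*\hat\otimes b^*$ and product grading. $\mathbb C l_k$ is the complex Clifford algebra generated by $k$ pairwise anticommuting OSUs $\rho_1,\dots,\rho_k$; $\rho$ denotes the generator of $\mathbb C l_1$. Van Daele $K$-group. For an OSU $e\in A$ put $e_n=e\oplus\dots\oplus e$. $V_e(A)=\bigsqcup_n\mathfrak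 S(M_n(A))/\!\sim$, where $x\in M_m(A)$, $y\in M_l(A)$ are equivalent if for some $n$ the elements $x\oplus e_{n-m}$, $y\oplus e_{n-l}$ are homotopic in $\mathfrak S(M_n(A))$; it is a semigroup under $\oplus$ and $DK_e(A)$ is its Grothendieck group. For the suspension $SA=C_0((0,1),A)$, the elements of $DK_{1\hat\otimes\rho}(SA\hat\otimes\mathbb C l_1)$ are represented by loops $Y:[0,1]\to\mathfrak S(M_m(A)\hat\otimes\mathbb C l_1)$ with $Y(0)=Y(1)=(1\hat\otimes\rho)_m$, up to homotopy of such loops and stabilisation. With $\nu_t(x)=\cos(\tfrac{\pi t}2)\hat\otimes1+\sin(\tfrac{\pi t}2)\,x\hat\otimes\rho$, $$\beta[x]=[\,t\mapsto\nu_t(x)\nu_t(e_m)^{-1}(1\hat\otimes\rho)_m\nu_t(e_m)\nu_t(x)^{-1}\,],\quad x\in\mathfrak S(M_m(A)),$$ which is a well-defined isomorphism (van Daele). Cycles. An $n$-dimensional cycle over $A$ with domain algebra $\mathcal A$ consists of a $\mathbb Z\times\mathbb Z_2$-graded algebra $\Omega$, a graded (injective, suppressed) $*$-homomorphism $\varphi:A\to\Omega_0$, a densely defined differential $d$ of degree $(1,0)$ (graded Leibniz rule for the $\mathbb Z$-degree, $d^2=0$), a densely defined linear functional $\int:\Omega_n\to\mathbb C$ and a dense $*$-subalgebra $\mathcal A\subset A$ such that: (C1) $\mathcal A$ lies in the domain of $d$; (C2) $\mathcal A(d\mathcal A)^n$ lies in the domain of $\int$, there $\int\omega\omega'=(-1)^{|\omega|_{\mathbb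 Z}|\omega'|_{\mathbb Z}+|\omega||\omega'|}\int\omega'\omega$, and $\int$ vanishes on $(d\mathcal A)^n$; (C3) the even part of $\mathcal A\hat\otimes\mathbb C l_k$ is closed under holomorphic functional calculus for all $k\ge0$; (C4) in any neighbourhood of an OSU of $M_m(A\hat\otimes\mathbb C l_k)$ there is an OSU of $M_m(\mathcal A\hat\otimes\mathbb C l_k)$; (C5) $\mathcal A$ contains an OSU $e$ with $de=0$. Its character is $\xi(a_0,\dots,a_n)=\int a_0\,da_1\cdots da_n$, $a_i\in\mathcal A$. Pairing. Let $\kappa=\sqrt2e^{i\pi/4}$ and let $\kappa_k:\mathbb C l_k\to\mathbb C$ be linear with $\kappa_k(\rho_1\cdots\rho_k)=\kappa^k$ and $\kappa_k=0$ on products of fewer than $k$ distinct generators; for $\omega\in\Omega$, $\kappa_k(\omega\hat\otimes c)=\kappa_k(c)\omega$; $d$ acts entrywise on matrices and as $d\otimes\mathrm{id}$ on tensor products with $\mathbb C l_k$. Then $\langle\xi,[x]\rangle=\int\mathrm{Tr}_m((x-e_m)(dx)^n)$ for a representative $x\in\mathfrak S(M_m(\mathcal A))$, extended to a homomorphism on $DK_e(A)$. Suspended cycle. It is the $(n+1)$-dimensional cycle $(\Omega\wedge\Omega([0,1]),d^s,\int_{C([0,1],A)})$ over $SA$, where $\Omega([0,1])$ are the differential forms on $[0,1]$, $\wedge$ is the tensor product graded with respect to the $\mathbb Z$-degree, i.e. $(\omega\wedge\mu)(\omega'\wedge\mu')=(-1)^{|\mu|_{\mathbb Z}|\omega'|_{\mathbb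 Z}}\omega\omega'\wedge\mu\mu'$, $d^s(\omega\wedge\mu)=d\omega\wedge\mu+(-1)^{|\omega|_{\mathbb Z}}\omega\wedge d_{[0,1]}\mu$ and $\int_{C([0,1],A)}\omega\wedge\mu=\int\omega\int_{[0,1]}\mu$; its domain algebra consists of the continuous, piecewise smooth functions $[0,1]\to\mathcal A$ vanishing at the end points. For a loop $Y:[0,1]\to\mathfrak S(M_m(A)\hat\otimes\mathbb C l_1)$ with $Y(0)=Y(1)=(1\hat\otimes\rho)_m$, continuous, piecewise smooth with values in $M_m(\mathcal A)\hat\otimes\mathbb C l_1$, $$\langle\xi^S,[Y]\rangle=\int_{C([0,1],A)}\mathrm{Tr}_m\kappa_1\big((Y-(1\hat\otimes\rho)_m)(d^sY)^{n+1}\big).$$ *)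

theory Defs
  imports "HOL-Complex_Analysis.Complex_Analysis" "HOL-Library.Function_Algebras"
begin

class complex_algebra = ring +
  fixes scaleC :: "complex \<Rightarrow> 'a \<Rightarrow> 'a"  (infixr \<open>*\<^sub>C\<close> 75)
  assumes scaleC_add_right: "c *\<^sub>C (x + y) = c *\<^sub>C x + c *\<^sub>C y"
    and scaleC_add_left: "(c + c') *\<^sub>C x = c *\<^sub>C x + c' *\<^sub>C x"
    and scaleC_scaleC: "c *\<^sub>C c' *\<^sub>C x = (c * c') *\<^sub>C x"
    and scaleC_one: "1 *\<^sub>C x = x"
    and mult_scaleC_left: "(c *\<^sub>C x) * y = c *\<^sub>C (x * y)"
    and mult_scaleC_right: "x * (c *\<^sub>C y) = c *\<^sub>C (x * y)"

class cstar_algebra = complex_algebra + real_normed_algebra_1 + banach +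
  fixes cstar :: "'a \<Rightarrow> 'a"
  assumes scaleR_scaleC: "r *\<^sub>R x = complex_of_real r *\<^sub>C x"
    and norm_scaleC: "norm (c *\<^sub>C x) = cmod c * norm x"
    and cstar_add: "cstar (x + y) = cstar x + cstar y"
    and cstar_scaleC: "cstar (c *\<^sub>C x) = cnj c *\<^sub>C cstar x"
    and cstar_mult: "cstar (x * y) = cstar y * cstar x"
    and cstar_cstar: "cstar (cstar x) = x"
    and cstar_identity: "norm (cstar x * x) = (norm x)\<^sup>2"

class graded_cstar_algebra = cstar_algebra +
  fixes grading :: "'a \<Rightarrow> 'a"
  assumes grading_add: "grading (x + y) = grading x + grading y"
    and grading_scaleC: "grading (c *\<^sub>C x) = c *\<^sub>C grading x"
    and grading_mult: "grading (x * y) = grading x * grading y"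
    and grading_cstar: "grading (cstar x) = cstar (grading x)"
    and grading_grading: "grading (grading x) = x"


section \<open>Graded tensor products with Clifford algebras, matrices, OSUs\<close>

definition signed :: "nat \<Rightarrow> 'b::ab_group_add \<Rightarrow> 'b"
  where "signed p x = (if even p then x else - x)"

record 'b star_alg =
  carr :: "'b set"
  smul :: "complex \<Rightarrow> 'b \<Rightarrow> 'b"
  mult :: "'b \<Rightarrow> 'b \<Rightarrow> 'b"
  unit :: 'b
  star :: "'b \<Rightarrow> 'b"
  grad :: "'b \<Rightarrow> 'b"

definition base_alg :: "'a::graded_cstar_algebra star_alg"
  where "base_alg = \<lparr>carr = UNIV, smul = scaleC, mult = (*), unit = 1, star = cstar, grad = grading\<rparr>"

definition even_part :: "'b star_alg \<Rightarrow> 'b star_alg"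
  where "even_part B = B\<lparr>carr := {x \<in> carr B. grad B x = x}\<rparr>"

definition inv_in :: "'b star_alg \<Rightarrow> 'b \<Rightarrow> 'b"
  where "inv_in B x = (THE y. y \<in> carr B \<and> mult B x y = unit B \<and> mult B y x = unit B)"

definition spectrum_in :: "'b::ab_group_add star_alg \<Rightarrow> 'b \<Rightarrow> complex set"
  where "spectrum_in B a = {z. \<not> (\<exists>y \<in> carr B. mult B (smul B z (unit B) - a) y = unit B
                                         \<and> mult B y (smul B z (unit B) - a) = unit B)}"

definition OSU :: "'b::ab_group_add star_alg \<Rightarrow> 'b set"
  where "OSU B = {x \<in> carr B. grad B x = - x \<and> star B x = x \<and> mult B x x = unit B}"

text \<open>
  An element of the graded tensor product of \<open>B\<close> with the Clifford algebra on
  \<open>\<rho>\<^sub>1, \<dots>, \<rho>\<^sub>k\<close> is encoded by its coefficients: \<open>f\<close> stands for the sum over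
  \<open>S \<subseteq> {1..k}\<close> of \<open>f S \<otimes> \<rho>\<^sub>S\<close>, where \<open>\<rho>\<^sub>S\<close> is the product of the \<open>\<rho>\<^sub>i\<close>, \<open>i \<in> S\<close>,
  in increasing order.  Then \<open>\<rho>\<^sub>S \<rho>\<^sub>T\<close> is \<open>\<rho>\<close> of the symmetric difference, with one sign for each pair
  \<open>(s, t) \<in> S \<times> T\<close> with \<open>t < s\<close>, and moving \<open>\<rho>\<^sub>S\<close> past \<open>b\<close> replaces \<open>b\<close> by its image under
  the \<open>card S\<close>-th power of the grading \<open>\<gamma>\<close>.
\<close>

definition cl_el :: "'b::zero \<Rightarrow> nat set \<Rightarrow> nat set \<Rightarrow> 'b"
  where "cl_el b S = (\<lambda>T. if T = S then b else 0)"

definition cl_mult ::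
    "nat \<Rightarrow> ('b \<Rightarrow> 'b \<Rightarrow> 'b) \<Rightarrow> ('b \<Rightarrow> 'b) \<Rightarrow> (nat set \<Rightarrow> 'b) \<Rightarrow> (nat set \<Rightarrow> 'b) \<Rightarrow> nat set \<Rightarrow> 'b::ab_group_add"
  where "cl_mult k mul \<gamma> f g = (\<lambda>U. \<Sum>S\<in>Pow {1..k}. \<Sum>T\<in>Pow {1..k}.
     if sym_diff S T = U
     then signed (card {(s, t). s \<in> S \<and> t \<in> T \<and> t < s}) (mul (f S) ((\<gamma> ^^ card S) (g T)))
     else 0)"

definition cl_tensor :: "nat \<Rightarrow> 'b::ab_group_add star_alg \<Rightarrow> (nat set \<Rightarrow> 'b) star_alg"
  where "cl_tensor k B = \<lparr>
     carr = {f. (\<forall>S. f S \<in> carr B) \<and> (\<forall>S. \<not> S \<subseteq> {1..k} \<longrightarrow> f S = 0)},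
     smul = (\<lambda>c f S. smul B c (f S)),
     mult = cl_mult k (mult B) (grad B),
     unit = cl_el (unit B) {},
     star = (\<lambda>f S. signed (card S * (card S - 1) div 2) ((grad B ^^ card S) (star B (f S)))),
     grad = (\<lambda>f S. signed (card S) (grad B (f S)))\<rparr>"

text \<open>
  An \<open>m \<times> m\<close> matrix is a function on all index pairs that vanishes outside \<open>{..<m} \<times> {..<m}\<close>.
  On matrices and on Clifford coefficients the product topology of the function space is used; as
  only finitely many entries are nonzero, it induces the norm topology of \<open>M\<^sub>m(A \<otimes> \<complex>l\<^sub>k)\<close>.
\<close>

type_synonym 'b matrix = "nat \<Rightarrow> nat \<Rightarrow> 'b"

definition mat_mult :: "('b \<Rightarrow> 'b \<Rightarrow> 'b) \<Rightarrow> nat \<Rightarrow> 'b matrix \<Rightarrow> 'b matrix \<Rightarrow> 'b::comm_monoid_add matrix"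
  where "mat_mult mul m X Y = (\<lambda>i j. if i < m \<and> j < m then \<Sum>l<m. mul (X i l) (Y l j) else 0)"

definition mat_diag :: "nat \<Rightarrow> 'b \<Rightarrow> 'b::zero matrix"
  where "mat_diag m b = (\<lambda>i j. if i < m \<and> j = i then b else 0)"

definition mat_alg :: "nat \<Rightarrow> 'b::ab_group_add star_alg \<Rightarrow> 'b matrix star_alg"
  where "mat_alg m B = \<lparr>
     carr = {X. (\<forall>i j. X i j \<in> carr B) \<and> (\<forall>i j. \<not> (i < m \<and> j < m) \<longrightarrow> X i j = 0)},
     smul = (\<lambda>c X i j. smul B c (X i j)),
     mult = mat_mult (mult B) m,
     unit = mat_diag m (unit B),
     star = (\<lambda>X i j. star B (X j i)),
     grad = (\<lambda>X i j. grad B (X i j))\<rparr>"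

definition mat_tr :: "nat \<Rightarrow> 'b matrix \<Rightarrow> 'b::comm_monoid_add"
  where "mat_tr m X = (\<Sum>i<m. X i i)"

definition mat_dsum :: "nat \<Rightarrow> nat \<Rightarrow> 'b matrix \<Rightarrow> 'b matrix \<Rightarrow> 'b::zero matrix"
  where "mat_dsum m l X Y = (\<lambda>i j. if i < m \<and> j < m then X i j
                                   else if m \<le> i \<and> m \<le> j \<and> i < m + l \<and> j < m + l then Y (i - m) (j - m)
                                   else 0)"


section \<open>Van Daele groups\<close>

text \<open>
  The same construction is used for OSUs over \<open>A\<close> and for loops of OSUs (the suspension).
  The data are: the objects of each size, homotopy, direct sum, and the basepoints.
\<close>

record 'x vd_data =
  vd_obj :: "nat \<Rightarrow> 'x set"
  vd_htp :: "nat \<Rightarrow> 'x \<Rightarrow> 'x \<Rightarrow> bool"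
  vd_sum :: "nat \<Rightarrow> nat \<Rightarrow> 'x \<Rightarrow> 'x \<Rightarrow> 'x"
  vd_base :: "nat \<Rightarrow> 'x"

definition vd_elems :: "'x vd_data \<Rightarrow> (nat \<times> 'x) set"
  where "vd_elems D = (SIGMA m:{1..}. vd_obj D m)"

definition vd_rel :: "'x vd_data \<Rightarrow> ((nat \<times> 'x) \<times> (nat \<times> 'x)) set"
  where "vd_rel D = {((m, x), (l, y)). (m, x) \<in> vd_elems D \<and> (l, y) \<in> vd_elems D \<and>
     (\<exists>n. m \<le> n \<and> l \<le> n \<and>
        vd_htp D n (vd_sum D m (n - m) x (vd_base D (n - m))) (vd_sum D l (n - l) y (vd_base D (n - l))))}"

definition vd_class :: "'x vd_data \<Rightarrow> nat \<Rightarrow> 'x \<Rightarrow> (nat \<times> 'x) set"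
  where "vd_class D m x = vd_rel D `` {(m, x)}"

definition vd_semigroup :: "'x vd_data \<Rightarrow> (nat \<times> 'x) set set"
  where "vd_semigroup D = vd_elems D // vd_rel D"

definition vd_plus :: "'x vd_data \<Rightarrow> (nat \<times> 'x) set \<Rightarrow> (nat \<times> 'x) set \<Rightarrow> (nat \<times> 'x) set"
  where "vd_plus D a b = (\<Union>(m, x)\<in>a. \<Union>(l, y)\<in>b. vd_class D (m + l) (vd_sum D m l x y))"

definition groth_rel :: "'x vd_data \<Rightarrow>
    (((nat \<times> 'x) set \<times> (nat \<times> 'x) set) \<times> ((nat \<times> 'x) set \<times> (nat \<times> 'x) set)) set"
  where "groth_rel D = {((a, b), (a', b')).
     {a, b, a', b'} \<subseteq> vd_semigroup D \<and>
     (\<exists>c \<in> vd_semigroup D. vd_plus D (vd_plus D a b') c = vd_plus D (vd_plus D a' b) c)}"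

definition DK :: "'x vd_data \<Rightarrow> ((nat \<times> 'x) set \<times> (nat \<times> 'x) set) set set"
  where "DK D = (vd_semigroup D \<times> vd_semigroup D) // groth_rel D"

text \<open>The formal difference \<open>[x] - [y]\<close> in the Grothendieck group.\<close>

definition DK_diff :: "'x vd_data \<Rightarrow> nat \<times> 'x \<Rightarrow> nat \<times> 'x \<Rightarrow> ((nat \<times> 'x) set \<times> (nat \<times> 'x) set) set"
  where "DK_diff D p q =
     groth_rel D `` {(vd_class D (fst p) (snd p), vd_class D (fst q) (snd q))}"

definition vd_alg :: "'a::graded_cstar_algebra \<Rightarrow> 'a matrix vd_data"
  where "vd_alg e = \<lparr>
     vd_obj = (\<lambda>m. OSU (mat_alg m base_alg)),
     vd_htp = (\<lambda>m. path_component (OSU (mat_alg m base_alg))),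
     vd_sum = mat_dsum,
     vd_base = (\<lambda>m. mat_diag m e)\<rparr>"

definition rho_mat :: "nat \<Rightarrow> (nat set \<Rightarrow> 'a::graded_cstar_algebra) matrix"
  where "rho_mat m = mat_diag m (cl_el 1 {1})"

definition susp_alg :: "nat \<Rightarrow> (nat set \<Rightarrow> 'a::graded_cstar_algebra) matrix star_alg"
  where "susp_alg m = mat_alg m (cl_tensor 1 base_alg)"

text \<open>The loop model of the van Daele group of \<open>SA \<otimes> \<complex>l\<^sub>1\<close> with basepoint \<open>1 \<otimes> \<rho>\<close>.\<close>

definition osu_loops :: "nat \<Rightarrow> (real \<Rightarrow> (nat set \<Rightarrow> 'a::graded_cstar_algebra) matrix) set"
  where "osu_loops m = {Y. path Y \<and> path_image Y \<subseteq> OSU (susp_alg m) \<and>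
                           pathstart Y = rho_mat m \<and> pathfinish Y = rho_mat m}"

definition vd_susp :: "(real \<Rightarrow> (nat set \<Rightarrow> 'a::graded_cstar_algebra) matrix) vd_data"
  where "vd_susp = \<lparr>
     vd_obj = osu_loops,
     vd_htp = (\<lambda>m. homotopic_paths (OSU (susp_alg m))),
     vd_sum = (\<lambda>m l Y Z t. mat_dsum m l (Y t) (Z t)),
     vd_base = (\<lambda>m t. rho_mat m)\<rparr>"

definition nu :: "nat \<Rightarrow> real \<Rightarrow> 'a matrix \<Rightarrow> (nat set \<Rightarrow> 'a::graded_cstar_algebra) matrix"
  where "nu m t x = (\<lambda>i j. cl_el (cos (pi * t / 2) *\<^sub>R mat_diag m 1 i j) {} +
                           cl_el (sin (pi * t / 2) *\<^sub>R x i j) {1})"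

definition beta_loop :: "'a \<Rightarrow> nat \<Rightarrow> 'a matrix \<Rightarrow> real \<Rightarrow> (nat set \<Rightarrow> 'a::graded_cstar_algebra) matrix"
  where "beta_loop e m x t =
     (let B = susp_alg m; v = nu m t x; w = nu m t (mat_diag m e)
      in mult B v (mult B (inv_in B w) (mult B (rho_mat m) (mult B w (inv_in B v)))))"

definition beta_semigroup :: "'a::graded_cstar_algebra \<Rightarrow> (nat \<times> 'a matrix) set \<Rightarrow>
    (nat \<times> (real \<Rightarrow> (nat set \<Rightarrow> 'a) matrix)) set"
  where "beta_semigroup e a = (\<Union>(m, x)\<in>a. vd_class vd_susp m (beta_loop e m x))"

text \<open>The homomorphism of Grothendieck groups induced by \<^const>\<open>beta_semigroup\<close>.\<close>

definition beta :: "'a::graded_cstar_algebra \<Rightarrow>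
    ((nat \<times> 'a matrix) set \<times> (nat \<times> 'a matrix) set) set \<Rightarrow>
    ((nat \<times> (real \<Rightarrow> (nat set \<Rightarrow> 'a) matrix)) set \<times> (nat \<times> (real \<Rightarrow> (nat set \<Rightarrow> 'a) matrix)) set) set"
  where "beta e c = (\<Union>(a, b)\<in>c. groth_rel vd_susp `` {(beta_semigroup e a, beta_semigroup e b)})"


section \<open>Cycles\<close>

text \<open>
  Riesz--Dunford calculus in the even part of \<open>A \<otimes> \<complex>l\<^sub>k\<close>: the contour integral of
  \<open>f(z) (z - a)\<^sup>-\<^sup>1 / (2 \<pi> i)\<close> along a cycle \<open>\<Gamma>\<close> (a list of closed paths), computed
  coefficientwise.
\<close>

definition holo_calc :: "nat \<Rightarrow> (complex \<Rightarrow> complex) \<Rightarrow> (real \<Rightarrow> complex) list \<Rightarrow>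
    (nat set \<Rightarrow> 'a::graded_cstar_algebra) \<Rightarrow> nat set \<Rightarrow> 'a"
  where "holo_calc k f \<Gamma> a = (let B = even_part (cl_tensor k base_alg) in
     (\<lambda>S. (1 / (2 * complex_of_real pi * \<i>)) *\<^sub>C (\<Sum>\<gamma>\<leftarrow>\<Gamma>. integral {0..1}
        (\<lambda>t. (f (\<gamma> t) * vector_derivative \<gamma> (at t within {0..1})) *\<^sub>C
              inv_in B (smul B (\<gamma> t) (unit B) - a) S))))"

definition holo_closed :: "nat \<Rightarrow> (nat set \<Rightarrow> 'a::graded_cstar_algebra) set \<Rightarrow> bool"
  where "holo_closed k Q \<longleftrightarrow> (\<forall>a\<in>Q. \<forall>U f \<Gamma>.
     (let \<sigma> = spectrum_in (even_part (cl_tensor k base_alg)) a in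
      open U \<and> f holomorphic_on U \<and> \<sigma> \<subseteq> U \<and>
      (\<forall>\<gamma>\<in>set \<Gamma>. valid_path \<gamma> \<and> pathfinish \<gamma> = pathstart \<gamma> \<and> path_image \<gamma> \<subseteq> U - \<sigma>) \<and>
      (\<forall>z\<in>\<sigma>. (\<Sum>\<gamma>\<leftarrow>\<Gamma>. winding_number \<gamma> z) = 1) \<and>
      (\<forall>z. z \<notin> U \<longrightarrow> (\<Sum>\<gamma>\<leftarrow>\<Gamma>. winding_number \<gamma> z) = 0))
     \<longrightarrow> holo_calc k f \<Gamma> a \<in> Q)"

text \<open>
  \<open>cyc_hom j\<close> is the component of \<open>\<int>\<close>-degree \<open>j\<close>, \<open>cyc_grad\<close> the automorphism giving the
  \<open>\<int>\<^sub>2\<close>-grading, and \<open>cyc_star\<close> the involution, needed only on degree \<open>0\<close>.  The operators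
  \<open>cyc_d\<close> and \<open>cyc_int\<close> are meaningful on the domains \<open>cyc_ddom\<close> and \<open>cyc_idom\<close> only;
  \<open>cyc_alg\<close> is the domain algebra.
\<close>

record ('a, 'w) cycle_data =
  cyc_hom :: "int \<Rightarrow> 'w set"
  cyc_grad :: "'w \<Rightarrow> 'w"
  cyc_star :: "'w \<Rightarrow> 'w"
  cyc_emb :: "'a \<Rightarrow> 'w"
  cyc_ddom :: "'w set"
  cyc_d :: "'w \<Rightarrow> 'w"
  cyc_idom :: "'w set"
  cyc_int :: "'w \<Rightarrow> complex"
  cyc_alg :: "'a set"

definition cyc_components :: "('a, 'w::complex_algebra) cycle_data \<Rightarrow> 'w \<Rightarrow> (int \<Rightarrow> 'w) \<Rightarrow> bool"
  where "cyc_components C w c \<longleftrightarrow>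
     (\<forall>j. c j \<in> cyc_hom C j) \<and> finite {j. c j \<noteq> 0} \<and> w = (\<Sum>j | c j \<noteq> 0. c j)"

definition cyc_bideg :: "('a, 'w::complex_algebra) cycle_data \<Rightarrow> int \<Rightarrow> nat \<Rightarrow> 'w set"
  where "cyc_bideg C j p = {w \<in> cyc_hom C j. cyc_grad C w = signed p w}"

definition cyc_form :: "('a, 'w::complex_algebra) cycle_data \<Rightarrow> 'a \<Rightarrow> 'a list \<Rightarrow> 'w"
  where "cyc_form C a0 as = foldl (\<lambda>w a. w * cyc_d C (cyc_emb C a)) (cyc_emb C a0) as"

text \<open>The linear span \<open>\<A>(d\<A>)\<^sup>j\<close>.\<close>

definition cyc_forms :: "('a, 'w::complex_algebra) cycle_data \<Rightarrow> nat \<Rightarrow> 'w set"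
  where "cyc_forms C j = module.span scaleC
     {cyc_form C a0 as |a0 as. a0 \<in> cyc_alg C \<and> set as \<subseteq> cyc_alg C \<and> length as = j}"

locale n_cycle =
  fixes n :: nat
    and C :: "('a::graded_cstar_algebra, 'w::{complex_algebra, topological_space}) cycle_data"
  assumes hom_subspace: "module.subspace scaleC (cyc_hom C j)"
    and hom_direct_sum: "\<exists>!c. cyc_components C w c"
    and hom_mult: "v \<in> cyc_hom C i \<Longrightarrow> w \<in> cyc_hom C j \<Longrightarrow> v * w \<in> cyc_hom C (i + j)"
    and grad_linear: "module_hom scaleC scaleC (cyc_grad C)"
    and grad_mult: "cyc_grad C (v * w) = cyc_grad C v * cyc_grad C w"
    and grad_invol: "cyc_grad C (cyc_grad C w) = w"
    and grad_hom: "w \<in> cyc_hom C j \<Longrightarrow> cyc_grad C w \<in> cyc_hom C j"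
    and star_hom: "w \<in> cyc_hom C 0 \<Longrightarrow> cyc_star C w \<in> cyc_hom C 0"
    and star_add: "\<lbrakk>v \<in> cyc_hom C 0; w \<in> cyc_hom C 0\<rbrakk> \<Longrightarrow> cyc_star C (v + w) = cyc_star C v + cyc_star C w"
    and star_scaleC: "w \<in> cyc_hom C 0 \<Longrightarrow> cyc_star C (z *\<^sub>C w) = cnj z *\<^sub>C cyc_star C w"
    and star_mult: "\<lbrakk>v \<in> cyc_hom C 0; w \<in> cyc_hom C 0\<rbrakk> \<Longrightarrow> cyc_star C (v * w) = cyc_star C w * cyc_star C v"
    and star_invol: "w \<in> cyc_hom C 0 \<Longrightarrow> cyc_star C (cyc_star C w) = w"
    and emb_inj: "inj (cyc_emb C)"
    and emb_linear: "module_hom scaleC scaleC (cyc_emb C)"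
    and emb_mult: "cyc_emb C (a * b) = cyc_emb C a * cyc_emb C b"
    and emb_star: "cyc_emb C (cstar a) = cyc_star C (cyc_emb C a)"
    and emb_grading: "cyc_emb C (grading a) = cyc_grad C (cyc_emb C a)"
    and emb_hom: "cyc_emb C a \<in> cyc_hom C 0"
    \<comment> \<open>The domain of \<open>d\<close> is only assumed to be a dense subspace; the Leibniz rule and \<open>d\<^sup>2 = 0\<close>
        are required wherever both sides are defined.\<close>
    and ddom_subspace: "module.subspace scaleC (cyc_ddom C)"
    and ddom_dense: "closure (cyc_ddom C) = UNIV"
    and d_add: "\<lbrakk>v \<in> cyc_ddom C; w \<in> cyc_ddom C\<rbrakk> \<Longrightarrow> cyc_d C (v + w) = cyc_d C v + cyc_d C w"
    and d_scaleC: "w \<in> cyc_ddom C \<Longrightarrow> cyc_d C (z *\<^sub>C w) = z *\<^sub>C cyc_d C w"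
    and d_degree: "w \<in> cyc_ddom C \<Longrightarrow> w \<in> cyc_bideg C j p \<Longrightarrow> cyc_d C w \<in> cyc_bideg C (j + 1) p"
    and d_leibniz: "\<lbrakk>v \<in> cyc_ddom C; w \<in> cyc_ddom C; v * w \<in> cyc_ddom C; v \<in> cyc_hom C j\<rbrakk> \<Longrightarrow>
        cyc_d C (v * w) = cyc_d C v * w + signed (nat \<bar>j\<bar>) (v * cyc_d C w)"
    and d_square: "\<lbrakk>w \<in> cyc_ddom C; cyc_d C w \<in> cyc_ddom C\<rbrakk> \<Longrightarrow> cyc_d C (cyc_d C w) = 0"
    and idom_subspace: "module.subspace scaleC (cyc_idom C)"
    and idom_dense: "cyc_idom C \<subseteq> cyc_hom C (int n)" "cyc_hom C (int n) \<subseteq> closure (cyc_idom C)"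
    and int_add: "\<lbrakk>v \<in> cyc_idom C; w \<in> cyc_idom C\<rbrakk> \<Longrightarrow> cyc_int C (v + w) = cyc_int C v + cyc_int C w"
    and int_scaleC: "w \<in> cyc_idom C \<Longrightarrow> cyc_int C (z *\<^sub>C w) = z * cyc_int C w"
    and alg_subspace: "module.subspace scaleC (cyc_alg C)"
    and alg_mult: "\<lbrakk>a \<in> cyc_alg C; b \<in> cyc_alg C\<rbrakk> \<Longrightarrow> a * b \<in> cyc_alg C"
    and alg_star: "a \<in> cyc_alg C \<Longrightarrow> cstar a \<in> cyc_alg C"
    and alg_dense: "closure (cyc_alg C) = UNIV"
    and C1: "a \<in> cyc_alg C \<Longrightarrow> cyc_emb C a \<in> cyc_ddom C"
    and C2_dom: "cyc_forms C n \<subseteq> cyc_idom C"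
    and C2_trace: "\<lbrakk>j \<le> n; v \<in> cyc_forms C j; w \<in> cyc_forms C (n - j);
        v \<in> cyc_bideg C (int j) p; w \<in> cyc_bideg C (int (n - j)) q\<rbrakk> \<Longrightarrow>
        cyc_int C (v * w) = signed (j * (n - j) + p * q) (cyc_int C (w * v))"
    \<comment> \<open>\<open>cyc_form C 1 [a\<^sub>1, \<dots>, a\<^sub>n]\<close> is \<open>d a\<^sub>1 \<dots> d a\<^sub>n\<close>: by C5, \<open>1 = e\<^sup>2 \<in> \<A>\<close> and \<open>d 1 = 0\<close>,
        hence \<open>1 \<sqdot> d a = d a\<close>.\<close>
    and C2_closed: "\<lbrakk>set as \<subseteq> cyc_alg C; length as = n\<rbrakk> \<Longrightarrow> cyc_int C (cyc_form C 1 as) = 0"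
    and C3: "holo_closed k {f \<in> carr (even_part (cl_tensor k base_alg)). \<forall>S. f S \<in> cyc_alg C}"
    and C4: "\<lbrakk>1 \<le> m; x \<in> OSU (mat_alg m (cl_tensor k base_alg)); open N; x \<in> N\<rbrakk> \<Longrightarrow>
        \<exists>y \<in> OSU (mat_alg m (cl_tensor k base_alg)) \<inter> N. \<forall>i j S. y i j S \<in> cyc_alg C"
    and C5: "\<exists>e \<in> OSU base_alg. e \<in> cyc_alg C \<and> cyc_d C (cyc_emb C e) = 0"


section \<open>Pairings\<close>

definition kappa :: complex
  where "kappa = complex_of_real (sqrt 2) * exp (\<i> * complex_of_real pi / 4)"

definition kappa_cl :: "nat \<Rightarrow> (nat set \<Rightarrow> 'w) \<Rightarrow> 'w::complex_algebra"
  where "kappa_cl k f = kappa ^ k *\<^sub>C f {1..k}"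

text \<open>\<open>mat_rpow mul m X D n\<close> is \<open>X D\<^sup>n\<close>; this form needs no unit matrix over \<open>\<Omega>\<close>.\<close>

definition mat_rpow ::
    "('b \<Rightarrow> 'b \<Rightarrow> 'b) \<Rightarrow> nat \<Rightarrow> 'b matrix \<Rightarrow> 'b matrix \<Rightarrow> nat \<Rightarrow> 'b::comm_monoid_add matrix"
  where "mat_rpow mul m X D n = ((\<lambda>Z. mat_mult mul m Z D) ^^ n) X"

definition smooth_osus :: "('a::graded_cstar_algebra, 'w) cycle_data \<Rightarrow> (nat \<times> 'a matrix) set"
  where "smooth_osus C = {(m, x). 1 \<le> m \<and> x \<in> OSU (mat_alg m base_alg) \<and> (\<forall>i j. x i j \<in> cyc_alg C)}"

definition pairing_rep ::
    "nat \<Rightarrow> ('a::graded_cstar_algebra, 'w::complex_algebra) cycle_data \<Rightarrow> 'a \<Rightarrow> nat \<times> 'a matrix \<Rightarrow> complex"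
  where "pairing_rep n C e = (\<lambda>(m, x). cyc_int C (mat_tr m (mat_rpow (*) m
     (\<lambda>i j. cyc_emb C (x i j - mat_diag m e i j)) (\<lambda>i j. cyc_d C (cyc_emb C (x i j))) n)))"

definition pairing ::
    "nat \<Rightarrow> ('a::graded_cstar_algebra, 'w::complex_algebra) cycle_data \<Rightarrow> 'a \<Rightarrow>
      ((nat \<times> 'a matrix) set \<times> (nat \<times> 'a matrix) set) set \<Rightarrow> complex"
  where "pairing n C e c = (THE z. \<exists>p \<in> smooth_osus C. \<exists>q \<in> smooth_osus C.
     c = DK_diff (vd_alg e) p q \<and> z = pairing_rep n C e p - pairing_rep n C e q)"

text \<open>
  Pointwise in \<open>t\<close>, an element of \<open>\<Omega> \<and> \<Omega>([0,1])\<close> is \<open>F + G \<and> dt\<close>, encoded as \<open>(F, G)\<close>;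
  \<open>cyc_zsign\<close> is \<open>(-1)\<^sup>j\<close> on degree \<open>j\<close> and arises from moving \<open>dt\<close> past a form.
\<close>

definition cyc_zsign :: "('a, 'w::complex_algebra) cycle_data \<Rightarrow> 'w \<Rightarrow> 'w"
  where "cyc_zsign C w = (let c = THE c. cyc_components C w c
                          in \<Sum>j | c j \<noteq> 0. signed (nat \<bar>j\<bar>) (c j))"

definition wedge_mult :: "('a, 'w::complex_algebra) cycle_data \<Rightarrow> 'w \<times> 'w \<Rightarrow> 'w \<times> 'w \<Rightarrow> 'w \<times> 'w"
  where "wedge_mult C = (\<lambda>(F, G) (F', G'). (F * F', F * G' + G * cyc_zsign C F'))"

definition wedge_grad :: "('a, 'w::complex_algebra) cycle_data \<Rightarrow> 'w \<times> 'w \<Rightarrow> 'w \<times> 'w"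
  where "wedge_grad C = (\<lambda>(F, G). (cyc_grad C F, cyc_grad C G))"

definition wedge_fun :: "('a, 'w::complex_algebra) cycle_data \<Rightarrow> 'a \<Rightarrow> 'w \<times> 'w"
  where "wedge_fun C a = (cyc_emb C a, 0)"

text \<open>\<open>d\<^sup>s y = d y + (\<partial>\<^sub>t y) \<and> dt\<close> at \<open>t\<close>, for a function \<open>y\<close> of degree \<open>0\<close>.\<close>

definition susp_d :: "('a::graded_cstar_algebra, 'w::complex_algebra) cycle_data \<Rightarrow>
    (real \<Rightarrow> 'a) \<Rightarrow> real \<Rightarrow> 'w \<times> 'w"
  where "susp_d C y t = (cyc_d C (cyc_emb C (y t)), cyc_emb C (vector_derivative y (at t within {0..1})))"

definition smooth_on_Icc :: "real \<Rightarrow> real \<Rightarrow> (real \<Rightarrow> complex) \<Rightarrow> bool"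
  where "smooth_on_Icc a b g \<longleftrightarrow> (\<exists>D :: nat \<Rightarrow> real \<Rightarrow> complex. \<forall>t\<in>{a..b}. D 0 t = g t \<and>
     (\<forall>k. (D k has_vector_derivative D (Suc k) t) (at t within {a..b})))"

definition pw_smooth :: "(real \<Rightarrow> complex) \<Rightarrow> bool"
  where "pw_smooth g \<longleftrightarrow> continuous_on {0..1} g \<and>
     (\<exists>P. finite P \<and> {0, 1} \<subseteq> P \<and> P \<subseteq> {0..1} \<and>
        (\<forall>a\<in>P. \<forall>b\<in>P. a < b \<and> {a<..<b} \<inter> P = {} \<longrightarrow> smooth_on_Icc a b g))"

text \<open>
  Continuous, piecewise smooth functions \<open>[0,1] \<rightarrow> \<A>\<close>, as degree-\<open>0\<close> elements of the tensor
  product \<open>\<Omega> \<and> \<Omega>([0,1])\<close>, i.e. finite sums \<open>\<Sum>i. g\<^sub>i(t) a\<^sub>i\<close>.  Smoothness in the norm of \<open>A\<close> alone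
  would not do: \<open>d\<close> is not continuous, so it gives no control over \<open>t \<mapsto> d y(t)\<close>.
\<close>

definition pw_smooth_in :: "'a::graded_cstar_algebra set \<Rightarrow> (real \<Rightarrow> 'a) \<Rightarrow> bool"
  where "pw_smooth_in Q y \<longleftrightarrow> (\<exists>(N::nat) g a. (\<forall>i<N. pw_smooth (g i) \<and> a i \<in> Q) \<and>
     (\<forall>t\<in>{0..1}. y t = (\<Sum>i<N. g i t *\<^sub>C a i)))"

definition smooth_loops :: "('a::graded_cstar_algebra, 'w) cycle_data \<Rightarrow>
    (nat \<times> (real \<Rightarrow> (nat set \<Rightarrow> 'a) matrix)) set"
  where "smooth_loops C = {(m, Y). 1 \<le> m \<and> Y \<in> osu_loops m \<and>
     (\<forall>i j S. pw_smooth_in (cyc_alg C) (\<lambda>t. Y t i j S))}"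

text \<open>
  As \<open>\<integral> \<omega> \<and> \<mu> = \<integral>\<omega> \<integral>\<mu>\<close> vanishes for \<open>\<mu>\<close> of degree \<open>0\<close>, only the \<open>dt\<close>-component is integrated.
\<close>

definition susp_pairing_rep ::
    "nat \<Rightarrow> ('a::graded_cstar_algebra, 'w::complex_algebra) cycle_data \<Rightarrow>
      nat \<times> (real \<Rightarrow> (nat set \<Rightarrow> 'a) matrix) \<Rightarrow> complex"
  where "susp_pairing_rep n C = (\<lambda>(m, Y). integral {0..1} (\<lambda>t.
     let mul = cl_mult 1 (wedge_mult C) (wedge_grad C);
         Z = mat_rpow mul m
               (\<lambda>i j S. wedge_fun C (Y t i j S - rho_mat m i j S))
               (\<lambda>i j S. susp_d C (\<lambda>s. Y s i j S) t) (n + 1)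
     in cyc_int C (kappa_cl 1 (\<lambda>S. snd (mat_tr m Z S)))))"

text \<open>
  The formula for loops extends to a homomorphism on \<open>DK(SA \<otimes> \<complex>l\<^sub>1)\<close>: its value on a formal
  difference of loops depends only on the class.  This is what makes \<open>susp_pairing\<close> meaningful.
\<close>

definition susp_pairing_well_defined ::
    "nat \<Rightarrow> ('a::graded_cstar_algebra, 'w::complex_algebra) cycle_data \<Rightarrow> bool"
  where "susp_pairing_well_defined n C \<longleftrightarrow>
     (\<forall>p\<in>smooth_loops C. \<forall>q\<in>smooth_loops C. \<forall>p'\<in>smooth_loops C. \<forall>q'\<in>smooth_loops C.
        DK_diff vd_susp p q = DK_diff vd_susp p' q' \<longrightarrow>
        susp_pairing_rep n C p - susp_pairing_rep n C q = susp_pairing_rep n C p' - susp_pairing_rep n C q')"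

definition susp_pairing ::
    "nat \<Rightarrow> ('a::graded_cstar_algebra, 'w::complex_algebra) cycle_data \<Rightarrow>
      ((nat \<times> (real \<Rightarrow> (nat set \<Rightarrow> 'a) matrix)) set \<times> (nat \<times> (real \<Rightarrow> (nat set \<Rightarrow> 'a) matrix)) set) set
      \<Rightarrow> complex"
  where "susp_pairing n C c = (THE z. \<exists>p \<in> smooth_loops C. \<exists>q \<in> smooth_loops C.
     c = DK_diff vd_susp p q \<and> z = susp_pairing_rep n C p - susp_pairing_rep n C q)"

end

theory Submission
  imports Defs
begin

text \<open>
  The idea is to replace the loop \<open>\<beta>[x]\<close> by a homotopic one for which the pairing is easy to compute.
  The elements \<open>G(u, v) = \<nu>\<^sub>u(x) \<nu>\<^sub>v(e)\<^sup>-\<^sup>1 \<rho> \<nu>\<^sub>v(e) \<nu>\<^sub>u(x)\<^sup>-\<^sup>1\<close> form a square of OSUs (\<open>sweep\<close>),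
  and \<open>\<beta>[x]\<close> is its diagonal.  Deforming the diagonal into the two sides from \<open>(0, 0)\<close> over \<open>(0, 1)\<close>
  to \<open>(1, 1)\<close> gives the loop \<open>step_loop\<close>, which is \<open>cos(2\<pi>t) \<rho> - sin(2\<pi>t) e\<close> for \<open>t \<le> 1/2\<close> and
  \<open>cos(2\<pi>t) \<rho> + sin(2\<pi>t) x\<close> for \<open>t \<ge> 1/2\<close>.  The pairing with the suspended cycle is constant on
  classes by hypothesis, so it may be evaluated on this piecewise smooth loop.

  On a segment \<open>Y = a \<rho> + b z\<close>, with \<open>z\<close> an OSU over the domain algebra, both \<open>\<rho>\<close> and \<open>z\<close>
  anticommute with \<open>dz\<close>.  Hence all \<open>n + 1\<close> positions of \<open>dt\<close> in \<open>(Y - \<rho>) (d\<^sup>s Y)\<^sup>n\<^sup>+\<^sup>1\<close> contribute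
  the same form, and the integrand is \<open>\<kappa> (n + 1) b\<^sup>n (b a' - (a - 1) b')\<close> times the integral of the trace
  of \<open>z (dz)\<^sup>n\<close> (\<open>clifford_power\<close>, \<open>susp_integrand\<close>).  For the two segments the scalar factors integrate
  to the same multiple of \<open>\<integral> sin\<^sup>n(\<pi>t) dt\<close> with opposite signs, which produces \<open>c\<^sub>n\<close> times the difference of
  the terms for \<open>x\<close> and \<open>e\<close>; that difference is the pairing with \<open>\<xi>\<close> (\<open>pairing_rep_eq\<close>,
  \<open>susp_pairing_rep_step\<close>).

  Two matters remain.  The passage to Grothendieck groups needs the semigroups to be commutative, which
  holds because conjugation with a permutation matrix is connected to the identity through conjugations
  with scalar unitaries (\<open>involution_isotopy\<close>, \<open>vd_monoid\<close>, \<open>beta_DK_diff\<close>).  And each class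
  must be represented over the domain algebra: nearby OSUs \<open>x\<close>, \<open>y\<close> are homotopic, by normalising the segment between them with an inverse
  square root (\<open>nearby_OSUs_path_component\<close>, \<open>smooth_representative\<close>).  That the pairing with \<open>\<xi>\<close> is well
  defined then follows from the same property of the suspended pairing, because \<open>c\<^sub>n \<noteq> 0\<close>.
\<close>

section \<open>Star algebras, matrices and Clifford extensions\<close>

text \<open>
  Apart from the unit laws and the closure properties, the laws are demanded for all elements of the
  type: matrices with the wrong support and Clifford elements with superfluous coefficients satisfy
  them as well, and calculations then need no membership proofs.
\<close>

locale star_algebra =
  fixes B :: "'b::ab_group_add star_alg"
  assumes carr_zero: "0 \<in> carr B"
    and carr_add: "x \<in> carr B \<Longrightarrow> y \<in> carr B \<Longrightarrow> x + y \<in> carr B"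
    and carr_uminus: "x \<in> carr B \<Longrightarrow> - x \<in> carr B"
    and carr_smul: "x \<in> carr B \<Longrightarrow> smul B c x \<in> carr B"
    and carr_mult: "x \<in> carr B \<Longrightarrow> y \<in> carr B \<Longrightarrow> mult B x y \<in> carr B"
    and carr_unit: "unit B \<in> carr B"
    and carr_star: "x \<in> carr B \<Longrightarrow> star B x \<in> carr B"
    and carr_grad: "x \<in> carr B \<Longrightarrow> grad B x \<in> carr B"
    and smul_add_right: "smul B c (x + y) = smul B c x + smul B c y"
    and smul_add_left: "smul B (c + c') x = smul B c x + smul B c' x"
    and smul_smul: "smul B c (smul B c' x) = smul B (c * c') x"
    and smul_one: "smul B 1 x = x"
    and mult_add_left: "mult B (x + y) z = mult B x z + mult B y z"
    and mult_add_right: "mult B x (y + z) = mult B x y + mult B x z"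
    and mult_smul_left: "mult B (smul B c x) y = smul B c (mult B x y)"
    and mult_smul_right: "mult B x (smul B c y) = smul B c (mult B x y)"
    and mult_assoc: "mult B (mult B x y) z = mult B x (mult B y z)"
    and unit_left: "x \<in> carr B \<Longrightarrow> mult B (unit B) x = x"
    and unit_right: "x \<in> carr B \<Longrightarrow> mult B x (unit B) = x"
    and star_add: "star B (x + y) = star B x + star B y"
    and star_smul: "star B (smul B c x) = smul B (cnj c) (star B x)"
    and star_mult: "star B (mult B x y) = mult B (star B y) (star B x)"
    and star_star: "star B (star B x) = x"
    and grad_add: "grad B (x + y) = grad B x + grad B y"
    and grad_smul: "grad B (smul B c x) = smul B c (grad B x)"
    and grad_mult: "grad B (mult B x y) = mult B (grad B x) (grad B y)"
    and grad_star: "grad B (star B x) = star B (grad B x)"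
    and grad_grad: "grad B (grad B x) = x"
begin

lemma smul_zero_right [simp]: "smul B c 0 = 0"
  using smul_add_right[of c 0 0] by simp

lemma smul_zero_left [simp]: "smul B 0 x = 0"
  using smul_add_left[of 0 0 x] by simp

lemma mult_zero_left [simp]: "mult B 0 x = 0"
  using mult_add_left[of 0 0 x] by simp

lemma mult_zero_right [simp]: "mult B x 0 = 0"
  using mult_add_right[of x 0 0] by simp

lemma star_zero [simp]: "star B 0 = 0"
  using star_add[of 0 0] by simp

lemma grad_zero [simp]: "grad B 0 = 0"
  using grad_add[of 0 0] by simp

lemma mult_minus_left: "mult B (- x) y = - mult B x y"
  using mult_add_left[of x "- x" y] by (simp add: eq_neg_iff_add_eq_0 add.commute)

lemma mult_minus_right: "mult B x (- y) = - mult B x y"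
  using mult_add_right[of x y "- y"] by (simp add: eq_neg_iff_add_eq_0 add.commute)

lemma smul_minus_right: "smul B c (- x) = - smul B c x"
  using smul_add_right[of c x "- x"] by (simp add: eq_neg_iff_add_eq_0 add.commute)

lemma smul_minus_left: "smul B (- c) x = - smul B c x"
  using smul_add_left[of c "- c" x] by (simp add: eq_neg_iff_add_eq_0 add.commute)

lemma mult_diff_left: "mult B (x - y) z = mult B x z - mult B y z"
  using mult_add_left[of x "- y" z] by (simp add: mult_minus_left)

lemma mult_diff_right: "mult B x (y - z) = mult B x y - mult B x z"
  using mult_add_right[of x y "- z"] by (simp add: mult_minus_right)

lemma smul_diff_right: "smul B c (x - y) = smul B c x - smul B c y"
  using smul_add_right[of c x "- y"] by (simp add: smul_minus_right)

lemma smul_diff_left: "smul B (c - c') x = smul B c x - smul B c' x"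
  using smul_add_left[of c "- c'" x] by (simp add: smul_minus_left)

lemma star_minus: "star B (- x) = - star B x"
  using star_add[of x "- x"] by (simp add: eq_neg_iff_add_eq_0 add.commute)

lemma grad_minus: "grad B (- x) = - grad B x"
  using grad_add[of x "- x"] by (simp add: eq_neg_iff_add_eq_0 add.commute)

lemma star_unit [simp]: "star B (unit B) = unit B"
  by (metis carr_unit carr_star star_mult star_star unit_right)

lemma grad_unit [simp]: "grad B (unit B) = unit B"
  by (metis carr_unit carr_grad grad_mult grad_grad unit_left unit_right)

lemma mult_sum_left: "mult B (\<Sum>i\<in>I. f i) y = (\<Sum>i\<in>I. mult B (f i) y)"
  by (induction I rule: infinite_finite_induct) (auto simp: mult_add_left)

lemma mult_sum_right: "mult B y (\<Sum>i\<in>I. f i) = (\<Sum>i\<in>I. mult B y (f i))"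
  by (induction I rule: infinite_finite_induct) (auto simp: mult_add_right)

lemma smul_sum_right: "smul B c (\<Sum>i\<in>I. f i) = (\<Sum>i\<in>I. smul B c (f i))"
  by (induction I rule: infinite_finite_induct) (auto simp: smul_add_right)

lemma smul_sum_left: "smul B (\<Sum>i\<in>I. f i) x = (\<Sum>i\<in>I. smul B (f i) x)"
  by (induction I rule: infinite_finite_induct) (auto simp: smul_add_left)

lemma star_sum: "star B (\<Sum>i\<in>I. f i) = (\<Sum>i\<in>I. star B (f i))"
  by (induction I rule: infinite_finite_induct) (auto simp: star_add)

lemma grad_sum: "grad B (\<Sum>i\<in>I. f i) = (\<Sum>i\<in>I. grad B (f i))"
  by (induction I rule: infinite_finite_induct) (auto simp: grad_add)

lemma carr_sum: "(\<And>i. i \<in> I \<Longrightarrow> f i \<in> carr B) \<Longrightarrow> (\<Sum>i\<in>I. f i) \<in> carr B"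
  by (induction I rule: infinite_finite_induct) (auto simp: carr_zero carr_add)

lemma inv_in_eqI:
  assumes "x \<in> carr B" "y \<in> carr B" "mult B x y = unit B" "mult B y x = unit B"
  shows "inv_in B x = y"
  unfolding inv_in_def
proof (rule the_equality)
  show "y \<in> carr B \<and> mult B x y = unit B \<and> mult B y x = unit B" using assms by simp
  fix z assume z: "z \<in> carr B \<and> mult B x z = unit B \<and> mult B z x = unit B"
  have "z = mult B (mult B y x) z" using z assms by (simp add: unit_left)
  also have "\<dots> = mult B y (mult B x z)" by (rule mult_assoc)
  also have "\<dots> = y" using z assms(2) by (simp add: unit_right)
  finally show "z = y" .
qed

text \<open>
  Paths of even unitaries give homotopies of OSUs by conjugation; block permutations and the square
  containing \<open>\<beta>[x]\<close> are obtained in this way.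
\<close>

lemma OSU_conj:
  assumes "x \<in> OSU B" "u \<in> carr B" "grad B u = u"
    and "mult B u (star B u) = unit B" "mult B (star B u) u = unit B"
  shows "mult B u (mult B x (star B u)) \<in> OSU B"
proof -
  have x: "x \<in> carr B" "grad B x = - x" "star B x = x" "mult B x x = unit B"
    using assms(1) by (auto simp: OSU_def)
  have "mult B (mult B u (mult B x (star B u))) (mult B u (mult B x (star B u)))
      = mult B u (mult B x (mult B (mult B (star B u) u) (mult B x (star B u))))"
    by (simp add: mult_assoc)
  also have "\<dots> = mult B u (mult B x (mult B x (star B u)))"
    using assms x by (simp add: unit_left carr_mult carr_star)
  also have "\<dots> = mult B u (mult B (mult B x x) (star B u))"
    by (simp add: mult_assoc)
  finally have "mult B (mult B u (mult B x (star B u))) (mult B u (mult B x (star B u))) = unit B"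
    using assms x by (simp add: unit_left carr_star)
  then show ?thesis
    using assms x
    by (simp add: OSU_def carr_mult carr_star grad_mult grad_star mult_minus_left mult_minus_right
        star_mult star_star mult_assoc)
qed

end

lemma star_algebra_base: "star_algebra (base_alg :: 'a::graded_cstar_algebra star_alg)"
  by unfold_locales
    (simp_all add: base_alg_def scaleC_add_right scaleC_add_left scaleC_scaleC scaleC_one
      distrib_left distrib_right mult_scaleC_left mult_scaleC_right mult.assoc cstar_add
      cstar_scaleC cstar_mult cstar_cstar grading_add grading_scaleC grading_mult grading_cstar
      grading_grading)

lemma fun_sum_apply: "(\<Sum>i\<in>I. f i) x = (\<Sum>i\<in>I. f i x)"
  by (induction I rule: infinite_finite_induct) auto

lemma mat_mult_apply: "mat_mult mul m X Y i j = (if i < m \<and> j < m then \<Sum>l<m. mul (X i l) (Y l j) else 0)"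
  by (simp add: mat_mult_def)

lemma (in star_algebra) star_algebra_mat: "star_algebra (mat_alg m B)"
proof
  fix x y z :: "'b matrix" and c c' :: complex
  show "mult (mat_alg m B) (mult (mat_alg m B) x y) z = mult (mat_alg m B) x (mult (mat_alg m B) y z)"
  proof (intro ext)
    fix i j
    have "(\<Sum>l<m. mult B (\<Sum>k<m. mult B (x i k) (y k l)) (z l j)) = 
        (\<Sum>l<m. \<Sum>k<m. mult B (x i k) (mult B (y k l) (z l j)))"
      by (simp add: mult_sum_left mult_assoc)
    also have "\<dots> = (\<Sum>k<m. mult B (x i k) (\<Sum>l<m. mult B (y k l) (z l j)))"
      by (subst sum.swap) (simp add: mult_sum_right)
    finally show "mult (mat_alg m B) (mult (mat_alg m B) x y) z i j
        = mult (mat_alg m B) x (mult (mat_alg m B) y z) i j"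
      by (simp add: mat_alg_def mat_mult_apply cong: sum.cong_simp)
  qed
  show "mult (mat_alg m B) (unit (mat_alg m B)) x = x" if "x \<in> carr (mat_alg m B)"
  proof (intro ext)
    fix i j
    have "(\<Sum>l<m. mult B (if l = i then unit B else 0) (x l j)) = x i j" if "i < m"
      using that \<open>x \<in> _\<close> 
      by (subst sum.remove[of _ i]) (auto simp: mat_alg_def unit_left)
    then show "mult (mat_alg m B) (unit (mat_alg m B)) x i j = x i j"
      using that by (auto simp: mat_alg_def mat_mult_apply mat_diag_def)
  qed
  show "mult (mat_alg m B) x (unit (mat_alg m B)) = x" if "x \<in> carr (mat_alg m B)"
  proof (intro ext)
    fix i j
    have "(\<Sum>l<m. mult B (x i l) (if j = l then unit B else 0)) = x i j" if "j < m"
      using that \<open>x \<in> _\<close>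
      by (subst sum.remove[of _ j]) (auto simp: mat_alg_def unit_right)
    then show "mult (mat_alg m B) x (unit (mat_alg m B)) i j = x i j"
      using that by (auto simp: mat_alg_def mat_mult_apply mat_diag_def)
  qed
qed (auto simp: mat_alg_def mat_mult_apply mat_diag_def fun_eq_iff carr_zero carr_add carr_uminus
      carr_smul carr_unit carr_star carr_grad smul_add_right smul_add_left smul_smul smul_one
      mult_add_left mult_add_right mult_smul_left mult_smul_right star_add star_smul star_mult
      star_star grad_add grad_smul grad_mult grad_star grad_grad sum.distrib smul_sum_right
      star_sum grad_sum intro!: carr_sum carr_mult)

lemma cl_mult_1: "cl_mult 1 mul \<gamma> f g U =
   (if U = {} then mul (f {}) (g {}) + mul (f {1}) (\<gamma> (g {1}))
    else if U = {1} then mul (f {}) (g {1}) + mul (f {1}) (\<gamma> (g {})) else 0)"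
proof -
  have P: "Pow {1..1::nat} = {{}, {1}}" by auto
  have E: "{(s, t). s \<in> S \<and> t \<in> T \<and> t < s} = {}" if "S \<in> {{}, {1::nat}}" "T \<in> {{}, {1}}" for S T
    using that by auto
  have "cl_mult 1 mul \<gamma> f g U = (\<Sum>S\<in>{{}, {1}}. \<Sum>T\<in>{{}, {1}}.
     if sym_diff S T = U then mul (f S) ((\<gamma> ^^ card S) (g T)) else 0)"
    unfolding cl_mult_def P by (intro sum.cong refl) (simp add: E signed_def)
  then show ?thesis by auto
qed

lemma (in star_algebra) star_algebra_cl: "star_algebra (cl_tensor 1 B)"
proof -
  have pow: "(grad B ^^ k) x = (if even k then x else grad B x)" for k x
    by (induction k) (auto simp: grad_grad)
  have sub: "S \<subseteq> {1..1::nat} \<longleftrightarrow> S = {} \<or> S = {1}" for S by auto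
  show ?thesis
    by unfold_locales
     (auto simp: cl_tensor_def sub carr_zero carr_add carr_uminus
      carr_smul carr_unit carr_star carr_grad carr_mult cl_mult_1[unfolded One_nat_def] fun_eq_iff cl_el_def
      signed_def smul_add_right smul_add_left smul_smul smul_one
      mult_add_left mult_add_right mult_smul_left mult_smul_right star_add star_smul star_mult
      star_star grad_add grad_smul grad_mult grad_star grad_grad unit_left unit_right mult_assoc
      algebra_simps smul_minus_right star_minus grad_minus mult_minus_left mult_minus_right pow
      intro!: carr_add carr_mult carr_uminus)
qed


lemma (in star_algebra) mat_alg_simps:
  "mult (mat_alg m B) = mat_mult (mult B) m" "unit (mat_alg m B) = mat_diag m (unit B)"
  "star (mat_alg m B) X = (\<lambda>i j. star B (X j i))" "grad (mat_alg m B) X = (\<lambda>i j. grad B (X i j))"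
  "X \<in> carr (mat_alg m B) \<longleftrightarrow> (\<forall>i j. X i j \<in> carr B) \<and> (\<forall>i j. \<not> (i < m \<and> j < m) \<longrightarrow> X i j = 0)"
  by (auto simp: mat_alg_def)

lemma OSU_mat_iff:
  "X \<in> OSU (mat_alg m B) \<longleftrightarrow> (\<forall>i j. X i j \<in> carr B) \<and> (\<forall>i j. \<not> (i < m \<and> j < m) \<longrightarrow> X i j = 0)
     \<and> (\<forall>i j. grad B (X i j) = - X i j) \<and> (\<forall>i j. star B (X j i) = X i j)
     \<and> mat_mult (mult B) m X X = mat_diag m (unit B)"
  by (auto simp: OSU_def mat_alg_def fun_eq_iff)

lemma OSU_mat_support: "X \<in> OSU (mat_alg m B) \<Longrightarrow> \<not> (i < m \<and> j < m) \<Longrightarrow> X i j = 0"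
  by (auto simp: OSU_mat_iff)

lemma sum_lessThan_add: "(\<Sum>k<m + l. f k) = (\<Sum>k<m. f k) + (\<Sum>k<l. f (m + k :: nat) :: 'c::comm_monoid_add)"
  by (induction l) (simp_all add: add.assoc)

context star_algebra
begin

lemma mat_mult_dsum:
  "mat_mult (mult B) (m + l) (mat_dsum m l X Y) (mat_dsum m l X' Y')
   = mat_dsum m l (mat_mult (mult B) m X X') (mat_mult (mult B) l Y Y')"
  by (intro ext) (auto simp: mat_mult_apply sum_lessThan_add mat_dsum_def not_less)

lemma mat_dsum_diag: "mat_dsum m l (mat_diag m b) (mat_diag l b) = mat_diag (m + l) b"
  by (auto simp: mat_dsum_def mat_diag_def fun_eq_iff)

lemma OSU_dsum:
  assumes "X \<in> OSU (mat_alg m B)" "Y \<in> OSU (mat_alg l B)"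
  shows "mat_dsum m l X Y \<in> OSU (mat_alg (m + l) B)"
  using assms unfolding OSU_mat_iff mat_mult_dsum
  by (auto simp: mat_dsum_diag carr_zero) (auto simp: mat_dsum_def carr_zero)

lemma OSU_diag: "b \<in> OSU B \<Longrightarrow> mat_diag m b \<in> OSU (mat_alg m B)"
  unfolding OSU_mat_iff
  by (auto simp: OSU_def mat_diag_def carr_zero mat_mult_apply fun_eq_iff if_distrib[of "mult B _"]
      if_distrib[of "\<lambda>x. mult B x _"] cong: if_cong)

text \<open>
  The entries of \<open>u X u\<^sup>*\<close> are written out because their continuity in \<open>u\<close> and \<open>X\<close> then involves
  only the linear structure of \<^term>\<open>B\<close>.
\<close>

definition scalar_conj :: "nat \<Rightarrow> (nat \<Rightarrow> nat \<Rightarrow> complex) \<Rightarrow> 'b matrix \<Rightarrow> 'b matrix"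
  where "scalar_conj m u X = (\<lambda>i j. if i < m \<and> j < m
     then \<Sum>k<m. \<Sum>l<m. smul B (u i k * cnj (u j l)) (X k l) else 0)"

lemma OSU_scalar_conj:
  assumes X: "X \<in> OSU (mat_alg m B)"
    and u: "\<And>i j. i < m \<Longrightarrow> j < m \<Longrightarrow> (\<Sum>k<m. u i k * cnj (u j k)) = (if i = j then 1 else 0)"
    and u': "\<And>i j. i < m \<Longrightarrow> j < m \<Longrightarrow> (\<Sum>k<m. cnj (u k i) * u k j) = (if i = j then 1 else 0)"
  shows "scalar_conj m u X \<in> OSU (mat_alg m B)"
proof -
  interpret M: star_algebra "mat_alg m B" by (rule star_algebra_mat)
  define U where "U = (\<lambda>i j. if i < m \<and> j < m then smul B (u i j) (unit B) else 0)"
  have U: "U \<in> carr (mat_alg m B)" "grad (mat_alg m B) U = U"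
    by (auto simp: mat_alg_simps U_def carr_smul carr_unit carr_zero grad_smul fun_eq_iff)
  have "mult (mat_alg m B) U (star (mat_alg m B) U) = unit (mat_alg m B)"
    by (auto simp: mat_alg_simps U_def mat_mult_apply mat_diag_def fun_eq_iff mult_smul_left
        mult_smul_right star_smul unit_left carr_unit smul_smul u[unfolded mult.commute[of "u _ _"]] smul_one simp flip: smul_sum_left)
  moreover have "mult (mat_alg m B) (star (mat_alg m B) U) U = unit (mat_alg m B)"
    by (auto simp: mat_alg_simps U_def mat_mult_apply mat_diag_def fun_eq_iff mult_smul_left
        mult_smul_right star_smul unit_left carr_unit smul_smul u'[unfolded mult.commute[of "cnj _"]] smul_one simp flip: smul_sum_left)
  ultimately have "mult (mat_alg m B) U (mult (mat_alg m B) X (star (mat_alg m B) U)) \<in> OSU (mat_alg m B)"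
    by (intro M.OSU_conj X U)
  moreover have "mult (mat_alg m B) U (mult (mat_alg m B) X (star (mat_alg m B) U)) = scalar_conj m u X"
  proof (intro ext)
    fix i j
    have carr: "X k l \<in> carr B" for k l using X by (simp add: OSU_mat_iff)
    show "mult (mat_alg m B) U (mult (mat_alg m B) X (star (mat_alg m B) U)) i j = scalar_conj m u X i j"
      by (simp add: mat_alg_simps U_def mat_mult_apply scalar_conj_def mult_smul_left mult_sum_right
          mult_smul_right star_smul unit_left unit_right carr_unit carr smul_smul mult.commute
          cong: sum.cong_simp)
  qed
  ultimately show ?thesis by simp
qed

lemma scalar_conj_diag:
  assumes u: "\<And>i j. i < m \<Longrightarrow> j < m \<Longrightarrow> (\<Sum>k<m. u i k * cnj (u j k)) = (if i = j then 1 else 0)"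
  shows "scalar_conj m u (mat_diag m r) = mat_diag m r"
proof (intro ext)
  fix i j
  have "(\<Sum>l<m. smul B (u i k * cnj (u j l)) (mat_diag m r k l)) = smul B (u i k * cnj (u j k)) r" if "k < m" for k
    using that by (simp add: mat_diag_def if_distrib[of "smul B _"] cong: if_cong)
  then show "scalar_conj m u (mat_diag m r) i j = mat_diag m r i j"
    by (simp add: scalar_conj_def u smul_one flip: smul_sum_left) (auto simp: mat_diag_def smul_one)
qed

end

section \<open>Permuting the indices of a matrix OSU\<close>

lemma continuous_on_entry:
  assumes "continuous_on S f"
  shows "continuous_on S (\<lambda>x. f x i j)"
proof -
  have "continuous_on S (\<lambda>x. f x i)" using assms by (rule continuous_on_product_then_coordinatewise)
  then show ?thesis by (rule continuous_on_product_then_coordinatewise)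
qed

lemma continuous_on_matrixI:
  assumes "\<And>i j. continuous_on S (\<lambda>x. f x i j)"
  shows "continuous_on S f"
  by (intro continuous_on_coordinatewise_then_product assms)

text \<open>
  Continuity of the multiplication is not part of the axioms: on the Clifford extension it involves
  the grading \<open>\<gamma>\<close>, whose continuity is a theorem (\<open>norm_grading\<close> below).
\<close>

locale top_star_algebra = star_algebra B for B :: "'b::{ab_group_add,topological_space} star_alg" +
  assumes continuous_plus: "continuous_on UNIV (\<lambda>p::'b \<times> 'b. fst p + snd p)"
    and continuous_smul: "continuous_on UNIV (\<lambda>p. smul B (fst p) (snd p))"
begin

lemma continuous_on_plus:
  assumes "continuous_on S f" "continuous_on S g"
  shows "continuous_on S (\<lambda>x. f x + g x :: 'b)"
  using continuous_on_compose2[OF continuous_plus continuous_on_Pair[OF assms]] by simp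

lemma continuous_on_smul:
  assumes "continuous_on S f" "continuous_on S g"
  shows "continuous_on S (\<lambda>x. smul B (f x) (g x))"
  using continuous_on_compose2[OF continuous_smul continuous_on_Pair[OF assms]] by simp

lemma continuous_on_finite_sum:
  assumes "\<And>i. i \<in> I \<Longrightarrow> continuous_on S (f i)"
  shows "continuous_on S (\<lambda>x. \<Sum>i\<in>I. f i x :: 'b)"
  using assms by (induction I rule: infinite_finite_induct) (auto intro: continuous_on_plus)

text \<open>
  Fixing the matrices \<open>diag(r, \<dots>, r)\<close> makes an isotopy act on loops based at \<open>\<rho>\<close>.
\<close>

definition OSU_isotopy :: "nat \<Rightarrow> (real \<Rightarrow> 'b matrix \<Rightarrow> 'b matrix) \<Rightarrow> bool"
  where "OSU_isotopy m h \<longleftrightarrow> continuous_on UNIV (\<lambda>p. h (fst p) (snd p)) \<and>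
    (\<forall>s. \<forall>X\<in>OSU (mat_alg m B). h s X \<in> OSU (mat_alg m B)) \<and>
    (\<forall>X\<in>OSU (mat_alg m B). h 0 X = X) \<and>
    (\<forall>s r. h s (mat_diag m r) = mat_diag m r)"

text \<open>
  For an involutive permutation matrix \<open>P\<close> the unitaries \<open>cos (\<pi> s / 2) + i sin (\<pi> s / 2) P\<close>
  connect \<open>1\<close> with \<open>i P\<close>, and conjugation by \<open>i P\<close> permutes the indices.
\<close>

lemma involution_isotopy:
  assumes \<sigma>: "\<And>i. i < m \<Longrightarrow> \<sigma> i < m" "\<And>i. i < m \<Longrightarrow> \<sigma> (\<sigma> i) = i"
  shows "\<exists>h. OSU_isotopy m h \<and>
    (\<forall>X\<in>OSU (mat_alg m B). \<forall>i<m. \<forall>j<m. h 1 X i j = X (\<sigma> i) (\<sigma> j))"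
proof -
  define u :: "real \<Rightarrow> nat \<Rightarrow> nat \<Rightarrow> complex" where
    "u s i j = complex_of_real (cos (pi * s / 2)) * of_bool (i = j)
       + \<i> * complex_of_real (sin (pi * s / 2)) * of_bool (\<sigma> i = j)" for s i j
  have inj: "\<sigma> i = \<sigma> j \<longleftrightarrow> i = j" if "i < m" "j < m" for i j using \<sigma> that by metis
  have sw: "\<sigma> i = j \<longleftrightarrow> \<sigma> j = i" if "i < m" "j < m" for i j using \<sigma> that by metis
  have row: "(\<Sum>k<m. u s i k * f k)
      = complex_of_real (cos (pi * s / 2)) * f i + \<i> * complex_of_real (sin (pi * s / 2)) * f (\<sigma> i)"
    if "i < m" for s i f
  proof -
    have "(\<Sum>k<m. u s i k * f k) = (\<Sum>k<m. (if k = i then complex_of_real (cos (pi * s / 2)) * f i else 0)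
       + (if k = \<sigma> i then \<i> * complex_of_real (sin (pi * s / 2)) * f (\<sigma> i) else 0))"
      by (intro sum.cong) (auto simp: u_def distrib_right)
    then show ?thesis using that \<sigma>(1)[OF that] by (simp add: sum.distrib)
  qed
  have sq: "complex_of_real (cos x) * complex_of_real (cos x) + complex_of_real (sin x) * complex_of_real (sin x) = 1" for x
    by (metis sin_cos_squared_add2 add.commute of_real_1 of_real_add of_real_mult power2_eq_square)
  have u1: "(\<Sum>k<m. u s i k * cnj (u s j k)) = (if i = j then 1 else 0)" if "i < m" "j < m" for s i j
    unfolding row[OF that(1)] using that \<sigma> sq[of "pi * s / 2"] inj[OF that]
    by (auto simp: u_def algebra_simps of_bool_def)
  have sym: "u s k i = u s i k" if "i < m" "k < m" for s i k
    using that sw by (auto simp: u_def)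
  have u2: "(\<Sum>k<m. cnj (u s k i) * u s k j) = (if i = j then 1 else 0)" if "i < m" "j < m" for s i j
  proof -
    have "(\<Sum>k<m. cnj (u s k i) * u s k j) = (\<Sum>k<m. u s j k * cnj (u s i k))"
      using that sym by (intro sum.cong) (auto simp: mult.commute)
    then show ?thesis using u1[of j i] that by simp
  qed
  show ?thesis
    unfolding OSU_isotopy_def
  proof (intro exI[of _ "\<lambda>s. scalar_conj m (u s)"] conjI allI ballI impI)
    show "continuous_on UNIV (\<lambda>p. scalar_conj m (u (fst p)) (snd p))"
    proof (rule continuous_on_matrixI)
      fix i j
      have ent: "continuous_on UNIV (\<lambda>p::real \<times> 'b matrix. snd p k l)" for k l
        by (rule continuous_on_entry[OF continuous_on_snd[OF continuous_on_id]])
      have trig: "continuous_on UNIV (\<lambda>p::real \<times> 'b matrix. cos (pi * fst p / 2))"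
        "continuous_on UNIV (\<lambda>p::real \<times> 'b matrix. sin (pi * fst p / 2))"
        by (rule continuous_on_compose2[of UNIV "\<lambda>s::real. cos (pi * s / 2)", OF _ continuous_on_fst[OF continuous_on_id]]
            continuous_on_compose2[of UNIV "\<lambda>s::real. sin (pi * s / 2)", OF _ continuous_on_fst[OF continuous_on_id]];
            auto intro!: continuous_intros)+
      show "continuous_on UNIV (\<lambda>p. scalar_conj m (u (fst p)) (snd p) i j)"
        unfolding scalar_conj_def u_def
        by (cases "i < m \<and> j < m")
           (auto intro!: continuous_on_finite_sum continuous_on_smul continuous_intros ent trig)
    qed
    fix X assume X: "X \<in> OSU (mat_alg m B)"
    show "scalar_conj m (u s) X \<in> OSU (mat_alg m B)" for s
      by (rule OSU_scalar_conj[OF X u1 u2])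
    have two: "(\<Sum>k<m. \<Sum>l<m. smul B (of_bool (k = i) * of_bool (l = j)) (X k l)) = X i j" if "i < m" "j < m" for i j
    proof -
      have "(\<Sum>l<m. smul B (of_bool (k = i) * of_bool (l = j)) (X k l)) = (if k = i then X i j else 0)" if "k < m" for k
        using that \<open>j < m\<close> by (subst sum.remove[of _ j]) (auto simp: smul_one intro!: sum.neutral)
      then show ?thesis using that by simp
    qed
    have u0: "u 0 i k * cnj (u 0 j l) = of_bool (k = i) * of_bool (l = j)" for i j k l
      by (simp add: u_def)
    show "scalar_conj m (u 0) X = X"
    proof (intro ext)
      fix i j
      show "scalar_conj m (u 0) X i j = X i j"
        using OSU_mat_support[OF X, of i j] by (simp add: scalar_conj_def u0 two)
    qed
    have u1: "u 1 i k * cnj (u 1 j l) = of_bool (k = \<sigma> i) * of_bool (l = \<sigma> j)" for i j k l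
      by (simp add: u_def)
    show "scalar_conj m (u 1) X i j = X (\<sigma> i) (\<sigma> j)" if "i < m" "j < m" for i j
      using that \<sigma> by (simp add: scalar_conj_def u1 two)
  next
    show "scalar_conj m (u s) (mat_diag m r) = mat_diag m r" for s r
      by (rule scalar_conj_diag[OF u1])
  qed
qed

end

text \<open>
  Interchanging two blocks of different size is not an involution in general, but it is a product of two: the
  reversal of all indices and the reversal of the indices within each block.
\<close>

lemma (in top_star_algebra) block_swap_isotopy:
  "\<exists>h h'. OSU_isotopy (m + l) h \<and> OSU_isotopy (m + l) h' \<and>
    (\<forall>X\<in>OSU (mat_alg m B). \<forall>Y\<in>OSU (mat_alg l B). h' 1 (h 1 (mat_dsum m l X Y)) = mat_dsum l m Y X)"
proof -
  define \<sigma> where "\<sigma> i = m + l - 1 - i" for i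
  define \<sigma>' where "\<sigma>' i = (if i < l then l - 1 - i else 2 * l + m - 1 - i)" for i
  have \<sigma>: "\<sigma> i < m + l" "\<sigma> (\<sigma> i) = i" if "i < m + l" for i
    using that by (auto simp: \<sigma>_def)
  have \<sigma>': "\<sigma>' i < m + l" "\<sigma>' (\<sigma>' i) = i" if "i < m + l" for i
    using that by (auto simp: \<sigma>'_def)
  obtain h where h: "OSU_isotopy (m + l) h"
    "\<forall>X\<in>OSU (mat_alg (m + l) B). \<forall>i<m + l. \<forall>j<m + l. h 1 X i j = X (\<sigma> i) (\<sigma> j)"
    using involution_isotopy[of "m + l" \<sigma>, OF \<sigma>] by blast
  obtain h' where h': "OSU_isotopy (m + l) h'"
    "\<forall>X\<in>OSU (mat_alg (m + l) B). \<forall>i<m + l. \<forall>j<m + l. h' 1 X i j = X (\<sigma>' i) (\<sigma>' j)"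
    using involution_isotopy[of "m + l" \<sigma>', OF \<sigma>'] by blast
  have "h' 1 (h 1 (mat_dsum m l X Y)) = mat_dsum l m Y X"
    if X: "X \<in> OSU (mat_alg m B)" and Y: "Y \<in> OSU (mat_alg l B)" for X Y
  proof (intro ext)
    fix i j
    let ?Z = "mat_dsum m l X Y"
    have Z: "?Z \<in> OSU (mat_alg (m + l) B)" by (rule OSU_dsum[OF X Y])
    then have hZ: "h 1 ?Z \<in> OSU (mat_alg (m + l) B)" using h(1) by (auto simp: OSU_isotopy_def)
    then have hhZ: "h' 1 (h 1 ?Z) \<in> OSU (mat_alg (m + l) B)" using h'(1) by (auto simp: OSU_isotopy_def)
    show "h' 1 (h 1 ?Z) i j = mat_dsum l m Y X i j"
    proof (cases "i < m + l \<and> j < m + l")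
      case True
      then have "h' 1 (h 1 ?Z) i j = ?Z (\<sigma> (\<sigma>' i)) (\<sigma> (\<sigma>' j))"
        using h'(2) hZ h(2) Z \<sigma>'(1) by simp
      moreover have "\<sigma> (\<sigma>' k) = (if k < l then m + k else k - l)" if "k < m + l" for k
        using that by (auto simp: \<sigma>_def \<sigma>'_def)
      ultimately show ?thesis using True by (auto simp: mat_dsum_def)
    next
      case False
      then show ?thesis
        using OSU_mat_support[OF hhZ False] OSU_mat_support[OF OSU_dsum[OF Y X], of i j]
        by (auto simp: add.commute)
    qed
  qed
  then show ?thesis using h(1) h'(1) by blast
qed


section \<open>Van Daele semigroups and their Grothendieck groups\<close>

text \<open>
  Adding the empty basepoint is the identity only up to homotopy: a loop is a function on all of
  \<open>\<real>\<close>, constrained on \<open>[0, 1]\<close> only, and the direct sum truncates its other values.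
\<close>

locale vd_monoid =
  fixes D :: "'x vd_data"
  assumes sum_obj: "x \<in> vd_obj D m \<Longrightarrow> y \<in> vd_obj D l \<Longrightarrow> vd_sum D m l x y \<in> vd_obj D (m + l)"
    and base_obj: "vd_base D m \<in> vd_obj D m"
    and htp_refl: "x \<in> vd_obj D m \<Longrightarrow> vd_htp D m x x"
    and htp_sym: "vd_htp D m x y \<Longrightarrow> vd_htp D m y x"
    and htp_trans: "vd_htp D m x y \<Longrightarrow> vd_htp D m y z \<Longrightarrow> vd_htp D m x z"
    and htp_sum: "vd_htp D m x x' \<Longrightarrow> vd_htp D l y y' \<Longrightarrow>
      vd_htp D (m + l) (vd_sum D m l x y) (vd_sum D m l x' y')"
    and sum_assoc: "vd_sum D (m + l) k (vd_sum D m l x y) z = vd_sum D m (l + k) x (vd_sum D l k y z)"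
    and sum_base_zero: "x \<in> vd_obj D m \<Longrightarrow> vd_htp D m (vd_sum D m 0 x (vd_base D 0)) x"
    and base_sum: "vd_sum D m l (vd_base D m) (vd_base D l) = vd_base D (m + l)"
    and sum_comm: "x \<in> vd_obj D m \<Longrightarrow> y \<in> vd_obj D l \<Longrightarrow>
      vd_htp D (m + l) (vd_sum D m l x y) (vd_sum D l m y x)"
begin

definition stab :: "nat \<Rightarrow> nat \<Rightarrow> 'x \<Rightarrow> 'x"
  where "stab n m x = vd_sum D m (n - m) x (vd_base D (n - m))"

lemma stab_obj: "x \<in> vd_obj D m \<Longrightarrow> m \<le> n \<Longrightarrow> stab n m x \<in> vd_obj D n"
  using sum_obj[OF _ base_obj, of x m "n - m"] by (simp add: stab_def)

lemma stab_self: "x \<in> vd_obj D m \<Longrightarrow> vd_htp D m (stab m m x) x"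
  by (simp add: stab_def sum_base_zero)

lemma stab_stab: "m \<le> n \<Longrightarrow> n \<le> k \<Longrightarrow> stab k n (stab n m x) = stab k m x"
  using sum_assoc[of m "n - m" "k - n" x "vd_base D (n - m)" "vd_base D (k - n)"]
  by (simp add: stab_def base_sum)

lemma htp_stab: "vd_htp D n x y \<Longrightarrow> n \<le> k \<Longrightarrow> vd_htp D k (stab k n x) (stab k n y)"
  using htp_sum[OF _ htp_refl[OF base_obj], of n x y "k - n"] by (simp add: stab_def)

lemma vd_elems_iff: "(m, x) \<in> vd_elems D \<longleftrightarrow> 1 \<le> m \<and> x \<in> vd_obj D m"
  by (auto simp: vd_elems_def)

lemma vd_rel_iff: "((m, x), (l, y)) \<in> vd_rel D \<longleftrightarrow> (m, x) \<in> vd_elems D \<and> (l, y) \<in> vd_elems D \<and>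
    (\<exists>n. m \<le> n \<and> l \<le> n \<and> vd_htp D n (stab n m x) (stab n l y))"
  by (simp add: vd_rel_def stab_def)

lemma vd_rel_htp:
  assumes "1 \<le> m" "x \<in> vd_obj D m" "y \<in> vd_obj D m" "vd_htp D m x y"
  shows "((m, x), (m, y)) \<in> vd_rel D"
  using assms htp_trans[OF stab_self[OF assms(2)] htp_trans[OF assms(4) htp_sym[OF stab_self[OF assms(3)]]]]
  by (auto simp: vd_rel_iff vd_elems_iff intro!: exI[of _ m])

lemma equiv_vd_rel: "equiv (vd_elems D) (vd_rel D)"
proof (rule equivI)
  show "vd_rel D \<subseteq> vd_elems D \<times> vd_elems D" by (auto simp: vd_rel_def)
  show "refl_on (vd_elems D) (vd_rel D)"
  proof (rule refl_onI)
    fix p assume p: "p \<in> vd_elems D"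
    obtain m x where "p = (m, x)" by (cases p)
    then show "(p, p) \<in> vd_rel D"
      using p by (auto simp: vd_elems_iff intro!: vd_rel_htp htp_refl)
  qed
  show "sym (vd_rel D)"
    by (rule symI, clarsimp simp: vd_rel_iff) (blast intro: htp_sym)
  show "trans (vd_rel D)"
  proof (rule transI)
    fix p q r assume *: "(p, q) \<in> vd_rel D" "(q, r) \<in> vd_rel D"
    obtain m x l y k z where pqr: "p = (m, x)" "q = (l, y)" "r = (k, z)"
      by (cases p, cases q, cases r)
    from *(1) obtain n where n: "(m, x) \<in> vd_elems D" "m \<le> n" "l \<le> n" "vd_htp D n (stab n m x) (stab n l y)"
      by (auto simp: pqr vd_rel_iff)
    from *(2) obtain n' where n': "(k, z) \<in> vd_elems D" "l \<le> n'" "k \<le> n'" "vd_htp D n' (stab n' l y) (stab n' k z)"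
      by (auto simp: pqr vd_rel_iff)
    let ?N = "max n n'"
    have "vd_htp D ?N (stab ?N m x) (stab ?N l y)"
      using htp_stab[OF n(4), of ?N] n by (simp add: stab_stab)
    moreover have "vd_htp D ?N (stab ?N l y) (stab ?N k z)"
      using htp_stab[OF n'(4), of ?N] n' by (simp add: stab_stab)
    ultimately have "vd_htp D ?N (stab ?N m x) (stab ?N k z)" by (rule htp_trans)
    then show "(p, r) \<in> vd_rel D"
      using n n' by (auto simp: pqr vd_rel_iff intro!: exI[of _ ?N])
  qed
qed

lemma vd_class_eqI: "((m, x), (l, y)) \<in> vd_rel D \<Longrightarrow> vd_class D m x = vd_class D l y"
  unfolding vd_class_def by (rule equiv_class_eq[OF equiv_vd_rel])

lemma vd_class_self: "(m, x) \<in> vd_elems D \<Longrightarrow> (m, x) \<in> vd_class D m x"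
  unfolding vd_class_def by (rule equiv_class_self[OF equiv_vd_rel])

lemma sum_elems: "(m, x) \<in> vd_elems D \<Longrightarrow> (l, y) \<in> vd_elems D \<Longrightarrow> (m + l, vd_sum D m l x y) \<in> vd_elems D"
  by (simp add: vd_elems_iff sum_obj)

text \<open>
  Stabilising \<open>x \<oplus> y\<close> appends all basepoints at the end, whereas \<open>x\<close> and \<open>y\<close> are stabilised
  separately in the hypotheses; commutativity moves the basepoints of \<open>x\<close> past \<open>y\<close>.
\<close>

lemma vd_rel_sum:
  assumes "((m, x), (m', x')) \<in> vd_rel D" "((l, y), (l', y')) \<in> vd_rel D"
  shows "((m + l, vd_sum D m l x y), (m' + l', vd_sum D m' l' x' y')) \<in> vd_rel D"
proof -
  have spread: "vd_htp D (N + N') (stab (N + N') (m + l) (vd_sum D m l x y))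
        (vd_sum D N N' (stab N m x) (stab N' l y))"
    if x: "x \<in> vd_obj D m" and y: "y \<in> vd_obj D l" and "m \<le> N" "l \<le> N'" for m l x y N N'
  proof -
    obtain a b where N: "N = m + a" "N' = l + b"
      using le_Suc_ex[OF \<open>m \<le> N\<close>] le_Suc_ex[OF \<open>l \<le> N'\<close>] by blast
    let ?S = "vd_sum D" and ?b = "vd_base D"
    have "?S (m + l) (a + b) (?S m l x y) (?b (a + b)) = ?S (m + (l + a)) b (?S m (l + a) x (?S l a y (?b a))) (?b b)"
      using sum_assoc[of "m + l" a b "?S m l x y" "?b a" "?b b"] sum_assoc[of m l a x y "?b a"]
      by (simp only: base_sum add.assoc)
    moreover have "vd_htp D (m + (l + a) + b) \<dots> (?S (m + (l + a)) b (?S m (l + a) x (?S a l (?b a) y)) (?b b))"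
      by (intro htp_sum htp_refl x base_obj sum_comm y)
    moreover have "?S (m + (l + a)) b (?S m (l + a) x (?S a l (?b a) y)) (?b b)
        = ?S (m + a) (l + b) (?S m a x (?b a)) (?S l b y (?b b))"
      using sum_assoc[of m "l + a" b x "?S a l (?b a) y" "?b b"] sum_assoc[of a l b "?b a" y "?b b"]
        sum_assoc[of m a "l + b" x "?b a" "?S l b y (?b b)"]
      by (simp only: add.assoc add.left_commute[of l a b] add.commute[of l a])
    moreover have "N + N' = m + (l + a) + b" "N + N' - (m + l) = a + b" "N - m = a" "N' - l = b"
      by (simp_all add: N)
    ultimately show ?thesis by (simp only: stab_def N(1)[symmetric] N(2)[symmetric])
  qed
  obtain N where N: "m \<le> N" "m' \<le> N" "vd_htp D N (stab N m x) (stab N m' x')"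
    using assms(1) by (auto simp: vd_rel_iff)
  obtain N' where N': "l \<le> N'" "l' \<le> N'" "vd_htp D N' (stab N' l y) (stab N' l' y')"
    using assms(2) by (auto simp: vd_rel_iff)
  have el: "(m, x) \<in> vd_elems D" "(m', x') \<in> vd_elems D" "(l, y) \<in> vd_elems D" "(l', y') \<in> vd_elems D"
    using assms by (auto simp: vd_rel_iff)
  then have ob: "x \<in> vd_obj D m" "x' \<in> vd_obj D m'" "y \<in> vd_obj D l" "y' \<in> vd_obj D l'"
    by (auto simp: vd_elems_iff)
  have "vd_htp D (N + N') (stab (N + N') (m + l) (vd_sum D m l x y))
        (stab (N + N') (m' + l') (vd_sum D m' l' x' y'))"
    by (rule htp_trans[OF spread[OF ob(1,3) N(1) N'(1)]
          htp_trans[OF htp_sum[OF N(3) N'(3)] htp_sym[OF spread[OF ob(2,4) N(2) N'(2)]]]])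
  then show ?thesis
    using el N N' by (auto simp: vd_rel_iff sum_elems intro!: exI[of _ "N + N'"] add_mono)
qed

lemma vd_plus_class:
  assumes "(m, x) \<in> vd_elems D" "(l, y) \<in> vd_elems D"
  shows "vd_plus D (vd_class D m x) (vd_class D l y) = vd_class D (m + l) (vd_sum D m l x y)"
proof -
  have "vd_class D (m' + l') (vd_sum D m' l' x' y') = vd_class D (m + l) (vd_sum D m l x y)"
    if "(m', x') \<in> vd_class D m x" "(l', y') \<in> vd_class D l y" for m' x' l' y'
    using that by (auto simp: vd_class_def intro!: equiv_class_eq[OF equiv_vd_rel, symmetric] vd_rel_sum)
  moreover have "(m, x) \<in> vd_class D m x" "(l, y) \<in> vd_class D l y"
    using assms by (auto intro: vd_class_self)
  ultimately show ?thesis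
    unfolding vd_plus_def by (intro subset_antisym) blast+
qed

lemma vd_semigroup_iff: "a \<in> vd_semigroup D \<longleftrightarrow> (\<exists>m x. (m, x) \<in> vd_elems D \<and> a = vd_class D m x)"
  by (auto simp: vd_semigroup_def quotient_def vd_class_def)

lemma vd_class_semigroup: "(m, x) \<in> vd_elems D \<Longrightarrow> vd_class D m x \<in> vd_semigroup D"
  by (auto simp: vd_semigroup_iff)

lemma vd_plus_closed: "a \<in> vd_semigroup D \<Longrightarrow> b \<in> vd_semigroup D \<Longrightarrow> vd_plus D a b \<in> vd_semigroup D"
  by (auto simp: vd_semigroup_iff vd_plus_class) (blast intro: sum_elems)

lemma vd_plus_assoc:
  assumes "a \<in> vd_semigroup D" "b \<in> vd_semigroup D" "c \<in> vd_semigroup D"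
  shows "vd_plus D (vd_plus D a b) c = vd_plus D a (vd_plus D b c)"
  using assms by (auto simp: vd_semigroup_iff vd_plus_class sum_elems sum_assoc add.assoc)

lemma vd_plus_comm:
  assumes "a \<in> vd_semigroup D" "b \<in> vd_semigroup D"
  shows "vd_plus D a b = vd_plus D b a"
proof -
  obtain m x l y where *: "(m, x) \<in> vd_elems D" "a = vd_class D m x" "(l, y) \<in> vd_elems D" "b = vd_class D l y"
    using assms by (auto simp: vd_semigroup_iff)
  have "((m + l, vd_sum D m l x y), (m + l, vd_sum D l m y x)) \<in> vd_rel D"
    using * sum_obj[of y l x m]
    by (intro vd_rel_htp sum_obj sum_comm) (auto simp: vd_elems_iff add.commute)
  then show ?thesis
    using * by (simp add: vd_plus_class vd_class_eqI add.commute)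
qed

lemma groth_rel_sym: "(p, q) \<in> groth_rel D \<Longrightarrow> (q, p) \<in> groth_rel D"
  by (auto simp: groth_rel_def)

lemma groth_rel_trans:
  assumes "(p, q) \<in> groth_rel D" "(q, r) \<in> groth_rel D"
  shows "(p, r) \<in> groth_rel D"
proof -
  let ?V = "vd_semigroup D"
  obtain a b a' b' a'' b'' where pqr: "p = (a, b)" "q = (a', b')" "r = (a'', b'')"
    by (cases p, cases q, cases r)
  obtain c where c: "c \<in> ?V" "vd_plus D (vd_plus D a b') c = vd_plus D (vd_plus D a' b) c"
    and V: "a \<in> ?V" "b \<in> ?V" "a' \<in> ?V" "b' \<in> ?V"
    using assms(1) by (auto simp: pqr groth_rel_def)
  obtain d where d: "d \<in> ?V" "vd_plus D (vd_plus D a' b'') d = vd_plus D (vd_plus D a'' b') d"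
    and V': "a'' \<in> ?V" "b'' \<in> ?V"
    using assms(2) by (auto simp: pqr groth_rel_def)
  note V = V V' c(1) d(1)
  have lcomm: "vd_plus D x (vd_plus D y z) = vd_plus D y (vd_plus D x z)"
    if "x \<in> ?V" "y \<in> ?V" "z \<in> ?V" for x y z
    using that vd_plus_assoc vd_plus_comm by metis
  note ac = vd_plus_assoc vd_plus_comm lcomm vd_plus_closed
  \<comment> \<open>Adding the two equations, everything but \<open>a + b''\<close> and \<open>a'' + b\<close> is collected in \<open>?k\<close>.\<close>
  let ?k = "vd_plus D (vd_plus D b' c) (vd_plus D a' d)"
  have "vd_plus D (vd_plus D a b'') ?k
      = vd_plus D (vd_plus D (vd_plus D a b') c) (vd_plus D (vd_plus D a' b'') d)"
    using V by (simp add: ac)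
  also have "\<dots> = vd_plus D (vd_plus D (vd_plus D a' b) c) (vd_plus D (vd_plus D a'' b') d)"
    by (simp add: c d)
  also have "\<dots> = vd_plus D (vd_plus D a'' b) ?k"
    using V by (simp add: ac)
  finally show ?thesis
    using V by (auto simp: pqr groth_rel_def vd_plus_closed intro!: bexI[of _ ?k])
qed

lemma groth_rel_refl: "a \<in> vd_semigroup D \<Longrightarrow> b \<in> vd_semigroup D \<Longrightarrow> ((a, b), (a, b)) \<in> groth_rel D"
  by (auto simp: groth_rel_def)

lemma groth_class_eq: "(p, q) \<in> groth_rel D \<Longrightarrow> groth_rel D `` {p} = groth_rel D `` {q}"
  using groth_rel_sym groth_rel_trans by blast

lemma DK_cases:
  assumes "c \<in> DK D"
  obtains m x l y where "(m, x) \<in> vd_elems D" "(l, y) \<in> vd_elems D" "c = DK_diff D (m, x) (l, y)"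
  using assms by (auto simp: DK_def quotient_def DK_diff_def vd_semigroup_iff)

lemma DK_diff_cong:
  assumes "((m, x), (m', x')) \<in> vd_rel D" "((l, y), (l', y')) \<in> vd_rel D"
  shows "DK_diff D (m, x) (l, y) = DK_diff D (m', x') (l', y')"
  using assms by (simp add: DK_diff_def vd_class_eqI)

end

text \<open>
  The conclusion of this locale is \<open>induced_DK_diff\<close>: the map of Grothendieck groups that is defined
  as a union over representatives takes \<open>[x] - [y]\<close> to \<open>[f x] - [f y]\<close>.
\<close>

locale vd_hom = vd_monoid D + D': vd_monoid D' for D :: "'x vd_data" and D' :: "'y vd_data" +
  fixes f :: "nat \<Rightarrow> 'x \<Rightarrow> 'y"
  assumes f_rel: "((m, x), (l, y)) \<in> vd_rel D \<Longrightarrow> ((m, f m x), (l, f l y)) \<in> vd_rel D'"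
    and f_sum: "(m, x) \<in> vd_elems D \<Longrightarrow> (l, y) \<in> vd_elems D \<Longrightarrow>
      f (m + l) (vd_sum D m l x y) = vd_sum D' m l (f m x) (f l y)"
begin

definition induced :: "(nat \<times> 'x) set \<Rightarrow> (nat \<times> 'y) set"
  where "induced a = (\<Union>(m, x)\<in>a. vd_class D' m (f m x))"

lemma f_elems: "(m, x) \<in> vd_elems D \<Longrightarrow> (m, f m x) \<in> vd_elems D'"
  using f_rel[of m x m x] equiv_class_self[OF equiv_vd_rel] by (auto simp: D'.vd_rel_iff)

lemma induced_class: "(m, x) \<in> vd_elems D \<Longrightarrow> induced (vd_class D m x) = vd_class D' m (f m x)"
proof -
  assume mx: "(m, x) \<in> vd_elems D"
  have "vd_class D' l (f l y) = vd_class D' m (f m x)" if "(l, y) \<in> vd_class D m x" for l y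
    using that by (auto simp: vd_class_def intro!: equiv_class_eq[OF D'.equiv_vd_rel, symmetric] f_rel)
  then show ?thesis
    using vd_class_self[OF mx] unfolding induced_def by (intro subset_antisym) blast+
qed

lemma induced_closed: "a \<in> vd_semigroup D \<Longrightarrow> induced a \<in> vd_semigroup D'"
  by (auto simp: vd_semigroup_iff induced_class f_elems D'.vd_class_semigroup)

lemma induced_plus:
  "a \<in> vd_semigroup D \<Longrightarrow> b \<in> vd_semigroup D \<Longrightarrow> induced (vd_plus D a b) = vd_plus D' (induced a) (induced b)"
  by (auto simp: vd_semigroup_iff induced_class vd_plus_class D'.vd_plus_class sum_elems f_elems f_sum)

lemma induced_DK_diff:
  assumes "(m, x) \<in> vd_elems D" "(l, y) \<in> vd_elems D"
  shows "(\<Union>(a, b)\<in>DK_diff D (m, x) (l, y). groth_rel D' `` {(induced a, induced b)})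
    = DK_diff D' (m, f m x) (l, f l y)"
proof -
  let ?a = "vd_class D m x" and ?b = "vd_class D l y"
  have V: "?a \<in> vd_semigroup D" "?b \<in> vd_semigroup D" using assms by (auto intro: vd_class_semigroup)
  have "groth_rel D' `` {(induced a, induced b)} = groth_rel D' `` {(induced ?a, induced ?b)}"
    if ab: "((?a, ?b), (a, b)) \<in> groth_rel D" for a b
  proof (rule D'.groth_class_eq[OF D'.groth_rel_sym])
    obtain c where c: "c \<in> vd_semigroup D" "vd_plus D (vd_plus D ?a b) c = vd_plus D (vd_plus D a ?b) c"
      and V': "a \<in> vd_semigroup D" "b \<in> vd_semigroup D"
      using ab by (auto simp: groth_rel_def)
    have "vd_plus D' (vd_plus D' (induced ?a) (induced b)) (induced c)
        = vd_plus D' (vd_plus D' (induced a) (induced ?b)) (induced c)"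
      using arg_cong[OF c(2), of induced] V V' c(1) by (simp add: induced_plus vd_plus_closed)
    then show "((induced ?a, induced ?b), (induced a, induced b)) \<in> groth_rel D'"
      using V V' c(1) by (auto simp: groth_rel_def induced_closed intro!: bexI[of _ "induced c"])
  qed
  moreover have "((?a, ?b), (?a, ?b)) \<in> groth_rel D" using V by (rule groth_rel_refl)
  ultimately show ?thesis
    using assms by (simp add: DK_diff_def induced_class) blast
qed

end

section \<open>Scalars and topology\<close>

lemma module_scaleC: "module (scaleC :: complex \<Rightarrow> 'a::complex_algebra \<Rightarrow> 'a)"
  by unfold_locales (simp_all add: scaleC_add_right scaleC_add_left scaleC_scaleC scaleC_one)

interpretation scaleC: module "scaleC :: complex \<Rightarrow> 'a::complex_algebra \<Rightarrow> 'a"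
  by (rule module_scaleC)

lemma bounded_bilinear_scaleC: "bounded_bilinear (scaleC :: complex \<Rightarrow> 'a::cstar_algebra \<Rightarrow> 'a)"
proof
  fix a a' :: complex and b b' :: 'a and r :: real
  show "(a + a') *\<^sub>C b = a *\<^sub>C b + a' *\<^sub>C b" "a *\<^sub>C (b + b') = a *\<^sub>C b + a *\<^sub>C b'"
    by (simp_all add: scaleC_add_left scaleC_add_right)
  show "(r *\<^sub>R a) *\<^sub>C b = r *\<^sub>R a *\<^sub>C b" "a *\<^sub>C r *\<^sub>R b = r *\<^sub>R a *\<^sub>C b"
    by (simp_all add: scaleR_scaleC scaleC_scaleC scaleR_conv_of_real mult.commute)
  show "\<exists>K. \<forall>a (b::'a). norm (a *\<^sub>C b) \<le> norm a * norm b * K"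
    by (rule exI[of _ 1]) (simp add: norm_scaleC)
qed

lemma top_star_algebra_base: "top_star_algebra (base_alg :: 'a::graded_cstar_algebra star_alg)"
proof -
  interpret star_algebra "base_alg :: 'a star_alg" by (rule star_algebra_base)
  show ?thesis
  proof
    show "continuous_on UNIV (\<lambda>p::'a \<times> 'a. fst p + snd p)" by (intro continuous_intros)
    show "continuous_on UNIV (\<lambda>p. smul base_alg (fst p) (snd p :: 'a))"
      unfolding base_alg_def
      by (simp add: bounded_bilinear.continuous_on[OF bounded_bilinear_scaleC] continuous_on_fst continuous_on_snd)
  qed
qed

lemma (in top_star_algebra) top_star_algebra_cl: "top_star_algebra (cl_tensor 1 B)"
proof -
  interpret C: star_algebra "cl_tensor 1 B" by (rule star_algebra_cl)
  show ?thesis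
  proof
    show "continuous_on UNIV (\<lambda>p::(nat set \<Rightarrow> 'b) \<times> (nat set \<Rightarrow> 'b). fst p + snd p)"
      by (rule continuous_on_coordinatewise_then_product)
        (auto intro!: continuous_on_plus continuous_on_product_then_coordinatewise[OF continuous_on_fst]
          continuous_on_product_then_coordinatewise[OF continuous_on_snd] continuous_on_id)
    show "continuous_on UNIV (\<lambda>p. smul (cl_tensor 1 B) (fst p) (snd p))"
      by (rule continuous_on_coordinatewise_then_product)
        (auto simp: cl_tensor_def intro!: continuous_on_smul continuous_on_fst
          continuous_on_product_then_coordinatewise[OF continuous_on_snd] continuous_on_id)
  qed
qed

lemma continuous_on_mat_mult:
  fixes f g :: "'x::topological_space \<Rightarrow> 'a::real_normed_algebra matrix"
  assumes "continuous_on S f" "continuous_on S g"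
  shows "continuous_on S (\<lambda>x. mat_mult (*) m (f x) (g x))"
proof (rule continuous_on_matrixI)
  fix i j
  show "continuous_on S (\<lambda>x. mat_mult (*) m (f x) (g x) i j)"
    unfolding mat_mult_apply
    by (cases "i < m \<and> j < m")
       (auto intro!: continuous_on_sum continuous_on_mult assms(1,2)[THEN continuous_on_entry])
qed

lemma continuous_on_mat_dsum:
  assumes "continuous_on S f" "continuous_on S g"
  shows "continuous_on S (\<lambda>x. mat_dsum m l (f x) (g x))"
proof (rule continuous_on_matrixI)
  fix i j
  show "continuous_on S (\<lambda>x. mat_dsum m l (f x) (g x) i j)"
    unfolding mat_dsum_def
    using continuous_on_entry[OF assms(1), of i j] continuous_on_entry[OF assms(2), of "i - m" "j - m"]
    by (cases "i < m \<and> j < m"; cases "m \<le> i \<and> m \<le> j \<and> i < m + l \<and> j < m + l")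
      (simp_all only: if_True if_False simp_thms continuous_on_const)
qed


section \<open>The two van Daele semigroups\<close>

lemma mat_dsum_assoc: "mat_dsum (m + l) k (mat_dsum m l X Y) Z = mat_dsum m (l + k) X (mat_dsum l k Y Z)"
proof (intro ext)
  fix i j
  show "mat_dsum (m + l) k (mat_dsum m l X Y) Z i j = mat_dsum m (l + k) X (mat_dsum l k Y Z) i j"
    by (cases "i < m"; cases "j < m"; cases "i < m + l"; cases "j < m + l")
      (simp_all add: mat_dsum_def not_less less_diff_conv2 add.assoc le_diff_conv2 add.commute diff_diff_left)
qed

lemma mat_dsum_zero: "X \<in> OSU (mat_alg m B) \<Longrightarrow> mat_dsum m 0 X Y = X"
  by (intro ext) (auto simp: mat_dsum_def OSU_mat_support)

lemma (in top_star_algebra) isotopy_path_component: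
  assumes "OSU_isotopy m h" "X \<in> OSU (mat_alg m B)"
  shows "path_component (OSU (mat_alg m B)) X (h 1 X)"
  unfolding path_component_def
proof (intro exI[of _ "\<lambda>s. h s X"] conjI)
  have "continuous_on UNIV (\<lambda>p. h (fst p) (snd p))" using assms(1) by (simp add: OSU_isotopy_def)
  from continuous_on_compose2[OF this, of "{0..1}" "\<lambda>s. (s, X)"]
  show "path (\<lambda>s. h s X)" by (simp add: path_def continuous_on_Pair continuous_on_id)
qed (use assms in \<open>auto simp: OSU_isotopy_def path_image_def pathstart_def pathfinish_def\<close>)

lemma vd_monoid_alg:
  fixes e :: "'a::graded_cstar_algebra"
  assumes e: "e \<in> OSU base_alg"
  shows "vd_monoid (vd_alg e)"
proof -
  interpret top_star_algebra "base_alg :: 'a star_alg" by (rule top_star_algebra_base)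
  show ?thesis
  proof (unfold_locales, goal_cases)
    case (6 m x x' l y y')
    then obtain g g' where "path g" "path_image g \<subseteq> OSU (mat_alg m base_alg)" "pathstart g = x" "pathfinish g = x'"
      and "path g'" "path_image g' \<subseteq> OSU (mat_alg l base_alg)" "pathstart g' = y" "pathfinish g' = y'"
      by (auto simp: vd_alg_def path_component_def)
    then show ?case
      unfolding vd_alg_def path_component_def
      by (auto intro!: exI[of _ "\<lambda>s. mat_dsum m l (g s) (g' s)"] continuous_on_mat_dsum OSU_dsum
          simp: path_def path_image_def pathstart_def pathfinish_def)
  next
    case (10 x m y l)
    then have x: "x \<in> OSU (mat_alg m base_alg)" and y: "y \<in> OSU (mat_alg l base_alg)"
      by (auto simp: vd_alg_def)
    obtain h h' where h: "OSU_isotopy (m + l) h" "OSU_isotopy (m + l) h'"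
      "h' 1 (h 1 (mat_dsum m l x y)) = mat_dsum l m y x"
      using block_swap_isotopy[of m l] x y by blast
    have z: "mat_dsum m l x y \<in> OSU (mat_alg (m + l) base_alg)" by (rule OSU_dsum[OF x y])
    then have "h 1 (mat_dsum m l x y) \<in> OSU (mat_alg (m + l) base_alg)"
      using h(1) by (auto simp: OSU_isotopy_def)
    from path_component_trans[OF isotopy_path_component[OF h(1) z] isotopy_path_component[OF h(2) this]]
    show ?case by (simp add: vd_alg_def h(3))
  qed (auto simp: vd_alg_def OSU_dsum OSU_diag e mat_dsum_assoc mat_dsum_zero mat_dsum_diag path_component_refl
      intro: path_component_refl path_component_sym path_component_trans)
qed

lemma rho_OSU: "cl_el 1 {1} \<in> OSU (cl_tensor 1 (base_alg :: 'a::graded_cstar_algebra star_alg))"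
proof -
  interpret star_algebra "base_alg :: 'a star_alg" by (rule star_algebra_base)
  have u: "cstar 1 = (1::'a)" "grading 1 = (1::'a)"
    using star_unit grad_unit by (simp_all add: base_alg_def)
  have "(grading ^^ k) 0 = (0::'a)" for k
    using grad_zero by (induction k) (simp_all add: base_alg_def)
  with u show ?thesis
    by (auto simp: OSU_def cl_tensor_def fun_eq_iff cl_el_def cl_mult_1[unfolded One_nat_def] signed_def base_alg_def star_zero[unfolded base_alg_def, simplified] grad_zero[unfolded base_alg_def, simplified])
qed

lemma rho_mat_OSU: "rho_mat m \<in> OSU (susp_alg m :: (nat set \<Rightarrow> 'a::graded_cstar_algebra) matrix star_alg)"
proof -
  interpret star_algebra "cl_tensor 1 (base_alg :: 'a star_alg)"
    by (rule star_algebra.star_algebra_cl[OF star_algebra_base])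
  show ?thesis unfolding susp_alg_def rho_mat_def by (rule OSU_diag[OF rho_OSU])
qed

lemma (in top_star_algebra) isotopy_homotopic_paths:
  assumes h: "OSU_isotopy m h" and Y: "path Y" "path_image Y \<subseteq> OSU (mat_alg m B)"
    "pathstart Y = mat_diag m r" "pathfinish Y = mat_diag m r"
  shows "homotopic_paths (OSU (mat_alg m B)) Y (\<lambda>t. h 1 (Y t))"
  unfolding homotopic_paths
proof (intro exI[of _ "\<lambda>p. h (fst p) (Y (snd p))"] conjI)
  have "continuous_on UNIV (\<lambda>p. h (fst p) (snd p))" using h by (simp add: OSU_isotopy_def)
  moreover have "continuous_on ({0..1} \<times> {0..1}) (\<lambda>p::real \<times> real. (fst p, Y (snd p)))"
    using Y(1) unfolding path_def
    by (intro continuous_on_Pair continuous_on_fst continuous_on_id continuous_on_compose2[OF _ continuous_on_snd[OF continuous_on_id]]) auto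
  ultimately show "continuous_on ({0..1} \<times> {0..1}) (\<lambda>p. h (fst p) (Y (snd p)))"
    using continuous_on_compose2[of UNIV "\<lambda>p. h (fst p) (snd p)" _ "\<lambda>p. (fst p, Y (snd p))"] by simp
qed (use h Y in \<open>auto simp: OSU_isotopy_def path_image_def pathstart_def pathfinish_def image_subset_iff\<close>)

lemma vd_monoid_susp: "vd_monoid (vd_susp :: (real \<Rightarrow> (nat set \<Rightarrow> 'a::graded_cstar_algebra) matrix) vd_data)"
proof -
  interpret top_star_algebra "cl_tensor 1 (base_alg :: 'a star_alg)"
    by (rule top_star_algebra.top_star_algebra_cl[OF top_star_algebra_base])
  have loop: "Y \<in> osu_loops m \<longleftrightarrow> path Y \<and> path_image Y \<subseteq> OSU (mat_alg m (cl_tensor 1 base_alg)) \<and>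
      pathstart Y = mat_diag m (cl_el 1 {1}) \<and> pathfinish Y = mat_diag m (cl_el 1 {1})"
    for Y :: "real \<Rightarrow> (nat set \<Rightarrow> 'a) matrix" and m
    by (simp add: osu_loops_def rho_mat_def susp_alg_def)
  have rho: "mat_diag m (cl_el 1 {1}) \<in> OSU (mat_alg m (cl_tensor 1 (base_alg :: 'a star_alg)))" for m
    using rho_mat_OSU[of m, where 'a='a] by (simp add: rho_mat_def susp_alg_def)
  have dsum_loop: "(\<lambda>t. mat_dsum m l (Y t) (Z t)) \<in> osu_loops (m + l)" if "Y \<in> osu_loops m" "Z \<in> osu_loops l"
    for Y Z :: "real \<Rightarrow> (nat set \<Rightarrow> 'a) matrix" and m l
    using that unfolding loop
    by (auto simp: path_def path_image_def pathstart_def pathfinish_def mat_dsum_diag image_subset_iff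
        simp del: One_nat_def intro!: continuous_on_mat_dsum OSU_dsum)
  show ?thesis
  proof (unfold_locales, goal_cases)
    case (6 m x x' l y y')
    let ?Q = "{0..1} \<times> {0..1} :: (real \<times> real) set"
    obtain h where h: "continuous_on ?Q h" "h \<in> ?Q \<rightarrow> OSU (mat_alg m (cl_tensor 1 base_alg))"
      "\<forall>t\<in>{0..1}. h (0, t) = x t" "\<forall>t\<in>{0..1}. h (1, t) = x' t"
      "\<forall>s\<in>{0..1}. pathstart (h \<circ> Pair s) = pathstart x \<and> pathfinish (h \<circ> Pair s) = pathfinish x"
      using 6(1) by (auto simp: vd_susp_def homotopic_paths susp_alg_def)
    obtain k where k: "continuous_on ?Q k" "k \<in> ?Q \<rightarrow> OSU (mat_alg l (cl_tensor 1 base_alg))"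
      "\<forall>t\<in>{0..1}. k (0, t) = y t" "\<forall>t\<in>{0..1}. k (1, t) = y' t"
      "\<forall>s\<in>{0..1}. pathstart (k \<circ> Pair s) = pathstart y \<and> pathfinish (k \<circ> Pair s) = pathfinish y"
      using 6(2) by (auto simp: vd_susp_def homotopic_paths susp_alg_def)
    have "homotopic_paths (OSU (mat_alg (m + l) (cl_tensor 1 base_alg)))
        (\<lambda>t. mat_dsum m l (x t) (y t)) (\<lambda>t. mat_dsum m l (x' t) (y' t))"
      unfolding homotopic_paths
      by (rule exI[of _ "\<lambda>p. mat_dsum m l (h p) (k p)"])
        (use h k in \<open>auto simp: pathstart_def pathfinish_def simp del: One_nat_def intro!: continuous_on_mat_dsum OSU_dsum\<close>)
    then show ?case by (simp add: vd_susp_def susp_alg_def)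
  next
    case (10 x m y l)
    then have x: "x \<in> osu_loops m" and y: "y \<in> osu_loops l"
      by (auto simp: vd_susp_def)
    obtain h h' where h: "OSU_isotopy (m + l) h" "OSU_isotopy (m + l) h'"
      "\<forall>X\<in>OSU (mat_alg m (cl_tensor 1 base_alg)). \<forall>Y\<in>OSU (mat_alg l (cl_tensor 1 base_alg)).
         h' 1 (h 1 (mat_dsum m l X Y)) = mat_dsum l m Y X"
      using block_swap_isotopy[of m l] by blast
    let ?z = "\<lambda>t. mat_dsum m l (x t) (y t)"
    have z: "?z \<in> osu_loops (m + l)" by (rule dsum_loop[OF x y])
    have 1: "homotopic_paths (OSU (mat_alg (m + l) (cl_tensor 1 base_alg))) ?z (\<lambda>t. h 1 (?z t))"
      using z by (intro isotopy_homotopic_paths[OF h(1)]) (auto simp: loop)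
    have 2: "homotopic_paths (OSU (mat_alg (m + l) (cl_tensor 1 base_alg))) (\<lambda>t. h 1 (?z t)) (\<lambda>t. h' 1 (h 1 (?z t)))"
      using z homotopic_paths_imp_path[OF 1] homotopic_paths_imp_subset[OF 1]
        homotopic_paths_imp_pathstart[OF 1] homotopic_paths_imp_pathfinish[OF 1]
      by (intro isotopy_homotopic_paths[OF h(2)]) (auto simp: loop)
    have 3: "homotopic_paths (OSU (mat_alg (m + l) (cl_tensor 1 base_alg))) (\<lambda>t. h' 1 (h 1 (?z t))) (\<lambda>t. mat_dsum l m (y t) (x t))"
      using x y homotopic_paths_imp_path[OF 2] homotopic_paths_imp_subset[OF 2] h(3)
      by (intro homotopic_paths_eq) (auto simp: loop path_image_def image_subset_iff)
    show ?case
      using homotopic_paths_trans[OF 1 homotopic_paths_trans[OF 2 3]]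
      by (simp add: vd_susp_def susp_alg_def)
  next
    case (1 x m y l)
    then show ?case using dsum_loop by (simp add: vd_susp_def)
  next
    case (2 m)
    then show ?case
      using rho[of m] by (simp add: vd_susp_def loop path_def path_image_def image_subset_iff
          pathstart_def pathfinish_def rho_mat_def del: One_nat_def)
  next
    case (7 m l k x y z) then show ?case by (simp add: vd_susp_def mat_dsum_assoc)
  next
    case (8 x m) 
    then show ?case
      by (auto simp: vd_susp_def susp_alg_def loop path_image_def image_subset_iff mat_dsum_zero
          intro!: homotopic_paths_sym[OF homotopic_paths_eq] mat_dsum_zero[symmetric])
  qed (auto simp: vd_susp_def dsum_loop rho_mat_def susp_alg_def mat_dsum_diag loop rho path_image_def path_def pathstart_def pathfinish_def
      intro: homotopic_paths_sym homotopic_paths_trans)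
qed

section \<open>The suspension map\<close>

text \<open>\<open>cpair X Y\<close> is \<open>X \<otimes> 1 + Y \<otimes> \<rho>\<close>, in the coefficientwise encoding of matrices over \<open>A \<otimes> \<complex>l\<^sub>1\<close>.\<close>

definition cpair :: "'b::ab_group_add matrix \<Rightarrow> 'b matrix \<Rightarrow> (nat set \<Rightarrow> 'b) matrix"
  where "cpair X Y = (\<lambda>i j. cl_el (X i j) {} + cl_el (Y i j) {1})"

lemma cpair_apply: "cpair X Y i j S = (if S = {} then X i j else if S = {1} then Y i j else 0)"
  by (simp add: cpair_def cl_el_def)

lemma mat_dsum_cpair: "mat_dsum m l (cpair X Y) (cpair X' Y') = cpair (mat_dsum m l X X') (mat_dsum m l Y Y')"
  by (auto simp: fun_eq_iff cpair_apply mat_dsum_def)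

lemma susp_mult:
  fixes X Y :: "'a::graded_cstar_algebra matrix"
  shows "mult (susp_alg m) (cpair X Y) (cpair X' Y') =
   cpair (mat_mult (*) m X X' + mat_mult (*) m Y (\<lambda>i j. grading (Y' i j)))
     (mat_mult (*) m X Y' + mat_mult (*) m Y (\<lambda>i j. grading (X' i j)))"
  by (auto simp: fun_eq_iff cpair_apply susp_alg_def mat_alg_def cl_tensor_def base_alg_def
      mat_mult_apply fun_sum_apply cl_mult_1[unfolded One_nat_def] sum.distrib)

text \<open>
  The two steps of the product \<open>(C + S x \<rho>) (q e + p \<rho>) (C - S x \<rho>)\<close>, by coefficients; \<open>L\<close> and \<open>L'\<close>
  are those of the first two factors.
\<close>

lemma (in star_algebra) clifford_rotation:
  fixes C S p q :: complex
  assumes "x \<in> OSU B" "e \<in> OSU B"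
  defines "L \<equiv> smul B (C * q) e + smul B (S * p) x" and "L' \<equiv> smul B (C * p) (unit B) - smul B (S * q) (mult B x e)"
  shows "mult B (smul B C (unit B)) (smul B q e) + mult B (smul B S x) (grad B (smul B p (unit B))) = L"
    and "mult B (smul B C (unit B)) (smul B p (unit B)) + mult B (smul B S x) (grad B (smul B q e)) = L'"
    and "mult B L (smul B C (unit B)) + mult B L' (grad B (smul B (- S) x))
      = smul B (p * (2 * S * C)) x + smul B (q * C\<^sup>2) e - smul B (q * S\<^sup>2) (mult B x (mult B e x))"
    and "mult B L (smul B (- S) x) + mult B L' (grad B (smul B C (unit B)))
      = smul B (p * (C\<^sup>2 - S\<^sup>2)) (unit B) - smul B (q * (S * C)) (mult B e x + mult B x e)"
proof -
  have x: "x \<in> carr B" "grad B x = - x" "mult B x x = unit B"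
    and e: "e \<in> carr B" "grad B e = - e" using assms by (auto simp: OSU_def)
  note s = mult_smul_left mult_smul_right smul_smul unit_left unit_right grad_smul carr_unit carr_mult
    mult_minus_left mult_minus_right smul_minus_left smul_minus_right mult_add_left mult_add_right
    mult_diff_left smul_diff_right smul_add_right mult_assoc grad_minus
  show "mult B (smul B C (unit B)) (smul B q e) + mult B (smul B S x) (grad B (smul B p (unit B))) = L"
    and "mult B (smul B C (unit B)) (smul B p (unit B)) + mult B (smul B S x) (grad B (smul B q e)) = L'"
    by (simp_all add: L_def L'_def s x e mult.commute)
  show "mult B L (smul B C (unit B)) + mult B L' (grad B (smul B (- S) x))
      = smul B (p * (2 * S * C)) x + smul B (q * C\<^sup>2) e - smul B (q * S\<^sup>2) (mult B x (mult B e x))"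
  proof -
    have "smul B (p * (2 * S * C)) x = smul B (p * S * C) x + smul B (p * S * C) x"
      by (simp add: ac_simps flip: smul_add_left)
    then show ?thesis
      by (simp add: L_def L'_def s x e power2_eq_square ac_simps)
  qed
  show "mult B L (smul B (- S) x) + mult B L' (grad B (smul B C (unit B)))
      = smul B (p * (C\<^sup>2 - S\<^sup>2)) (unit B) - smul B (q * (S * C)) (mult B e x + mult B x e)"
  proof -
    have "smul B (p * (C\<^sup>2 - S\<^sup>2)) (unit B) = smul B (p * C * C) (unit B) - smul B (p * S * S) (unit B)"
      by (simp add: power2_eq_square right_diff_distrib smul_diff_left mult.assoc)
    then show ?thesis
      by (simp add: L_def L'_def s x e power2_eq_square ac_simps)
  qed
qed

text \<open>
  The OSUs \<open>\<nu>\<^sub>u(x) \<nu>\<^sub>v(e)\<^sup>-\<^sup>1 \<rho> \<nu>\<^sub>v(e) \<nu>\<^sub>u(x)\<^sup>-\<^sup>1\<close>, multiplied out.  In this form they are polynomials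
  in \<open>x\<close> and \<open>e\<close> without the grading, so that continuity and additivity under \<open>\<oplus>\<close> can be read off.
\<close>

definition sweep :: "'a::graded_cstar_algebra \<Rightarrow> nat \<Rightarrow> 'a matrix \<Rightarrow> real \<Rightarrow> real \<Rightarrow> (nat set \<Rightarrow> 'a) matrix"
  where "sweep e m x u v = cpair
     (\<lambda>i j. (cos (pi * v) * sin (pi * u)) *\<^sub>R x i j
        + (- sin (pi * v) * (cos (pi * u / 2))\<^sup>2) *\<^sub>R mat_diag m e i j
        - (- sin (pi * v) * (sin (pi * u / 2))\<^sup>2) *\<^sub>R mat_mult (*) m x (mat_mult (*) m (mat_diag m e) x) i j)
     (\<lambda>i j. (cos (pi * v) * cos (pi * u)) *\<^sub>R mat_diag m 1 i j
        - (- sin (pi * v) * (sin (pi * u) / 2)) *\<^sub>R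
           (mat_mult (*) m (mat_diag m e) x i j + mat_mult (*) m x (mat_diag m e) i j))"

lemma sin_double_half: "sin (pi * u) = 2 * sin (pi * u / 2) * cos (pi * u / 2)"
  using sin_double[of "pi * u / 2"] by simp

lemma cos_double_half: "cos (pi * u) = (cos (pi * u / 2))\<^sup>2 - (sin (pi * u / 2))\<^sup>2"
  using cos_double[of "pi * u / 2"] by simp

lemma sweep_eq_conj:
  fixes x :: "'a::graded_cstar_algebra matrix"
  assumes x: "x \<in> OSU (mat_alg m base_alg)" and e: "e \<in> OSU base_alg"
  shows "sweep e m x u v = mult (susp_alg m) (nu m u x) (mult (susp_alg m)
     (cpair (\<lambda>i j. - sin (pi * v) *\<^sub>R mat_diag m e i j) (\<lambda>i j. cos (pi * v) *\<^sub>R mat_diag m 1 i j))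
     (nu m (- u) x))"
proof -
  define M where "M = mat_alg m (base_alg :: 'a star_alg)"
  interpret base: star_algebra "base_alg :: 'a star_alg" by (rule star_algebra_base)
  interpret star_algebra M unfolding M_def by (rule base.star_algebra_mat)
  interpret S: star_algebra "susp_alg m :: (nat set \<Rightarrow> 'a) matrix star_alg"
    unfolding susp_alg_def by (intro star_algebra.star_algebra_mat base.star_algebra_cl)
  have M: "mat_mult (*) m = mult M" "(\<lambda>i j. grading (X i j)) = grad M X" "mat_diag m 1 = unit M"
    for X by (simp_all add: M_def mat_alg_def base_alg_def)
  have sc: "(\<lambda>i j. r *\<^sub>R X i j) = smul M (complex_of_real r) X" for r X
    by (simp add: M_def mat_alg_def base_alg_def scaleR_scaleC)
  have sub': "(\<lambda>i j. r *\<^sub>R X i j + r' *\<^sub>R Y i j - r'' *\<^sub>R Z i j)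
      = smul M (complex_of_real r) X + smul M (complex_of_real r') Y - smul M (complex_of_real r'') Z"
      "(\<lambda>i j. r *\<^sub>R X i j - r' *\<^sub>R (Y i j + Z i j)) = smul M (complex_of_real r) X - smul M (complex_of_real r') (Y + Z)"
    for r r' r'' and X Y Z :: "'a matrix"
    by (simp_all add: fun_eq_iff flip: sc)
  have E: "mat_diag m e \<in> OSU M" unfolding M_def by (rule base.OSU_diag[OF e])
  have X: "x \<in> OSU M" using x by (simp add: M_def)
  have nu: "nu m t x = cpair (smul M (complex_of_real (cos (pi * t / 2))) (unit M))
      (smul M (complex_of_real (sin (pi * t / 2))) x)" for t
    unfolding nu_def cpair_def M(3) by (simp add: M_def mat_alg_def base_alg_def scaleR_scaleC)
  have "nu m (- u) x = cpair (smul M (complex_of_real (cos (pi * u / 2))) (unit M))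
      (smul M (- complex_of_real (sin (pi * u / 2))) x)"
    by (simp add: nu)
  let ?C = "complex_of_real (cos (pi * u / 2))" and ?S = "complex_of_real (sin (pi * u / 2))"
  let ?p = "complex_of_real (cos (pi * v))" and ?q = "complex_of_real (- sin (pi * v))"
  let ?E = "mat_diag m e"
  let ?L = "smul M (?C * ?q) ?E + smul M (?S * ?p) x"
  let ?L' = "smul M (?C * ?p) (unit M) - smul M (?S * ?q) (mult M x ?E)"
  have 1: "mult (susp_alg m) (nu m u x) (cpair (\<lambda>i j. - sin (pi * v) *\<^sub>R mat_diag m e i j)
      (\<lambda>i j. cos (pi * v) *\<^sub>R mat_diag m 1 i j)) = cpair ?L ?L'"
    by (simp only: nu sc M susp_mult clifford_rotation(1,2)[OF X E])
  have nu': "nu m (- u) x = cpair (smul M ?C (unit M)) (smul M (- ?S) x)"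
    by (simp add: nu)
  have 2: "mult (susp_alg m) (cpair ?L ?L') (nu m (- u) x) =
    cpair (smul M (?p * (2 * ?S * ?C)) x + smul M (?q * ?C\<^sup>2) ?E - smul M (?q * ?S\<^sup>2) (mult M x (mult M ?E x)))
      (smul M (?p * (?C\<^sup>2 - ?S\<^sup>2)) (unit M) - smul M (?q * (?S * ?C)) (mult M ?E x + mult M x ?E))"
    by (simp only: nu' susp_mult M clifford_rotation(3,4)[OF X E])
  have 3: "sweep e m x u v =
    cpair (smul M (?p * (2 * ?S * ?C)) x + smul M (?q * ?C\<^sup>2) ?E - smul M (?q * ?S\<^sup>2) (mult M x (mult M ?E x)))
      (smul M (?p * (?C\<^sup>2 - ?S\<^sup>2)) (unit M) - smul M (?q * (?S * ?C)) (mult M ?E x + mult M x ?E))"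
    unfolding sweep_def M sub'
    by (simp add: sin_double_half[of u] cos_double_half[of u])
  show ?thesis
    unfolding S.mult_assoc[symmetric] 1 2 3 ..
qed


lemma susp_star_algebra: "star_algebra (susp_alg m :: (nat set \<Rightarrow> 'a::graded_cstar_algebra) matrix star_alg)"
  unfolding susp_alg_def
  by (intro star_algebra.star_algebra_mat star_algebra.star_algebra_cl star_algebra_base)

text \<open>
  \<open>(x \<rho>)\<^sup>2 = -1\<close>, so \<open>\<nu>\<^sub>t(x)\<close> is the exponential of \<open>(\<pi> t / 2) x \<rho>\<close> and has the inverse and adjoint
  \<open>\<nu>\<^sub>-\<^sub>t(x)\<close>.
\<close>

lemma nu_unitary:
  fixes x :: "'a::graded_cstar_algebra matrix"
  assumes x: "x \<in> OSU (mat_alg m base_alg)"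
  shows "nu m t x \<in> carr (susp_alg m)" "grad (susp_alg m) (nu m t x) = nu m t x"
    "star (susp_alg m) (nu m t x) = nu m (- t) x"
    "mult (susp_alg m) (nu m t x) (nu m (- t) x) = unit (susp_alg m)"
    "mult (susp_alg m) (nu m (- t) x) (nu m t x) = unit (susp_alg m)"
proof -
  interpret base: star_algebra "base_alg :: 'a star_alg" by (rule star_algebra_base)
  have sub: "S \<subseteq> {1..1::nat} \<longleftrightarrow> S = {} \<or> S = {1}" for S by auto
  have one: "cstar 1 = (1::'a)" "grading 1 = (1::'a)"
    using base.star_unit base.grad_unit by (simp_all add: base_alg_def)
  have z: "grading 0 = (0::'a)" "cstar 0 = (0::'a)"
    using base.star_zero base.grad_zero by (simp_all add: base_alg_def)
  have pow: "(grading ^^ k) 0 = (0::'a)" for k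
    using z by (induction k) simp_all
  have rs: "cstar (r *\<^sub>R a) = r *\<^sub>R cstar a" "grading (r *\<^sub>R a) = r *\<^sub>R grading a" for r and a :: 'a
    by (simp_all add: scaleR_scaleC cstar_scaleC grading_scaleC)
  have g: "grading (- a) = - grading a" for a :: 'a
    using base.grad_minus[of a] by (simp add: base_alg_def)
  have X: "\<And>i j. grading (x i j) = - x i j" "\<And>i j. cstar (x j i) = x i j" "mat_mult (*) m x x = mat_diag m 1"
    "\<And>i j. \<not> (i < m \<and> j < m) \<Longrightarrow> x i j = 0"
    using x by (auto simp: OSU_mat_iff base_alg_def)
  have diag: "cstar (mat_diag m 1 j i) = (mat_diag m 1 i j :: 'a)" "grading (mat_diag m 1 i j) = (mat_diag m 1 i j :: 'a)"
    "\<not> (i < m \<and> j < m) \<Longrightarrow> mat_diag m 1 i j = (0::'a)" for i j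
    by (auto simp: mat_diag_def one z)
  have nu: "nu m t x = cpair (\<lambda>i j. cos (pi * t / 2) *\<^sub>R mat_diag m 1 i j) (\<lambda>i j. sin (pi * t / 2) *\<^sub>R x i j)" for t
    by (simp add: nu_def cpair_def)
  show "nu m t x \<in> carr (susp_alg m)"
    by (auto simp: nu susp_alg_def mat_alg_def cl_tensor_def base_alg_def cpair_apply sub X(4) diag fun_eq_iff)
  show "grad (susp_alg m) (nu m t x) = nu m t x"
    by (auto simp: nu susp_alg_def mat_alg_def cl_tensor_def base_alg_def cpair_apply fun_eq_iff signed_def rs X diag z)
  show "star (susp_alg m) (nu m t x) = nu m (- t) x"
    by (auto simp: nu susp_alg_def mat_alg_def cl_tensor_def base_alg_def cpair_apply fun_eq_iff signed_def rs X diag z pow)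
  have unit: "unit (susp_alg m) = cpair (mat_diag m 1 :: 'a matrix) 0"
    by (auto simp: susp_alg_def mat_alg_def cl_tensor_def base_alg_def cpair_apply fun_eq_iff mat_diag_def cl_el_def)
  have inv: "mult (susp_alg m) (nu m t x) (nu m (- t) x) = unit (susp_alg m)" for t
  proof -
    have comp: "mat_mult (*) m (\<lambda>i j. r *\<^sub>R X i j) (\<lambda>i j. r' *\<^sub>R Y i j) = (\<lambda>i j. (r * r') *\<^sub>R mat_mult (*) m X Y i j)"
      for r r' and X Y :: "'a matrix"
      by (auto simp: mat_mult_apply fun_eq_iff scaleR_sum_right mult.commute)
    have d: "mat_mult (*) m (mat_diag m 1) (mat_diag m 1) = (mat_diag m 1 :: 'a matrix)"
      "mat_mult (*) m (mat_diag m 1) x = x" "mat_mult (*) m x (mat_diag m 1) = x"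
    proof -
      interpret M: star_algebra "mat_alg m (base_alg :: 'a star_alg)" by (rule base.star_algebra_mat)
      have "x \<in> carr (mat_alg m base_alg)" using x by (simp add: OSU_def)
      then show "mat_mult (*) m (mat_diag m 1) (mat_diag m 1) = (mat_diag m 1 :: 'a matrix)"
        "mat_mult (*) m (mat_diag m 1) x = x" "mat_mult (*) m x (mat_diag m 1) = x"
        using M.unit_left[OF M.carr_unit] M.unit_left[of x] M.unit_right[of x]
        by (simp_all add: mat_alg_def base_alg_def)
    qed
    have "(cos (pi * t / 2) * cos (pi * t / 2)) *\<^sub>R a + (sin (pi * t / 2) * sin (pi * t / 2)) *\<^sub>R a = a" for a :: 'a
      by (metis scaleR_left.add scaleR_one sin_cos_squared_add2 add.commute power2_eq_square)
    then show ?thesis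
      unfolding nu susp_mult unit
      by (auto simp: cpair_apply fun_eq_iff rs X(1) diag(2) g comp[of _ _ _ x] comp[of _ _ _ "mat_diag m 1"] d X(3) scaleR_minus_left[symmetric] simp del: scaleR_minus_left simp:
         mult.commute[of "sin (pi * t / 2)" "cos (pi * t / 2)"]) (simp add: scaleR_minus_left)
  qed
  then show "mult (susp_alg m) (nu m t x) (nu m (- t) x) = unit (susp_alg m)"
    "mult (susp_alg m) (nu m (- t) x) (nu m t x) = unit (susp_alg m)"
    using inv[of t] inv[of "- t"] by simp_all
qed

lemma nu_conj_OSU:
  assumes "x \<in> OSU (mat_alg m base_alg)" "Y \<in> OSU (susp_alg m)"
  shows "mult (susp_alg m) (nu m t x) (mult (susp_alg m) Y (nu m (- t) x)) \<in> OSU (susp_alg m)"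
  using star_algebra.OSU_conj[OF susp_star_algebra assms(2) nu_unitary(1)[OF assms(1), of t]] assms(1)
  by (simp add: nu_unitary)

lemma rho_mat_cpair: "rho_mat m = cpair (\<lambda>i j. 0) (mat_diag m 1)"
  by (auto simp: rho_mat_def fun_eq_iff cpair_apply mat_diag_def cl_el_def)

lemma base_OSU_diag: "e \<in> OSU base_alg \<Longrightarrow> mat_diag m e \<in> OSU (mat_alg m base_alg)"
  by (rule star_algebra.OSU_diag[OF star_algebra_base])

lemma sweep_left: "sweep e m x 0 v
    = cpair (\<lambda>i j. - sin (pi * v) *\<^sub>R mat_diag m e i j) (\<lambda>i j. cos (pi * v) *\<^sub>R mat_diag m 1 i j)"
  by (simp add: sweep_def)

lemma sweep_top: "sweep e m x u 1
    = cpair (\<lambda>i j. - sin (pi * u) *\<^sub>R x i j) (\<lambda>i j. - cos (pi * u) *\<^sub>R mat_diag m 1 i j)"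
  by (simp add: sweep_def)

lemma nu_conj_rho:
  fixes x :: "'a::graded_cstar_algebra matrix" and e :: 'a
  assumes "x \<in> OSU (mat_alg m base_alg)" "e \<in> OSU base_alg"
  shows "mult (susp_alg m) (nu m (- t) x) (mult (susp_alg m) (rho_mat m) (nu m t x))
    = cpair (\<lambda>i j. - sin (pi * t) *\<^sub>R x i j) (\<lambda>i j. cos (pi * t) *\<^sub>R mat_diag m 1 i j)"
proof -
  have "sweep e m x (- t) 0 = mult (susp_alg m) (nu m (- t) x) (mult (susp_alg m) (rho_mat m) (nu m t x))"
    using sweep_eq_conj[OF assms, of "- t" 0] by (simp add: rho_mat_cpair)
  then show ?thesis by (simp add: sweep_def)
qed

lemma sweep_OSU:
  fixes x :: "'a::graded_cstar_algebra matrix" and e :: 'a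
  assumes "x \<in> OSU (mat_alg m base_alg)" "e \<in> OSU base_alg"
  shows "sweep e m x u v \<in> OSU (susp_alg m)"
proof -
  note E = base_OSU_diag[OF assms(2), of m]
  have "cpair (\<lambda>i j. - sin (pi * v) *\<^sub>R mat_diag m e i j) (\<lambda>i j. cos (pi * v) *\<^sub>R mat_diag m 1 i j) \<in> OSU (susp_alg m)"
    using nu_conj_OSU[OF E rho_mat_OSU, of "- v"] unfolding minus_minus nu_conj_rho[OF E assms(2)] .
  then show ?thesis
    unfolding sweep_eq_conj[OF assms] by (intro nu_conj_OSU assms)
qed

lemma beta_loop_eq_sweep:
  fixes x :: "'a::graded_cstar_algebra matrix" and e :: 'a
  assumes "x \<in> OSU (mat_alg m base_alg)" "e \<in> OSU base_alg"
  shows "beta_loop e m x = (\<lambda>t. sweep e m x t t)"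
proof
  fix t
  note E = base_OSU_diag[OF assms(2), of m]
  have inv: "inv_in (susp_alg m) (nu m t y) = nu m (- t) y" if "y \<in> OSU (mat_alg m base_alg)" for y :: "'a matrix"
    using that by (intro star_algebra.inv_in_eqI[OF susp_star_algebra] nu_unitary)
  show "beta_loop e m x t = sweep e m x t t"
    unfolding beta_loop_def Let_def inv[OF assms(1)] inv[OF E] sweep_eq_conj[OF assms]
      nu_conj_rho[OF E assms(2), symmetric]
    by (simp add: star_algebra.mult_assoc[OF susp_star_algebra])
qed

lemma continuous_on_cpair:
  assumes "continuous_on S f" "continuous_on S g"
  shows "continuous_on S (\<lambda>x. cpair (f x) (g x))"
proof (rule continuous_on_matrixI, rule continuous_on_coordinatewise_then_product)
  fix i j and U :: "nat set"
  show "continuous_on S (\<lambda>x. cpair (f x) (g x) i j U)"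
    using continuous_on_entry[OF assms(1), of i j] continuous_on_entry[OF assms(2), of i j]
    by (cases "U = {}"; cases "U = {1}") (simp_all only: cpair_apply if_True if_False simp_thms continuous_on_const)
qed

lemma continuous_on_sweep:
  fixes x :: "'x::t2_space \<Rightarrow> 'a::graded_cstar_algebra matrix"
  assumes "continuous_on S x" "continuous_on S u" "continuous_on S v"
  shows "continuous_on S (\<lambda>p. sweep e m (x p) (u p) (v p))"
proof -
  have trig: "continuous_on S (\<lambda>p. cos (pi * f p))" "continuous_on S (\<lambda>p. sin (pi * f p))"
    "continuous_on S (\<lambda>p. cos (pi * f p / 2))" "continuous_on S (\<lambda>p. sin (pi * f p / 2))"
    if "continuous_on S f" for f :: "'x \<Rightarrow> real"
    using that by (auto intro!: continuous_intros)
  note ent = assms(1)[THEN continuous_on_entry]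
    continuous_on_mat_mult[OF assms(1) continuous_on_mat_mult[OF continuous_on_const assms(1)], THEN continuous_on_entry]
    continuous_on_mat_mult[OF assms(1) continuous_on_const, THEN continuous_on_entry]
    continuous_on_mat_mult[OF continuous_on_const assms(1), THEN continuous_on_entry]
  show ?thesis
    unfolding sweep_def
    by (rule continuous_on_cpair; rule continuous_on_matrixI;
        intro continuous_on_add continuous_on_diff continuous_on_scaleR continuous_on_mult continuous_on_minus
          continuous_on_power continuous_on_divide continuous_on_const trig assms(2,3) ent; simp)
qed

lemma sweep_dsum:
  fixes x y :: "'a::graded_cstar_algebra matrix"
  shows "sweep e (m + l) (mat_dsum m l x y) u v = mat_dsum m l (sweep e m x u v) (sweep e l y u v)"
proof -
  have mm: "mat_mult (*) (m + l) (mat_dsum m l X Y) (mat_dsum m l X' Y')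
     = mat_dsum m l (mat_mult (*) m X X') (mat_mult (*) l Y Y')" for X Y X' Y' :: "'a matrix"
    using star_algebra.mat_mult_dsum[OF star_algebra_base, of m l X Y X' Y'] by (simp add: base_alg_def)
  have diag: "mat_diag (m + l) b = mat_dsum m l (mat_diag m b) (mat_diag l b)" for b :: 'a
    by (rule star_algebra.mat_dsum_diag[OF star_algebra_base, symmetric])
  show ?thesis
    unfolding sweep_def diag mm mat_dsum_cpair
    by (intro arg_cong2[of _ _ _ _ cpair] ext; simp add: mat_dsum_def)
qed

lemma sweep_diag:
  assumes e: "e \<in> OSU base_alg"
  shows "sweep e m (mat_diag m e) t t = rho_mat m"
proof -
  have E: "mat_mult (*) m (mat_diag m e) (mat_diag m e) = mat_diag m 1"
    using base_OSU_diag[OF e, of m] by (simp add: OSU_def mat_alg_def base_alg_def)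
  have E1: "mat_mult (*) m (mat_diag m e) (mat_diag m 1) = mat_diag m e"
    by (auto simp: mat_mult_apply mat_diag_def fun_eq_iff if_distrib[of "(*) _"] if_distrib[of "\<lambda>x. x * _"] cong: if_cong)
  have 1: "(cos (pi * t) * sin (pi * t)) *\<^sub>R a + (- sin (pi * t) * (cos (pi * t / 2))\<^sup>2) *\<^sub>R a
      - (- sin (pi * t) * (sin (pi * t / 2))\<^sup>2) *\<^sub>R a = 0" for a :: 'a
  proof -
    have "cos (pi * t) * sin (pi * t) + - sin (pi * t) * (cos (pi * t / 2))\<^sup>2
       - (- sin (pi * t) * (sin (pi * t / 2))\<^sup>2) = 0"
      by (simp add: cos_double_half[of t] algebra_simps)
    then show ?thesis by (simp only: scaleR_left.add[symmetric] scaleR_left.diff[symmetric] scaleR_zero_left)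
  qed
  have 2: "(cos (pi * t) * cos (pi * t)) *\<^sub>R a - (- sin (pi * t) * (sin (pi * t) / 2)) *\<^sub>R (a + a) = a" for a :: 'a
  proof -
    have "(sin (pi * t) * sin (pi * t) / 2) *\<^sub>R (a + a) = (sin (pi * t) * sin (pi * t)) *\<^sub>R a"
      by (simp flip: scaleR_2)
    moreover have "(cos (pi * t) * cos (pi * t)) *\<^sub>R a + (sin (pi * t) * sin (pi * t)) *\<^sub>R a = a"
      by (simp flip: scaleR_add_left)
    ultimately show ?thesis by simp
  qed
  show ?thesis
    unfolding sweep_def E E1 1 2 rho_mat_cpair ..
qed


lemma vd_elems_alg_iff: "(m, x) \<in> vd_elems (vd_alg e) \<longleftrightarrow> 1 \<le> m \<and> x \<in> OSU (mat_alg m base_alg)"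
  by (simp add: vd_elems_def vd_alg_def)

lemma vd_elems_susp_iff: "(m, Y) \<in> vd_elems vd_susp \<longleftrightarrow> 1 \<le> m \<and> Y \<in> osu_loops m"
  by (simp add: vd_elems_def vd_susp_def)

lemma sweep_ends: "sweep e m x 0 0 = rho_mat m" "sweep e m x 1 1 = rho_mat m"
  by (simp_all add: sweep_def rho_mat_cpair)

lemma homotopic_beta_loops:
  fixes x y :: "'a::graded_cstar_algebra matrix" and e :: 'a
  assumes "path_component (OSU (mat_alg m base_alg)) x y" "e \<in> OSU base_alg"
  shows "homotopic_paths (OSU (susp_alg m)) (beta_loop e m x) (beta_loop e m y)"
proof -
  obtain g where g: "path g" "path_image g \<subseteq> OSU (mat_alg m base_alg)" "pathstart g = x" "pathfinish g = y"
    using assms(1) by (auto simp: path_component_def)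
  have xy: "x \<in> OSU (mat_alg m base_alg)" "y \<in> OSU (mat_alg m base_alg)"
    using path_component_mem[OF assms(1)] .
  have cont: "continuous_on ({0..1} \<times> {0..1}) (\<lambda>p::real \<times> real. sweep e m (g (fst p)) (snd p) (snd p))"
    using g(1) unfolding path_def
    by (intro continuous_on_sweep continuous_on_snd continuous_on_id
        continuous_on_compose2[OF _ continuous_on_fst[OF continuous_on_id]]) auto
  show ?thesis
    unfolding homotopic_paths beta_loop_eq_sweep[OF xy(1) assms(2)] beta_loop_eq_sweep[OF xy(2) assms(2)]
    by (rule exI[of _ "\<lambda>p. sweep e m (g (fst p)) (snd p) (snd p)"])
      (use g cont in \<open>auto simp: path_image_def image_subset_iff pathstart_def pathfinish_def sweep_ends
        intro!: sweep_OSU assms(2)\<close>)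
qed

lemma beta_loop_osu_loops:
  fixes x :: "'a::graded_cstar_algebra matrix" and e :: 'a
  assumes "x \<in> OSU (mat_alg m base_alg)" "e \<in> OSU base_alg"
  shows "beta_loop e m x \<in> osu_loops m"
proof -
  have "path (\<lambda>t. sweep e m x t t)"
    unfolding path_def by (intro continuous_on_sweep continuous_on_const continuous_on_id)
  then show ?thesis
    unfolding beta_loop_eq_sweep[OF assms]
    by (auto simp: osu_loops_def path_image_def pathstart_def pathfinish_def sweep_OSU[OF assms] sweep_ends)
qed

text \<open>
  Compatibility with stabilisation rests on \<open>\<beta>[e]\<close> being the constant loop \<open>\<rho>\<close> (\<open>sweep_diag\<close>).
\<close>

lemma vd_hom_beta:
  fixes e :: "'a::graded_cstar_algebra"
  assumes e: "e \<in> OSU base_alg"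
  shows "vd_hom (vd_alg e) vd_susp (beta_loop e)"
proof -
  interpret D: vd_monoid "vd_alg e" by (rule vd_monoid_alg[OF e])
  interpret D': vd_monoid "vd_susp :: (real \<Rightarrow> (nat set \<Rightarrow> 'a) matrix) vd_data" by (rule vd_monoid_susp)
  have sum: "beta_loop e (m + l) (mat_dsum m l x y) = (\<lambda>t. mat_dsum m l (beta_loop e m x t) (beta_loop e l y t))"
    if "x \<in> OSU (mat_alg m base_alg)" "y \<in> OSU (mat_alg l base_alg)" for m l x y
    using that star_algebra.OSU_dsum[OF star_algebra_base that]
    by (simp add: beta_loop_eq_sweep e sweep_dsum)
  have stab: "beta_loop e n (D.stab n m x) = D'.stab n m (beta_loop e m x)"
    if "x \<in> OSU (mat_alg m base_alg)" "m \<le> n" for m n x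
  proof -
    have "beta_loop e (n - m) (mat_diag (n - m) e) = (\<lambda>t. rho_mat (n - m))"
      by (simp add: beta_loop_eq_sweep base_OSU_diag e sweep_diag)
    then show ?thesis
      using sum[OF that(1) base_OSU_diag[OF e], of "n - m"] that(2)
      unfolding D.stab_def D'.stab_def by (simp add: vd_alg_def vd_susp_def)
  qed
  have elems: "(m, beta_loop e m x) \<in> vd_elems vd_susp" if "(m, x) \<in> vd_elems (vd_alg e)" for m x
    using that by (simp add: vd_elems_alg_iff vd_elems_susp_iff beta_loop_osu_loops e)
  show ?thesis
  proof
    fix m l x y
    show "beta_loop e (m + l) (vd_sum (vd_alg e) m l x y) = vd_sum vd_susp m l (beta_loop e m x) (beta_loop e l y)"
      if "(m, x) \<in> vd_elems (vd_alg e)" "(l, y) \<in> vd_elems (vd_alg e)"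
      using that sum unfolding vd_elems_alg_iff by (simp add: vd_alg_def vd_susp_def)
    assume *: "((m, x), (l, y)) \<in> vd_rel (vd_alg e)"
    then obtain n where n: "m \<le> n" "l \<le> n" "vd_htp (vd_alg e) n (D.stab n m x) (D.stab n l y)"
      and mem: "(m, x) \<in> vd_elems (vd_alg e)" "(l, y) \<in> vd_elems (vd_alg e)"
      by (auto simp: D.vd_rel_iff)
    then have "homotopic_paths (OSU (susp_alg n)) (beta_loop e n (D.stab n m x)) (beta_loop e n (D.stab n l y))"
      by (intro homotopic_beta_loops e) (simp add: vd_alg_def)
    then have "vd_htp vd_susp n (D'.stab n m (beta_loop e m x)) (D'.stab n l (beta_loop e l y))"
      using n(1,2) mem stab[of x m n] stab[of y l n] by (simp add: vd_elems_alg_iff) (simp add: vd_susp_def)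
    then show "((m, beta_loop e m x), (l, beta_loop e l y)) \<in> vd_rel vd_susp"
      using n(1,2) mem elems by (auto simp: D'.vd_rel_iff)
  qed
qed

text \<open>
  The sweep along the sides from \<open>(0, 0)\<close> over \<open>(0, 1)\<close> to \<open>(1, 1)\<close>.  The formula for the coefficient of
  \<open>\<rho>\<close> is the same on both sides since \<open>- cos(\<pi>(2t - 1)) = cos(2\<pi>t)\<close>.
\<close>

definition step_loop :: "'a::graded_cstar_algebra \<Rightarrow> nat \<Rightarrow> 'a matrix \<Rightarrow> real \<Rightarrow> (nat set \<Rightarrow> 'a) matrix"
  where "step_loop e m x t = cpair
     (\<lambda>i j. if t \<le> 1/2 then - sin (2 * pi * t) *\<^sub>R mat_diag m e i j else sin (2 * pi * t) *\<^sub>R x i j)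
     (\<lambda>i j. cos (2 * pi * t) *\<^sub>R mat_diag m 1 i j)"

text \<open>The diagonal and the two sides of the square are homotopic in the plane, where the sweep is defined.\<close>

lemma homotopic_beta_step:
  fixes x :: "'a::graded_cstar_algebra matrix" and e :: 'a
  assumes "x \<in> OSU (mat_alg m base_alg)" "e \<in> OSU base_alg"
  shows "homotopic_paths (OSU (susp_alg m)) (beta_loop e m x) (step_loop e m x)"
proof -
  let ?p = "\<lambda>t::real. (t, t)"
  let ?q = "linepath (0, 0) (0, 1) +++ linepath (0, 1) (1, 1 :: real) :: real \<Rightarrow> real \<times> real"
  let ?h = "\<lambda>p. sweep e m x (fst p) (snd p)"
  have "path ?q" by (rule path_join_imp) auto
  moreover have "path ?p" unfolding path_def by (intro continuous_intros)
  ultimately have "homotopic_paths UNIV ?p ?q"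
    by (intro homotopic_paths_linear) (auto simp: pathstart_def pathfinish_def joinpaths_def linepath_def)
  moreover have "continuous_on UNIV ?h"
    by (intro continuous_on_sweep continuous_intros)
  ultimately have "homotopic_paths (OSU (susp_alg m)) (?h \<circ> ?p) (?h \<circ> ?q)"
    by (rule homotopic_paths_continuous_image) (simp add: sweep_OSU assms)
  moreover have "?h \<circ> ?p = beta_loop e m x"
    by (simp add: beta_loop_eq_sweep[OF assms] comp_def)
  moreover have "?h \<circ> ?q = step_loop e m x"
  proof
    fix t :: real
    have "pi * (2 * t - 1) = 2 * pi * t - pi" by (simp add: algebra_simps)
    then have "sin (pi * (2 * t - 1)) = - sin (2 * pi * t)" "cos (pi * (2 * t - 1)) = - cos (2 * pi * t)"
      by (simp_all add: sin_diff cos_diff)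
    then show "(?h \<circ> ?q) t = step_loop e m x t"
      by (auto simp: joinpaths_def linepath_def sweep_left sweep_top step_loop_def mult.left_commute mult.assoc)
  qed
  ultimately show ?thesis by simp
qed

lemma step_loop_osu_loops:
  fixes x :: "'a::graded_cstar_algebra matrix" and e :: 'a
  assumes "x \<in> OSU (mat_alg m base_alg)" "e \<in> OSU base_alg"
  shows "step_loop e m x \<in> osu_loops m"
  using homotopic_paths_imp_path[OF homotopic_beta_step[OF assms]]
    homotopic_paths_imp_subset[OF homotopic_beta_step[OF assms]]
    homotopic_paths_imp_pathstart[OF homotopic_beta_step[OF assms]]
    homotopic_paths_imp_pathfinish[OF homotopic_beta_step[OF assms]]
    beta_loop_osu_loops[OF assms]
  by (simp add: osu_loops_def)

theorem beta_DK_diff: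
  fixes e :: "'a::graded_cstar_algebra"
  assumes e: "e \<in> OSU base_alg" and p: "p \<in> vd_elems (vd_alg e)" and q: "q \<in> vd_elems (vd_alg e)"
  shows "beta e (DK_diff (vd_alg e) p q)
    = DK_diff vd_susp (fst p, step_loop e (fst p) (snd p)) (fst q, step_loop e (fst q) (snd q))"
proof -
  interpret vd_hom "vd_alg e" vd_susp "beta_loop e" by (rule vd_hom_beta[OF e])
  obtain m x l y where pq: "p = (m, x)" "q = (l, y)" by (cases p, cases q)
  have "induced = beta_semigroup e" by (simp add: fun_eq_iff induced_def beta_semigroup_def)
  then have "beta e (DK_diff (vd_alg e) p q) = DK_diff vd_susp (m, beta_loop e m x) (l, beta_loop e l y)"
    using induced_DK_diff[of m x l y] p q by (simp add: pq beta_def)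
  moreover have "((k, beta_loop e k z), (k, step_loop e k z)) \<in> vd_rel vd_susp" if "(k, z) \<in> vd_elems (vd_alg e)" for k z
  proof (rule D'.vd_rel_htp)
    have z: "1 \<le> k" "z \<in> OSU (mat_alg k base_alg)"
      using that by (simp_all add: vd_elems_alg_iff)
    then show "1 \<le> k" "beta_loop e k z \<in> vd_obj vd_susp k" "step_loop e k z \<in> vd_obj vd_susp k"
      "vd_htp vd_susp k (beta_loop e k z) (step_loop e k z)"
      using e by (simp_all add: vd_susp_def beta_loop_osu_loops step_loop_osu_loops homotopic_beta_step)
  qed
  ultimately show ?thesis
    using p q by (simp add: pq D'.DK_diff_cong)
qed

section \<open>Smoothness of the step loop\<close>

lemma smooth_on_Icc_cong:
  assumes "smooth_on_Icc a b f" "\<And>t. t \<in> {a..b} \<Longrightarrow> g t = f t"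
  shows "smooth_on_Icc a b g"
  using assms unfolding smooth_on_Icc_def by (metis (no_types, lifting))

lemma smooth_on_Icc_continuous:
  assumes "smooth_on_Icc a b g"
  shows "continuous_on {a..b} g"
proof -
  obtain D where D: "\<And>t. t \<in> {a..b} \<Longrightarrow> D 0 t = g t"
    "\<And>t. t \<in> {a..b} \<Longrightarrow> (D (0::nat) has_vector_derivative D (Suc 0) t) (at t within {a..b})"
    using assms unfolding smooth_on_Icc_def by blast
  have "continuous_on {a..b} (D 0)"
    using D(2) by (meson continuous_on_eq_continuous_within has_vector_derivative_continuous)
  then show ?thesis by (rule continuous_on_eq) (use D(1) in auto)
qed

text \<open>
  Each derivative shifts the phase by \<open>\<pi> / 2\<close>; with \<open>r\<close> and \<open>c\<close> this covers sine, cosine and zero.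
\<close>

lemma smooth_on_Icc_cos: "smooth_on_Icc a b (\<lambda>t. complex_of_real (r * cos (2 * pi * t + c)))"
  unfolding smooth_on_Icc_def
proof (intro exI[of _ "\<lambda>k t. complex_of_real (r * (2 * pi) ^ k * cos (2 * pi * t + c + real k * pi / 2))"] ballI conjI allI)
  fix t k
  have "((\<lambda>t. r * (2 * pi) ^ k * cos (2 * pi * t + c + real k * pi / 2)) has_real_derivative
      r * (2 * pi) ^ k * (- sin (2 * pi * t + c + real k * pi / 2) * (2 * pi))) (at t within {a..b})"
    by (auto intro!: derivative_eq_intros)
  moreover have "- sin (2 * pi * t + c + real k * pi / 2) = cos (2 * pi * t + c + real (Suc k) * pi / 2)"
    by (simp add: minus_sin_cos_eq algebra_simps add_divide_distrib)
  moreover have "r * (2 * pi) ^ k * (z * (2 * pi)) = r * (2 * pi) ^ Suc k * z" for z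
    by simp
  ultimately have "((\<lambda>t. r * (2 * pi) ^ k * cos (2 * pi * t + c + real k * pi / 2)) has_real_derivative
      r * (2 * pi) ^ Suc k * cos (2 * pi * t + c + real (Suc k) * pi / 2)) (at t within {a..b})"
    by (simp only:)
  then show "((\<lambda>t. complex_of_real (r * (2 * pi) ^ k * cos (2 * pi * t + c + real k * pi / 2))) has_vector_derivative
      complex_of_real (r * (2 * pi) ^ Suc k * cos (2 * pi * t + c + real (Suc k) * pi / 2))) (at t within {a..b})"
    by (intro has_vector_derivative_of_real) (simp add: has_real_derivative_iff_has_vector_derivative)
qed simp

lemma pw_smooth_glue:
  assumes f: "smooth_on_Icc 0 (1/2) f" and g: "smooth_on_Icc (1/2) 1 g" and fg: "f (1/2) = g (1/2)"
  shows "pw_smooth (\<lambda>t. if t \<le> 1/2 then f t else g t)"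
proof -
  have half: "f t = g t" if "t * 2 = 1" for t
  proof -
    have "t = 1/2" using that by simp
    show ?thesis unfolding \<open>t = 1/2\<close> by (rule fg)
  qed
  have "continuous_on {0..1} (\<lambda>t. if t \<le> 1/2 then f t else g t)"
    by (rule continuous_on_cases_le)
      (auto intro!: continuous_on_subset[OF smooth_on_Icc_continuous[OF f]]
        continuous_on_subset[OF smooth_on_Icc_continuous[OF g]] continuous_on_id
        simp: half)
  moreover have "smooth_on_Icc a b (\<lambda>t. if t \<le> 1/2 then f t else g t)"
    if "a \<in> {0, 1/2, 1}" "b \<in> {0, 1/2, 1}" "a < b" "{a<..<b} \<inter> {0, 1/2, 1} = {}" for a b :: real
  proof -
    have "a = 0 \<and> b = 1/2 \<or> a = 1/2 \<and> b = 1" using that by auto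
    moreover have "smooth_on_Icc 0 (1/2) (\<lambda>t. if t \<le> 1/2 then f t else g t)"
      by (rule smooth_on_Icc_cong[OF f]) simp
    moreover have "smooth_on_Icc (1/2) 1 (\<lambda>t. if t \<le> 1/2 then f t else g t)"
      by (rule smooth_on_Icc_cong[OF g]) (auto simp: half)
    ultimately show ?thesis by (elim disjE conjE) (simp_all only:)
  qed
  ultimately show ?thesis
    unfolding pw_smooth_def by (intro conjI exI[of _ "{0, 1/2, 1}"]) auto
qed

lemma step_loop_smooth:
  fixes C :: "('a::graded_cstar_algebra, 'w) cycle_data"
  assumes x: "(m, x) \<in> smooth_osus C" and e: "e \<in> OSU base_alg" "e \<in> cyc_alg C" "1 \<in> cyc_alg C" "0 \<in> cyc_alg C"
  shows "(m, step_loop e m x) \<in> smooth_loops C"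
proof -
  have m: "1 \<le> m" "x \<in> OSU (mat_alg m base_alg)" "\<And>i j. x i j \<in> cyc_alg C"
    using x by (auto simp: smooth_osus_def)
  have cos: "smooth_on_Icc a b (\<lambda>t. complex_of_real (cos (2 * pi * t)))"
    and sin: "smooth_on_Icc a b (\<lambda>t. complex_of_real (sin (2 * pi * t)))"
    and msin: "smooth_on_Icc a b (\<lambda>t. complex_of_real (- sin (2 * pi * t)))"
    and zero: "smooth_on_Icc a b (\<lambda>t. 0)" for a b
    using smooth_on_Icc_cos[of a b 1 0] smooth_on_Icc_cos[of a b 1 "- (pi / 2)"]
      smooth_on_Icc_cos[of a b 1 "pi / 2"] smooth_on_Icc_cos[of a b 0 0]
    by (simp_all add: cos_add cos_diff)
  have pw: "pw_smooth (\<lambda>t. if t \<le> 1/2 then complex_of_real (cos (2 * pi * t)) else complex_of_real (cos (2 * pi * t)))"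
    "pw_smooth (\<lambda>t. if t \<le> 1/2 then complex_of_real (- sin (2 * pi * t)) else 0)"
    "pw_smooth (\<lambda>t. if t \<le> 1/2 then 0 else complex_of_real (sin (2 * pi * t)))"
    by (rule pw_smooth_glue[OF cos cos] pw_smooth_glue[OF msin zero] pw_smooth_glue[OF zero sin]; simp)+
  have "pw_smooth_in (cyc_alg C) (\<lambda>t. step_loop e m x t i j S)" for i j S
  proof -
    have diag: "mat_diag m b i j \<in> cyc_alg C" if "b \<in> cyc_alg C" for b
      using that e by (simp add: mat_diag_def)
    consider "S = {}" | "S = {1}" | "S \<noteq> {}" "S \<noteq> {1}" by blast
    then show ?thesis
    proof cases
      case 1
      let ?g = "\<lambda>k::nat. if k = 0 then (\<lambda>t. if t \<le> 1/2 then complex_of_real (- sin (2 * pi * t)) else 0)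
        else (\<lambda>t. if t \<le> 1/2 then 0 else complex_of_real (sin (2 * pi * t)))"
      show ?thesis
        unfolding pw_smooth_in_def
        by (rule exI[of _ 2], rule exI[of _ ?g], rule exI[of _ "\<lambda>k. if k = 0 then mat_diag m e i j else x i j"])
          (use pw m diag e in \<open>auto simp: 1 step_loop_def cpair_apply numeral_2_eq_2 less_Suc_eq scaleR_scaleC
             scaleC.scale_zero_left\<close>)
    next
      case 2
      show ?thesis
        unfolding pw_smooth_in_def
        by (rule exI[of _ 1], rule exI[of _ "\<lambda>k t. complex_of_real (cos (2 * pi * t))"], rule exI[of _ "\<lambda>k. mat_diag m 1 i j"])
          (use pw diag e in \<open>auto simp: 2 step_loop_def cpair_apply scaleR_scaleC\<close>)
    next
      case 3
      then show ?thesis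
        unfolding pw_smooth_in_def by (intro exI[of _ 0]) (auto simp: step_loop_def cpair_apply)
    qed
  qed
  then show ?thesis
    using m e by (auto simp: smooth_loops_def step_loop_osu_loops)
qed


section \<open>Calculus in a cycle\<close>

lemma mat_mult_assoc:
  fixes X Y Z :: "'w::ring matrix"
  shows "mat_mult (*) m (mat_mult (*) m X Y) Z = mat_mult (*) m X (mat_mult (*) m Y Z)"
proof (intro ext)
  fix i j
  have "(\<Sum>l<m. (\<Sum>k<m. X i k * Y k l) * Z l j) = (\<Sum>l<m. \<Sum>k<m. X i k * (Y k l * Z l j))"
    by (simp add: sum_distrib_right mult.assoc)
  also have "\<dots> = (\<Sum>k<m. X i k * (\<Sum>l<m. Y k l * Z l j))"
    by (subst sum.swap) (simp add: sum_distrib_left)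
  finally show "mat_mult (*) m (mat_mult (*) m X Y) Z i j = mat_mult (*) m X (mat_mult (*) m Y Z) i j"
    by (simp add: mat_mult_apply cong: sum.cong_simp)
qed

lemma mat_rpow_0: "mat_rpow mul m X D 0 = X"
  by (simp add: mat_rpow_def)

lemma mat_rpow_Suc: "mat_rpow mul m X D (Suc k) = mat_mult mul m (mat_rpow mul m X D k) D"
  by (simp add: mat_rpow_def)

lemma mat_rpow_minus:
  fixes X Y D :: "'w::ring matrix"
  shows "mat_rpow (*) m (\<lambda>i j. X i j - Y i j) D k = (\<lambda>i j. mat_rpow (*) m X D k i j - mat_rpow (*) m Y D k i j)"
  by (induction k) (auto simp: mat_rpow_0 mat_rpow_Suc mat_mult_apply left_diff_distrib sum_subtractf fun_eq_iff)

context n_cycle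
begin

abbreviation dd :: "'a \<Rightarrow> 'w"
  where "dd a \<equiv> cyc_d C (cyc_emb C a)"

lemmas emb_simps = module_hom.add[OF emb_linear] module_hom.scale[OF emb_linear] module_hom.zero[OF emb_linear]
  module_hom.sum[OF emb_linear] module_hom.neg[OF emb_linear] module_hom.diff[OF emb_linear]

lemmas alg_closed = scaleC.subspace_add[OF alg_subspace] scaleC.subspace_scale[OF alg_subspace]
  scaleC.subspace_0[OF alg_subspace] scaleC.subspace_sum[OF alg_subspace] alg_mult

lemma dd_add: "a \<in> cyc_alg C \<Longrightarrow> b \<in> cyc_alg C \<Longrightarrow> dd (a + b) = dd a + dd b"
  by (simp add: emb_simps d_add C1)

lemma dd_scaleC: "a \<in> cyc_alg C \<Longrightarrow> dd (z *\<^sub>C a) = z *\<^sub>C dd a"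
  by (simp add: emb_simps d_scaleC C1)

lemma dd_zero: "dd 0 = 0"
  using dd_scaleC[of 0 0] alg_closed(3) by simp

lemma dd_sum: "(\<And>i. i \<in> I \<Longrightarrow> a i \<in> cyc_alg C) \<Longrightarrow> dd (\<Sum>i\<in>I. a i) = (\<Sum>i\<in>I. dd (a i))"
  by (induction I rule: infinite_finite_induct) (auto simp: dd_zero dd_add alg_closed)

lemma dd_mult: "a \<in> cyc_alg C \<Longrightarrow> b \<in> cyc_alg C \<Longrightarrow> dd (a * b) = dd a * cyc_emb C b + cyc_emb C a * dd b"
  using d_leibniz[of "cyc_emb C a" "cyc_emb C b" 0] C1 emb_hom alg_mult
  by (simp add: emb_mult[symmetric] signed_def)

lemma one_alg: "1 \<in> cyc_alg C"
  using C5 alg_mult by (auto simp: OSU_def base_alg_def) metis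

lemma dd_one: "dd 1 = 0"
proof -
  obtain e where e: "e * e = 1" "e \<in> cyc_alg C" "dd e = 0"
    using C5 by (auto simp: OSU_def base_alg_def)
  then show ?thesis using dd_mult[of e e] by simp
qed

lemma one_dd: "a \<in> cyc_alg C \<Longrightarrow> cyc_emb C 1 * dd a = dd a"
  using dd_mult[OF one_alg, of a] by (simp add: dd_one)

lemma dd_one_right: "a \<in> cyc_alg C \<Longrightarrow> dd a * cyc_emb C 1 = dd a"
  using dd_mult[OF _ one_alg, of a] by (simp add: dd_one)

lemma one_emb: "cyc_emb C 1 * cyc_emb C a = cyc_emb C a" "cyc_emb C a * cyc_emb C 1 = cyc_emb C a"
  by (simp_all flip: emb_mult)

lemma dd_odd:
  assumes "a \<in> cyc_alg C" "grading a = - a"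
  shows "dd a \<in> cyc_hom C 1" "cyc_grad C (dd a) = - dd a"
proof -
  have "cyc_emb C a \<in> cyc_bideg C (int 0) 1"
    using assms emb_grading[of a] by (simp add: cyc_bideg_def emb_hom emb_simps signed_def)
  from d_degree[OF C1[OF assms(1)] this] show "dd a \<in> cyc_hom C 1" "cyc_grad C (dd a) = - dd a"
    by (simp_all add: cyc_bideg_def signed_def)
qed

text \<open>
  Only the components of degree \<open>j \<ge> 0\<close> are subspaces by assumption; for the others, \<open>v * 0 = 0\<close>
  has the degree of \<open>v\<close>.
\<close>

lemma zero_hom: "0 \<in> cyc_hom C i"
proof -
  obtain c where "\<forall>i. c i \<in> cyc_hom C i"
    using hom_direct_sum[of 0] by (auto simp: cyc_components_def)
  moreover have "0 \<in> cyc_hom C (int 0)" by (rule scaleC.subspace_0[OF hom_subspace])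
  ultimately show ?thesis using hom_mult[of "c i" i 0 0] by simp
qed

lemma zsign_hom:
  assumes "w \<in> cyc_hom C (int j)"
  shows "cyc_zsign C w = signed j w"
proof -
  let ?c = "\<lambda>i. if i = int j then w else 0"
  have "cyc_components C w ?c"
    using assms zero_hom by (cases "w = 0") (auto simp: cyc_components_def)
  then have "(THE c. cyc_components C w c) = ?c"
    by (rule the1_equality[OF hom_direct_sum])
  then show ?thesis
    by (cases "w = 0") (auto simp: cyc_zsign_def Let_def signed_def)
qed


text \<open>The matrix of forms \<open>z (dz)\<^sup>k\<close>, a noncommutative Chern character form.\<close>

definition chern :: "nat \<Rightarrow> 'a matrix \<Rightarrow> nat \<Rightarrow> 'w matrix"
  where "chern m z k = mat_rpow (*) m (\<lambda>i j. cyc_emb C (z i j)) (\<lambda>i j. dd (z i j)) k"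

lemma cyc_form_snoc: "cyc_form C a0 (as @ [a]) = cyc_form C a0 as * dd a"
  by (simp add: cyc_form_def)

text \<open>
  Besides \<open>T = \<A>\<close>, the case of interest is \<open>T = {1}\<close>: the forms \<open>da\<^sub>1 \<dots> da\<^sub>k\<close>, whose integral vanishes
  for \<open>k = n\<close>.
\<close>

definition forms_from :: "'a set \<Rightarrow> nat \<Rightarrow> 'w set"
  where "forms_from T k = scaleC.span {cyc_form C a0 as |a0 as. a0 \<in> T \<and> set as \<subseteq> cyc_alg C \<and> length as = k}"

lemma forms_from_alg: "forms_from (cyc_alg C) k = cyc_forms C k"
  by (simp add: forms_from_def cyc_forms_def)

lemma forms_from_mult:
  assumes "w \<in> forms_from T k" "a \<in> cyc_alg C"
  shows "w * dd a \<in> forms_from T (Suc k)"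
  using assms(1) unfolding forms_from_def
proof (induction w rule: scaleC.span_induct_alt)
  case base
  then show ?case by (simp add: scaleC.span_zero)
next
  case (step c x y)
  then obtain a0 as where x: "x = cyc_form C a0 as" "a0 \<in> T" "set as \<subseteq> cyc_alg C" "length as = k" by auto
  then have "x * dd a = cyc_form C a0 (as @ [a])" by (simp add: cyc_form_snoc)
  moreover have "cyc_form C a0 (as @ [a]) \<in> {cyc_form C a0 as |a0 as. a0 \<in> T \<and> set as \<subseteq> cyc_alg C \<and> length as = Suc k}"
    using x assms(2) by (intro CollectI exI[of _ a0] exI[of _ "as @ [a]"]) auto
  ultimately have "x * dd a \<in> scaleC.span {cyc_form C a0 as |a0 as. a0 \<in> T \<and> set as \<subseteq> cyc_alg C \<and> length as = Suc k}"
    by (simp add: scaleC.span_base)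
  then show ?case
    using step by (simp add: distrib_right mult_scaleC_left scaleC.span_add scaleC.span_scale)
qed

lemma rpow_forms:
  assumes "\<And>i j. z i j \<in> cyc_alg C" "\<And>i j. X i j \<in> forms_from T l"
  shows "mat_rpow (*) m X (\<lambda>i j. dd (z i j)) k i j \<in> forms_from T (l + k)"
proof (induction k arbitrary: i j)
  case 0
  then show ?case using assms by (simp add: mat_rpow_0)
next
  case (Suc k)
  then show ?case
    using assms forms_from_mult[OF Suc.IH assms(1)]
    by (auto simp: mat_rpow_Suc mat_mult_apply forms_from_def intro!: scaleC.span_sum scaleC.span_zero)
qed

lemma emb_forms: "a \<in> T \<Longrightarrow> cyc_emb C a \<in> forms_from T 0"
  unfolding forms_from_def by (rule scaleC.span_base) (auto simp: cyc_form_def)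

lemma trace_idom:
  assumes "\<And>i j. X i j \<in> cyc_forms C n"
  shows "mat_tr m X \<in> cyc_idom C"
  unfolding mat_tr_def using assms C2_dom by (intro scaleC.subspace_sum[OF idom_subspace]) auto

lemma int_closed_forms:
  assumes "w \<in> forms_from {1} n"
  shows "w \<in> cyc_idom C \<and> cyc_int C w = 0"
  using assms unfolding forms_from_def
proof (induction w rule: scaleC.span_induct_alt)
  case base
  then show ?case
    using scaleC.subspace_0[OF idom_subspace] int_scaleC[of 0 0] by auto
next
  case (step c x y)
  then obtain as where x: "x = cyc_form C 1 as" "set as \<subseteq> cyc_alg C" "length as = n" by auto
  then have "x \<in> cyc_forms C n"
    unfolding cyc_forms_def using one_alg by (intro scaleC.span_base) auto
  then have "x \<in> cyc_idom C" using C2_dom by auto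
  then show ?case
    using step x C2_closed[of as] scaleC.subspace_add[OF idom_subspace] scaleC.subspace_scale[OF idom_subspace]
    by (auto simp: int_add int_scaleC)
qed

end

text \<open>
  Below, \<open>E\<close> stands in for the unit matrix: the image of \<open>1\<close> under the embedding need not be a unit of \<open>\<Omega>\<close>,
  but it acts as one on the entries of \<open>z\<close> and \<open>dz\<close>.
\<close>

locale osu_in_cycle = n_cycle n C
  for n and C :: "('a::graded_cstar_algebra, 'w::{complex_algebra, topological_space}) cycle_data" +
  fixes m :: nat and z :: "'a matrix"
  assumes osu: "z \<in> OSU (mat_alg m base_alg)" and smooth: "\<And>i j. z i j \<in> cyc_alg C"
begin

abbreviation mm :: "'w matrix \<Rightarrow> 'w matrix \<Rightarrow> 'w matrix" (infixl \<open>\<odot>\<close> 70)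
  where "X \<odot> Y \<equiv> mat_mult (*) m X Y"

definition "Z = (\<lambda>i j. cyc_emb C (z i j))"
definition "dZ = (\<lambda>i j. dd (z i j))"
definition "E = (\<lambda>i j. cyc_emb C (mat_diag m 1 i j))"

lemma z_facts: "grading (z i j) = - z i j" "\<not> (i < m \<and> j < m) \<Longrightarrow> z i j = 0"
  "mat_mult (*) m z z = mat_diag m 1"
  using osu by (auto simp: OSU_mat_iff base_alg_def)

lemma dZ_hom: "dZ i j \<in> cyc_hom C 1" "cyc_grad C (dZ i j) = - dZ i j"
  unfolding dZ_def by (rule dd_odd[OF smooth z_facts(1)])+

lemma Z_grad: "cyc_grad C (Z i j) = - Z i j"
  by (simp add: Z_def z_facts emb_simps flip: emb_grading)

lemma outside: "\<not> (i < m \<and> j < m) \<Longrightarrow> Z i j = 0" "\<not> (i < m \<and> j < m) \<Longrightarrow> dZ i j = 0"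
proof -
  show "Z i j = 0" if "\<not> (i < m \<and> j < m)" using z_facts(2)[OF that] by (simp add: Z_def emb_simps(3))
  show "dZ i j = 0" if "\<not> (i < m \<and> j < m)" using dd_zero unfolding dZ_def z_facts(2)[OF that] .
qed

lemma E_apply: "E i j = (if i < m \<and> j = i then cyc_emb C 1 else 0)"
  by (simp add: E_def mat_diag_def emb_simps(3))

lemma E_left: "E \<odot> Z = Z" "E \<odot> dZ = dZ"
  using outside by (auto simp: mat_mult_apply E_apply fun_eq_iff if_distrib[of "\<lambda>x. x * _"] one_emb Z_def dZ_def one_dd smooth cong: if_cong)

lemma E_right: "Z \<odot> E = Z" "dZ \<odot> E = dZ"
proof -
  have E': "E i j = (if i = j \<and> j < m then cyc_emb C 1 else 0)" for i j by (auto simp: E_apply)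
  show "Z \<odot> E = Z" "dZ \<odot> E = dZ"
    using outside by (auto simp: mat_mult_apply E' fun_eq_iff if_distrib[of "(*) _"] one_emb Z_def dZ_def dd_one_right smooth cong: if_cong)
qed

text \<open>The Leibniz rule applied to \<open>z\<^sup>2 = 1\<close>.\<close>

lemma dZ_Z: "dZ \<odot> Z = - (Z \<odot> dZ)"
proof (intro ext)
  fix i j
  have "(dZ \<odot> Z) i j + (Z \<odot> dZ) i j = 0"
  proof (cases "i < m \<and> j < m")
    case True
    then have "(dZ \<odot> Z) i j + (Z \<odot> dZ) i j = (\<Sum>l<m. dd (z i l * z l j))"
      by (simp add: mat_mult_apply Z_def dZ_def dd_mult smooth sum.distrib)
    also have "\<dots> = dd (mat_mult (*) m z z i j)"
      using True smooth alg_mult by (simp add: dd_sum mat_mult_apply)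
    also have "\<dots> = 0" by (simp add: z_facts mat_diag_def dd_one dd_zero)
    finally show ?thesis .
  qed (auto simp: mat_mult_apply)
  then show "(dZ \<odot> Z) i j = (- (Z \<odot> dZ)) i j" by (simp add: eq_neg_iff_add_eq_0)
qed

abbreviation "R k \<equiv> mat_rpow (*) m Z dZ k"
abbreviation "L k \<equiv> mat_rpow (*) m E dZ k"

lemma R_chern: "R k = chern m z k"
  by (simp add: chern_def Z_def dZ_def)

lemma R_E: "R k \<odot> E = R k"
  by (induction k) (simp_all add: mat_rpow_0 mat_rpow_Suc E_right mat_mult_assoc)

lemma mm_minus: "X \<odot> (- Y) = - (X \<odot> Y)" "(- X) \<odot> Y = - (X \<odot> Y)"
  by (auto simp: mat_mult_apply fun_eq_iff sum_negf)

lemma mm_scale: "(\<lambda>i j. c *\<^sub>C X i j) \<odot> Y = (\<lambda>i j. c *\<^sub>C (X \<odot> Y) i j)"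
  by (auto simp: mat_mult_apply fun_eq_iff mult_scaleC_left scaleC.scale_sum_right)

lemma L_Z: "L k \<odot> Z = (\<lambda>i j. (-1) ^ k *\<^sub>C R k i j)"
proof (induction k)
  case 0
  then show ?case by (simp add: mat_rpow_0 E_left)
next
  case (Suc k)
  have "L (Suc k) \<odot> Z = - ((L k \<odot> Z) \<odot> dZ)"
    by (simp add: mat_rpow_Suc mat_mult_assoc dZ_Z mm_minus)
  also have "\<dots> = (\<lambda>i j. (-1) ^ Suc k *\<^sub>C R (Suc k) i j)"
    by (simp add: Suc mm_scale mat_rpow_Suc fun_eq_iff)
  finally show ?case .
qed

lemma zsign_dZ: "cyc_zsign C (c *\<^sub>C dZ i j) = - (c *\<^sub>C dZ i j)"
proof -
  have "c *\<^sub>C dZ i j \<in> cyc_hom C (int 1)"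
    using scaleC.subspace_scale[OF hom_subspace[of 1]] dZ_hom(1) by simp
  then show ?thesis using zsign_hom[of _ 1] by (simp add: signed_def)
qed

lemma zsign_zero: "cyc_zsign C 0 = 0"
  using zsign_hom[of 0 0] zero_hom by (simp add: signed_def)

lemmas cyc_grad_simps = module_hom.scale[OF grad_linear] module_hom.zero[OF grad_linear]
  module_hom.neg[OF grad_linear]

text \<open>
  The pointwise computation for \<open>Y = a \<rho> + b z\<close> with \<open>a' = \<partial>\<^sub>t a\<close> and \<open>b' = \<partial>\<^sub>t b\<close>: each of the
  \<open>k\<close> positions of \<open>dt\<close> in \<open>(Y - \<rho>) (d\<^sup>s Y)\<^sup>k\<close> contributes the same multiple of \<open>z (dz)\<^sup>k\<^sup>-\<^sup>1\<close>
  to the coefficient of \<open>\<rho> \<and> dt\<close>.  The recursion for this coefficient involves,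
  besides itself, only the \<open>dt\<close>-free parts, whence the first two claims.
\<close>

lemma clifford_power:
  fixes a b a' b' :: complex
  defines "X \<equiv> (\<lambda>i j S. if S = {} then (b *\<^sub>C Z i j, 0) else if S = {1::nat} then ((a - 1) *\<^sub>C E i j, 0) else (0, 0))"
    and "D \<equiv> (\<lambda>i j S. if S = {} then (b *\<^sub>C dZ i j, b' *\<^sub>C Z i j) else if S = {1::nat} then (0, a' *\<^sub>C E i j) else (0, 0))"
  defines "W \<equiv> mat_rpow (cl_mult 1 (wedge_mult C) (wedge_grad C)) m X D"
  shows "fst (W k i j {}) = b ^ Suc k *\<^sub>C R k i j"
    and "fst (W k i j {1}) = ((- b) ^ k * (a - 1)) *\<^sub>C L k i j"
    and "snd (W k i j {1}) = (of_nat k * b ^ (k - 1) * (b * a' - (a - 1) * b')) *\<^sub>C R (k - 1) i j"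
proof (induction k arbitrary: i j)
  case 0
  { case 1 show ?case by (simp add: W_def X_def mat_rpow_0) next
    case 2 show ?case by (simp add: W_def X_def mat_rpow_0) next
    case 3 show ?case by (simp add: W_def X_def mat_rpow_0) }
next
  case (Suc k)
  have WS: "W (Suc k) i j S = (if i < m \<and> j < m then \<Sum>l<m. cl_mult 1 (wedge_mult C) (wedge_grad C) (W k i l) (D l j) S else 0)"
    for i j S
    unfolding W_def mat_rpow_Suc mat_mult_apply by (simp add: fun_sum_apply)
  have S: "W (Suc k) i j {} = (if i < m \<and> j < m then \<Sum>l<m. wedge_mult C (W k i l {}) (D l j {}) + wedge_mult C (W k i l {1}) (wedge_grad C (D l j {1})) else 0)"
    "W (Suc k) i j {1} = (if i < m \<and> j < m then \<Sum>l<m. wedge_mult C (W k i l {}) (D l j {1}) + wedge_mult C (W k i l {1}) (wedge_grad C (D l j {})) else 0)"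
    for i j unfolding WS cl_mult_1 by simp_all
  have wedge: "fst (wedge_mult C p q) = fst p * fst q" "snd (wedge_mult C p q) = fst p * snd q + snd p * cyc_zsign C (fst q)"
    "fst (wedge_grad C p) = cyc_grad C (fst p)" "snd (wedge_grad C p) = cyc_grad C (snd p)" for p q
    by (simp_all add: wedge_mult_def wedge_grad_def split: prod.splits)
  have D: "D l j {} = (b *\<^sub>C dZ l j, b' *\<^sub>C Z l j)" "D l j {1} = (0, a' *\<^sub>C E l j)" for l j
    by (simp_all add: D_def)
  { case 1
    show ?case
      unfolding S
      by (simp add: fst_sum wedge D cyc_grad_simps Suc.IH mat_rpow_Suc mat_mult_apply mult_scaleC_left
          mult_scaleC_right scaleC_scaleC scaleC.scale_sum_right ac_simps
          del: One_nat_def) }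
  { case 2
    show ?case
      unfolding S
      by (simp add: fst_sum wedge D cyc_grad_simps dZ_hom sum_negf Suc.IH mat_rpow_Suc mat_mult_apply mult_scaleC_left
          mult_scaleC_right scaleC_scaleC scaleC.scale_sum_right ac_simps
          del: One_nat_def) }
  { case 3
    show ?case
    proof (cases "i < m \<and> j < m")
      case True
      have zs: "cyc_zsign C (b *\<^sub>C cyc_grad C (dZ l j)) = b *\<^sub>C dZ l j" for l
        using zsign_dZ[of "- b" l j] by (simp add: cyc_grad_simps dZ_hom)
      have "snd (W (Suc k) i j {1}) = (a' * b ^ Suc k) *\<^sub>C (R k \<odot> E) i j
          + (- (b' * ((- b) ^ k * (a - 1)))) *\<^sub>C (L k \<odot> Z) i j
          + (b * (of_nat k * b ^ (k - 1) * (b * a' - (a - 1) * b'))) *\<^sub>C (R (k - 1) \<odot> dZ) i j"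
        using True unfolding S
        by (simp add: snd_sum wedge D zs zsign_zero Z_grad cyc_grad_simps(1) Suc.IH mat_mult_apply mult_scaleC_left
            mult_scaleC_right scaleC_scaleC scaleC.scale_sum_right sum.distrib ac_simps sum_negf sum_subtractf del: One_nat_def)
      also have "(- (b' * ((- b) ^ k * (a - 1)))) *\<^sub>C (L k \<odot> Z) i j = (- ((a - 1) * b' * b ^ k)) *\<^sub>C R k i j"
      proof -
        have "(- b) ^ k * (- 1) ^ k = b ^ k" by (simp flip: power_mult_distrib)
        then have "- (b' * ((- b) ^ k * (a - 1))) * (- 1) ^ k = - ((a - 1) * b' * b ^ k)"
          by (simp add: mult.assoc mult.left_commute mult.commute)
        then show ?thesis by (simp only: L_Z scaleC_scaleC)
      qed
      also have "(b * (of_nat k * b ^ (k - 1) * (b * a' - (a - 1) * b'))) *\<^sub>C (R (k - 1) \<odot> dZ) i j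
          = (of_nat k * b ^ k * (b * a' - (a - 1) * b')) *\<^sub>C R k i j"
        by (cases k) (simp_all add: mat_rpow_Suc ac_simps)
      also have "(a' * b ^ Suc k) *\<^sub>C (R k \<odot> E) i j + (- ((a - 1) * b' * b ^ k)) *\<^sub>C R k i j
          + (of_nat k * b ^ k * (b * a' - (a - 1) * b')) *\<^sub>C R k i j
          = (of_nat (Suc k) * b ^ k * (b * a' - (a - 1) * b')) *\<^sub>C R k i j"
        by (simp only: R_E scaleC_add_left[symmetric]) (simp add: algebra_simps)
      finally show ?thesis by simp
    next
      case False
      then have "R k i j = 0" by (cases k) (auto simp: mat_rpow_0 mat_rpow_Suc outside mat_mult_apply)
      with False show ?thesis unfolding S by auto
    qed }
qed

end

context osu_in_cycle
begin

definition chern_number :: complex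
  where "chern_number = cyc_int C (mat_tr m (chern m z n))"

lemma dd_diag_one: "dd (mat_diag m 1 i j) = 0"
  by (auto simp: mat_diag_def dd_one dd_zero)

lemma chern_forms: "chern m z k i j \<in> cyc_forms C k"
  using rpow_forms[of z "\<lambda>i j. cyc_emb C (z i j)" "cyc_alg C" 0 m k i j, OF smooth emb_forms[OF smooth]]
  by (simp add: chern_def forms_from_alg)

lemma susp_integrand:
  fixes Y :: "real \<Rightarrow> (nat set \<Rightarrow> 'a) matrix" and a b a' b' :: real
  assumes Y: "Y t = cpair (\<lambda>i j. b *\<^sub>R z i j) (\<lambda>i j. a *\<^sub>R mat_diag m 1 i j)"
    and Y': "\<And>i j S. vector_derivative (\<lambda>s. Y s i j S) (at t within {0..1})
        = cpair (\<lambda>i j. b' *\<^sub>R z i j) (\<lambda>i j. a' *\<^sub>R mat_diag m 1 i j) i j S"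
  shows "(let mul = cl_mult 1 (wedge_mult C) (wedge_grad C);
         Z = mat_rpow mul m
               (\<lambda>i j S. wedge_fun C (Y t i j S - rho_mat m i j S))
               (\<lambda>i j S. susp_d C (\<lambda>s. Y s i j S) t) (n + 1)
     in cyc_int C (kappa_cl 1 (\<lambda>S. snd (mat_tr m Z S))))
   = kappa * of_nat (n + 1) * complex_of_real (b ^ n * (b * a' - (a - 1) * b')) * chern_number"
proof -
  let ?mul = "cl_mult 1 (wedge_mult C) (wedge_grad C)"
  have X: "(\<lambda>i j S. wedge_fun C (Y t i j S - rho_mat m i j S))
      = (\<lambda>i j S. if S = {} then (of_real b *\<^sub>C Z i j, 0) else if S = {1::nat} then ((of_real a - 1) *\<^sub>C E i j, 0) else (0, 0))"
    by (auto simp: fun_eq_iff Y rho_mat_cpair cpair_apply wedge_fun_def scaleR_scaleC emb_simps Z_def E_def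
        scaleC.scale_left_diff_distrib)
  have D: "(\<lambda>i j S. susp_d C (\<lambda>s. Y s i j S) t)
      = (\<lambda>i j S. if S = {} then (of_real b *\<^sub>C dZ i j, of_real b' *\<^sub>C Z i j)
          else if S = {1::nat} then (0, of_real a' *\<^sub>C E i j) else (0, 0))"
  proof (intro ext)
    fix i j S
    have "mat_diag m 1 i j \<in> cyc_alg C" using one_alg alg_closed(3) by (simp add: mat_diag_def)
    then have "dd (of_real b *\<^sub>C z i j) = of_real b *\<^sub>C dZ i j" "dd (of_real a *\<^sub>C mat_diag m 1 i j) = 0"
      by (simp_all only: dd_scaleC smooth dZ_def dd_diag_one scaleC.scale_zero_right)
    then show "susp_d C (\<lambda>s. Y s i j S) t = (if S = {} then (of_real b *\<^sub>C dZ i j, of_real b' *\<^sub>C Z i j)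
          else if S = {1::nat} then (0, of_real a' *\<^sub>C E i j) else (0, 0))"
      unfolding susp_d_def Y' Y cpair_apply scaleR_scaleC
      using dd_zero emb_simps(2,3) by (simp add: Z_def E_def)
  qed
  let ?W = "mat_rpow ?mul m (\<lambda>i j S. wedge_fun C (Y t i j S - rho_mat m i j S))
               (\<lambda>i j S. susp_d C (\<lambda>s. Y s i j S) t) (n + 1)"
  let ?c = "complex_of_real (b ^ n * (b * a' - (a - 1) * b'))"
  have W: "snd (?W i j {1}) = (of_nat (n + 1) * ?c) *\<^sub>C R n i j" for i j
    unfolding X D clifford_power(3) by (simp add: mult.assoc)
  have "kappa_cl 1 (\<lambda>S. snd (mat_tr m ?W S)) = (kappa * (of_nat (n + 1) * ?c)) *\<^sub>C mat_tr m (chern m z n)"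
  proof -
    have "{1..1::nat} = {1}" by auto
    then show ?thesis
      unfolding kappa_cl_def mat_tr_def fun_sum_apply snd_sum
      by (simp only: W R_chern scaleC.scale_sum_right[symmetric] scaleC_scaleC power_one_right)
  qed
  moreover have "mat_tr m (chern m z n) \<in> cyc_idom C"
    by (intro trace_idom chern_forms)
  ultimately show ?thesis
    unfolding Let_def by (simp only: int_scaleC chern_number_def mult.assoc)
qed

end

section \<open>Evaluation on the step loop\<close>

text \<open>The cosine term is the derivative of a power of the sine and integrates to zero.\<close>

lemma sine_integral_shift:
  "((\<lambda>u. sin (pi * u) ^ n * (1 + c * cos (pi * u))) has_integral integral {0..1} (\<lambda>t::real. sin (pi * t) ^ n)) {0..1}"
proof -
  have "((\<lambda>t::real. sin (pi * t) ^ n) has_integral integral {0..1} (\<lambda>t::real. sin (pi * t) ^ n)) {0..1}"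
    by (intro integrable_integral integrable_continuous_interval continuous_intros)
  moreover have "((\<lambda>u. sin (pi * u) ^ n * cos (pi * u)) has_integral
     sin (pi * 1) ^ Suc n / (pi * real (Suc n)) - sin (pi * 0) ^ Suc n / (pi * real (Suc n))) {0..1}"
  proof (rule fundamental_theorem_of_calculus)
    fix t :: real
    have "((\<lambda>u. sin (pi * u) ^ Suc n / (pi * real (Suc n))) has_real_derivative
        real (Suc n) * (cos (pi * t) * pi) * sin (pi * t) ^ n / (pi * real (Suc n))) (at t within {0..1})"
      by (rule derivative_eq_intros refl | simp)+
    moreover have "real (Suc n) * (cos (pi * t) * pi) * sin (pi * t) ^ n / (pi * real (Suc n)) = sin (pi * t) ^ n * cos (pi * t)"
      by (simp del: of_nat_Suc)
    ultimately show "((\<lambda>u. sin (pi * u) ^ Suc n / (pi * real (Suc n))) has_vector_derivative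
        sin (pi * t) ^ n * cos (pi * t)) (at t within {0..1})"
      by (simp only: has_real_derivative_iff_has_vector_derivative)
  qed simp
  ultimately have "((\<lambda>u. sin (pi * u) ^ n + c * (sin (pi * u) ^ n * cos (pi * u))) has_integral
      integral {0..1} (\<lambda>t::real. sin (pi * t) ^ n) + c * 0) {0..1}"
    by (intro has_integral_add has_integral_mult_right) simp_all
  then show ?thesis by (simp add: algebra_simps)
qed

lemma has_integral_affine_half:
  fixes f :: "real \<Rightarrow> 'b::euclidean_space"
  assumes "(f has_integral I) {0..1}"
  shows "((\<lambda>t. f (2 * t - c)) has_integral (1/2) *\<^sub>R I) {c/2..(c+1)/2}"
proof -
  have "((\<lambda>t. f (2 *\<^sub>R t + - c)) has_integral I /\<^sub>R 2 ^ DIM(real)) (cbox ((0 - - c) /\<^sub>R 2) ((1 - - c) /\<^sub>R 2))"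
    by (rule has_integral_affinity') (use assms in auto)
  moreover have "cbox ((0 - - c) /\<^sub>R 2) ((1 - - c) /\<^sub>R 2) = {c/2..(c+1)/2}"
    by (auto simp: field_simps)
  moreover have "I /\<^sub>R 2 ^ DIM(real) = (1/2) *\<^sub>R I"
    by (simp only: DIM_real power_one_right inverse_eq_divide)
  moreover have "(\<lambda>t. f (2 *\<^sub>R t + - c)) = (\<lambda>t. f (2 * t - c))" by simp
  ultimately show ?thesis by (simp only:)
qed

context n_cycle
begin

lemma int_diff: "v \<in> cyc_idom C \<Longrightarrow> w \<in> cyc_idom C \<Longrightarrow> cyc_int C (v - w) = cyc_int C v - cyc_int C w"
  using int_add[of v "(-1) *\<^sub>C w"] scaleC.subspace_scale[OF idom_subspace, of w "-1"] int_scaleC[of w "-1"]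
  by simp

lemma int_zero: "cyc_int C 0 = 0"
  using int_scaleC[of 0 0] scaleC.subspace_0[OF idom_subspace] by simp

text \<open>
  The correction term of the pairing is the integral of the trace of \<open>e (dx)\<^sup>n\<close>, not of \<open>e (de)\<^sup>n\<close>.
  For \<open>n = 0\<close> they agree.  For \<open>n > 0\<close> the latter vanishes because \<open>de = 0\<close>, and the former because
  \<open>e dx = d(e x)\<close>, so that the integral vanishes by closedness.
\<close>

lemma pairing_rep_eq:
  assumes x: "(m, x) \<in> smooth_osus C"
    and e: "e \<in> OSU base_alg" "e \<in> cyc_alg C" "dd e = 0"
  shows "pairing_rep n C e (m, x)
    = osu_in_cycle.chern_number n C m x - osu_in_cycle.chern_number n C m (mat_diag m e)"
proof -
  have zero: "0 \<in> cyc_alg C" by (rule alg_closed(3))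
  interpret x: osu_in_cycle n C m x
    using x by unfold_locales (auto simp: smooth_osus_def)
  interpret e: osu_in_cycle n C m "mat_diag m e"
    using base_OSU_diag[OF e(1)] e(2) zero by unfold_locales (auto simp: mat_diag_def)
  let ?X = "\<lambda>i j. cyc_emb C (x i j)" and ?E = "\<lambda>i j. cyc_emb C (mat_diag m e i j)" and ?D = "\<lambda>i j. dd (x i j)"
  have tr: "mat_tr m (\<lambda>i j. U i j - V i j) = mat_tr m U - mat_tr m V" for U V :: "'w matrix"
    by (simp add: mat_tr_def sum_subtractf)
  have Ef: "mat_rpow (*) m ?E ?D n i j \<in> cyc_forms C n" for i j
    using rpow_forms[of x ?E "cyc_alg C" 0 m n i j, OF x.smooth emb_forms[OF e.smooth]]
    by (simp add: forms_from_alg)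
  have "pairing_rep n C e (m, x) = cyc_int C (mat_tr m (chern m x n)) - cyc_int C (mat_tr m (mat_rpow (*) m ?E ?D n))"
    unfolding pairing_rep_def
    by (simp add: emb_simps mat_rpow_minus tr flip: chern_def)
       (intro int_diff trace_idom Ef x.chern_forms)
  also have "cyc_int C (mat_tr m (mat_rpow (*) m ?E ?D n)) = e.chern_number"
  proof (cases n)
    case 0
    then show ?thesis unfolding e.chern_number_def chern_def by (simp add: mat_rpow_0)
  next
    case (Suc k)
    have de: "dd (mat_diag m e i j) = 0" for i j
      using e(3) dd_zero by (simp add: mat_diag_def)
    have "chern m (mat_diag m e) n = (\<lambda>i j. 0)"
      by (simp add: chern_def Suc mat_rpow_Suc mat_mult_apply de fun_eq_iff)
    then have "e.chern_number = 0"
      by (simp add: e.chern_number_def mat_tr_def int_zero)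
    moreover have "mat_rpow (*) m ?E ?D n = mat_rpow (*) m (mat_mult (*) m ?E ?D) ?D k"
      using funpow_swap1[of "\<lambda>Z. mat_mult (*) m Z ?D" k ?E] by (simp add: Suc mat_rpow_def)
    moreover have "mat_mult (*) m ?E ?D i j \<in> forms_from {1} 1" for i j
    proof (cases "i < m \<and> j < m")
      case True
      have ite: "cyc_emb C (if l = i then e else 0) * w = (if l = i then cyc_emb C e * w else 0)" for l w
        by (simp add: emb_simps(3))
      have "mat_mult (*) m ?E ?D i j = cyc_emb C e * dd (x i j)"
        using True by (simp add: mat_mult_apply mat_diag_def ite)
      also have "\<dots> = cyc_emb C 1 * dd (e * x i j)"
        unfolding one_dd[OF alg_mult[OF e(2) x.smooth]] by (simp add: e(2,3) x.smooth dd_mult)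
      also have "\<dots> \<in> forms_from {1} 1"
        unfolding forms_from_def using e(2) x.smooth alg_mult
        by (intro scaleC.span_base CollectI exI[of _ 1] exI[of _ "[e * x i j]"]) (auto simp: cyc_form_def)
      finally show ?thesis .
    qed (auto simp: mat_mult_apply forms_from_def scaleC.span_zero)
    then have "mat_rpow (*) m (mat_mult (*) m ?E ?D) ?D k i j \<in> forms_from {1} n" for i j
      using rpow_forms[of x "mat_mult (*) m ?E ?D" "{1}" 1 m k i j, OF x.smooth] Suc by simp
    then have "mat_tr m (mat_rpow (*) m (mat_mult (*) m ?E ?D) ?D k) \<in> forms_from {1} n"
      unfolding mat_tr_def forms_from_def by (intro scaleC.span_sum) auto
    ultimately show ?thesis using int_closed_forms by simp
  qed
  finally show ?thesis by (simp add: x.chern_number_def)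
qed


end

lemma cpair_derivative:
  fixes X Y :: "'a::real_normed_vector matrix"
  assumes "(b has_real_derivative b') (at t)" "(a has_real_derivative a') (at t)"
  shows "((\<lambda>s. cpair (\<lambda>i j. b s *\<^sub>R X i j) (\<lambda>i j. a s *\<^sub>R Y i j) i j S) has_vector_derivative
    cpair (\<lambda>i j. b' *\<^sub>R X i j) (\<lambda>i j. a' *\<^sub>R Y i j) i j S) (at t)"
  using has_vector_derivative_scaleR[OF assms(1) has_vector_derivative_const[of "X i j"]]
    has_vector_derivative_scaleR[OF assms(2) has_vector_derivative_const[of "Y i j"]]
  by (simp add: cpair_apply)

lemma vector_derivative_local:
  fixes f g :: "real \<Rightarrow> 'b::real_normed_vector"
  assumes "(g has_vector_derivative D) (at t)" "open T" "t \<in> T" "\<And>s. s \<in> T \<Longrightarrow> f s = g s" "0 \<le> t" "t \<le> 1"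
  shows "vector_derivative f (at t within {0..1}) = D"
  by (rule vector_derivative_at_within_ivl[OF has_vector_derivative_transform_within_open[OF assms(1,2,3)]])
     (use assms in auto)

context n_cycle
begin

text \<open>
  Both halves of the interval are rescaled to \<open>[0, 1]\<close>, by \<open>u = 2t\<close> and \<open>u = 2t - 1\<close>; on the second half
  \<open>sin(2\<pi>t) = - sin(\<pi>u)\<close> and \<open>cos(2\<pi>t) = - cos(\<pi>u)\<close>.  The scalar factors become
  \<open>\<plusminus> 2 \<pi> (- 1)\<^sup>n sin\<^sup>n(\<pi>u) (1 \<mp> cos(\<pi>u))\<close>, and the sign of the cosine does not affect the integral.
\<close>

lemma susp_pairing_rep_step:
  assumes x: "(m, x) \<in> smooth_osus C"
    and e: "e \<in> OSU base_alg" "e \<in> cyc_alg C" "dd e = 0"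
  shows "susp_pairing_rep n C (m, step_loop e m x) =
    (- 1) ^ (n + 1) * kappa * complex_of_real pi * of_nat (n + 1)
         * complex_of_real (integral {0..1} (\<lambda>t::real. sin (pi * t) ^ n)) * pairing_rep n C e (m, x)"
proof -
  have zero: "0 \<in> cyc_alg C" by (rule alg_closed(3))
  interpret x: osu_in_cycle n C m x
    using x by unfold_locales (auto simp: smooth_osus_def)
  interpret e: osu_in_cycle n C m "mat_diag m e"
    using base_OSU_diag[OF e(1)] e(2) zero by unfold_locales (auto simp: mat_diag_def)
  let ?Y = "step_loop e m x"
  let ?\<alpha> = "integral {0..1} (\<lambda>t::real. sin (pi * t) ^ n)"
  define K where "K = kappa * of_nat (n + 1)"
  define F where "F = (\<lambda>t. let mul = cl_mult 1 (wedge_mult C) (wedge_grad C);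
         Z = mat_rpow mul m
               (\<lambda>i j S. wedge_fun C (?Y t i j S - rho_mat m i j S))
               (\<lambda>i j S. susp_d C (\<lambda>s. ?Y s i j S) t) (n + 1)
     in cyc_int C (kappa_cl 1 (\<lambda>S. snd (mat_tr m Z S))))"
  have d: "((\<lambda>s. - sin (2 * pi * s)) has_real_derivative - cos (2 * pi * t) * (2 * pi)) (at t)"
    "((\<lambda>s. sin (2 * pi * s)) has_real_derivative cos (2 * pi * t) * (2 * pi)) (at t)"
    "((\<lambda>s. cos (2 * pi * s)) has_real_derivative - sin (2 * pi * t) * (2 * pi)) (at t)" for t
    by (auto intro!: derivative_eq_intros)
  have sc: "sin y * sin y = 1 - cos y * cos (y::real)" for y
    using sin_squared_eq[of y] by (simp add: power2_eq_square)
  have left: "F t = K * e.chern_number * (- 1) ^ n * complex_of_real (2 * pi) *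
      complex_of_real (sin (pi * (2 * t - 0)) ^ n * (1 + (- 1) * cos (pi * (2 * t - 0))))" if "0 < t" "t < 1/2" for t
  proof -
    have "vector_derivative (\<lambda>s. ?Y s i j S) (at t within {0..1}) =
        cpair (\<lambda>i j. (- cos (2 * pi * t) * (2 * pi)) *\<^sub>R mat_diag m e i j) (\<lambda>i j. (- sin (2 * pi * t) * (2 * pi)) *\<^sub>R mat_diag m 1 i j) i j S" for i j S
      by (rule vector_derivative_local[OF cpair_derivative[OF d(1) d(3)], where T = "{..<1/2}"])
         (use that in \<open>auto simp: step_loop_def cpair_apply\<close>)
    then have "F t = K * complex_of_real ((- sin (2 * pi * t)) ^ n * ((- sin (2 * pi * t)) * (- sin (2 * pi * t) * (2 * pi))
        - (cos (2 * pi * t) - 1) * (- cos (2 * pi * t) * (2 * pi)))) * e.chern_number"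
      unfolding F_def K_def
      by (intro e.susp_integrand) (use that in \<open>auto simp: step_loop_def\<close>)
    moreover have "(- sin (2 * pi * t)) ^ n * ((- sin (2 * pi * t)) * (- sin (2 * pi * t) * (2 * pi))
        - (cos (2 * pi * t) - 1) * (- cos (2 * pi * t) * (2 * pi)))
      = (- 1) ^ n * (2 * pi) * (sin (pi * (2 * t - 0)) ^ n * (1 + (- 1) * cos (pi * (2 * t - 0))))"
    proof -
      have "(- sin (2 * pi * t)) * (- sin (2 * pi * t) * (2 * pi)) = 2 * pi * (1 - cos (2 * pi * t) * cos (2 * pi * t))"
        by (simp flip: sc)
      moreover have "(- sin (2 * pi * t)) ^ n = (- 1) ^ n * sin (2 * pi * t) ^ n" by (rule power_minus)
      moreover have "pi * (2 * t - 0) = 2 * pi * t" by simp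
      ultimately show ?thesis by (simp only:) (simp add: algebra_simps)
    qed
    ultimately have "F t = K * complex_of_real ((- 1) ^ n * (2 * pi) *
        (sin (pi * (2 * t - 0)) ^ n * (1 + (- 1) * cos (pi * (2 * t - 0))))) * e.chern_number"
      by (simp only:)
    then show ?thesis by simp
  qed
  have right: "F t = - (K * x.chern_number * (- 1) ^ n * complex_of_real (2 * pi)) *
      complex_of_real (sin (pi * (2 * t - 1)) ^ n * (1 + 1 * cos (pi * (2 * t - 1))))" if "1/2 < t" "t < 1" for t
  proof -
    have "vector_derivative (\<lambda>s. ?Y s i j S) (at t within {0..1}) =
        cpair (\<lambda>i j. (cos (2 * pi * t) * (2 * pi)) *\<^sub>R x i j) (\<lambda>i j. (- sin (2 * pi * t) * (2 * pi)) *\<^sub>R mat_diag m 1 i j) i j S" for i j S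
      by (rule vector_derivative_local[OF cpair_derivative[OF d(2) d(3)], where T = "{1/2<..}"])
         (use that in \<open>auto simp: step_loop_def cpair_apply\<close>)
    then have "F t = K * complex_of_real (sin (2 * pi * t) ^ n * (sin (2 * pi * t) * (- sin (2 * pi * t) * (2 * pi))
        - (cos (2 * pi * t) - 1) * (cos (2 * pi * t) * (2 * pi)))) * x.chern_number"
      unfolding F_def K_def
      by (intro x.susp_integrand) (use that in \<open>auto simp: step_loop_def\<close>)
    moreover have "sin (2 * pi * t) ^ n * (sin (2 * pi * t) * (- sin (2 * pi * t) * (2 * pi))
        - (cos (2 * pi * t) - 1) * (cos (2 * pi * t) * (2 * pi)))
      = - ((- 1) ^ n * (2 * pi) * (sin (pi * (2 * t - 1)) ^ n * (1 + 1 * cos (pi * (2 * t - 1)))))"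
    proof -
      have "sin (2 * pi * t) * (- sin (2 * pi * t) * (2 * pi)) = - (2 * pi * (1 - cos (2 * pi * t) * cos (2 * pi * t)))"
        by (simp flip: sc)
      moreover have "pi * (2 * t - 1) = 2 * pi * t - pi" by (simp add: algebra_simps)
      moreover have "sin (2 * pi * t - pi) = - sin (2 * pi * t)" "cos (2 * pi * t - pi) = - cos (2 * pi * t)"
        by (simp_all add: sin_diff cos_diff)
      moreover have "sin (2 * pi * t) ^ n = (- 1) ^ n * (- sin (2 * pi * t)) ^ n"
        by (simp flip: power_mult_distrib)
      ultimately show ?thesis by (simp only:) (simp add: algebra_simps)
    qed
    ultimately have "F t = K * complex_of_real (- ((- 1) ^ n * (2 * pi) *
        (sin (pi * (2 * t - 1)) ^ n * (1 + 1 * cos (pi * (2 * t - 1)))))) * x.chern_number"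
      by (simp only:)
    then show ?thesis by simp
  qed
  have half: "((\<lambda>t. c * complex_of_real (sin (pi * (2 * t - k)) ^ n * (1 + r * cos (pi * (2 * t - k))))) has_integral
      c * complex_of_real ((1/2) *\<^sub>R ?\<alpha>)) {k/2..(k+1)/2}" for c k r
    by (intro has_integral_mult_right has_integral_of_real has_integral_affine_half[OF sine_integral_shift])
  have 1: "(F has_integral K * e.chern_number * (- 1) ^ n * complex_of_real (2 * pi) * complex_of_real ((1/2) *\<^sub>R ?\<alpha>)) {0..1/2}"
    using half[of "K * e.chern_number * (- 1) ^ n * complex_of_real (2 * pi)" 0 "- 1"]
    by (intro has_integral_spike_finite[of "{0, 1/2}", OF _ left]) auto
  have 2: "(F has_integral - (K * x.chern_number * (- 1) ^ n * complex_of_real (2 * pi)) * complex_of_real ((1/2) *\<^sub>R ?\<alpha>)) {1/2..1}"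
    using half[of "- (K * x.chern_number * (- 1) ^ n * complex_of_real (2 * pi))" 1 1]
    by (intro has_integral_spike_finite[of "{1/2, 1}", OF _ right]) auto
  have "susp_pairing_rep n C (m, ?Y) = integral {0..1} F"
    by (simp add: susp_pairing_rep_def F_def)
  also have "\<dots> = K * e.chern_number * (- 1) ^ n * complex_of_real (2 * pi) * complex_of_real ((1/2) *\<^sub>R ?\<alpha>)
      + - (K * x.chern_number * (- 1) ^ n * complex_of_real (2 * pi)) * complex_of_real ((1/2) *\<^sub>R ?\<alpha>)"
    by (rule integral_unique[OF has_integral_combine[OF _ _ 1 2]]) simp_all
  also have "\<dots> = (- 1) ^ (n + 1) * kappa * complex_of_real pi * of_nat (n + 1)
         * complex_of_real ?\<alpha> * (x.chern_number - e.chern_number)"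
    by (simp add: K_def algebra_simps)
  finally show ?thesis
    by (simp only: pairing_rep_eq[OF x e])
qed

end

section \<open>Inverse square roots\<close>

text \<open>The Taylor coefficients of \<open>(1 - h)\<^sup>-\<^sup>1\<^sup>/\<^sup>2\<close>; by Vandermonde their convolution square is constantly \<open>1\<close>.\<close>

definition invsqrt_coeff :: "nat \<Rightarrow> real"
  where "invsqrt_coeff k = (-1) ^ k * ((-1/2) gchoose k)"

lemma invsqrt_coeff_convolution: "(\<Sum>i\<le>k. invsqrt_coeff i * invsqrt_coeff (k - i)) = 1"
proof -
  have "(\<Sum>i\<le>k. invsqrt_coeff i * invsqrt_coeff (k - i))
      = (\<Sum>i\<le>k. (-1) ^ k * (((-1/2) gchoose i) * ((-1/2) gchoose (k - i))))"
  proof (rule sum.cong)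
    fix i assume "i \<in> {..k}"
    then have "(-1::real) ^ k = (-1) ^ i * (-1) ^ (k - i)" by (simp flip: power_add)
    then show "invsqrt_coeff i * invsqrt_coeff (k - i) = (-1) ^ k * (((-1/2) gchoose i) * ((-1/2) gchoose (k - i)))"
      by (simp add: invsqrt_coeff_def)
  qed simp
  also have "\<dots> = (-1) ^ k * ((-1 :: real) gchoose k)"
    using gbinomial_Vandermonde[of "-1/2 :: real" "-1/2" k] by (simp add: atMost_atLeast0 flip: sum_distrib_left)
  also have "(-1 :: real) gchoose k = (-1) ^ k"
    using gbinomial_minus[of "1::real" k] by (simp flip: binomial_gbinomial)
  finally show ?thesis by (simp flip: power_mult_distrib)
qed

lemma invsqrt_coeff_0: "invsqrt_coeff 0 = 1"
  by (simp add: invsqrt_coeff_def)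

lemma abs_invsqrt_coeff: "\<bar>invsqrt_coeff k\<bar> \<le> 1"
proof -
  have "\<bar>(-1/2 :: real) gchoose k\<bar> \<le> 1"
  proof (induction k)
    case (Suc k)
    have "((-1/2 :: real) gchoose Suc k) = ((-1/2) gchoose k) * ((-1/2 - real k) / real (Suc k))"
      by (simp add: gbinomial_prod_rev)
    moreover have "\<bar>(-1/2 - real k) / real (Suc k)\<bar> \<le> 1" by (simp add: abs_if field_simps)
    ultimately show ?case using Suc by (metis abs_ge_zero abs_mult mult_le_one)
  qed simp
  then show ?thesis by (simp add: invsqrt_coeff_def abs_mult)
qed

definition mat_power :: "nat \<Rightarrow> 'a::real_normed_algebra_1 matrix \<Rightarrow> nat \<Rightarrow> 'a matrix"
  where "mat_power m q k = mat_rpow (*) m (mat_diag m 1) q k"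

definition mat_invsqrt :: "nat \<Rightarrow> 'a::{real_normed_algebra_1,banach} matrix \<Rightarrow> 'a matrix"
  where "mat_invsqrt m q = (\<lambda>i j. \<Sum>k. invsqrt_coeff k *\<^sub>R mat_power m q k i j)"

definition geom :: "nat \<Rightarrow> 'a::{real_normed_algebra_1,banach} matrix \<Rightarrow> 'a matrix"
  where "geom m q = (\<lambda>i j. \<Sum>k. mat_power m q k i j)"

text \<open>
  The bound on the entries contains the factor \<open>1 / m\<close> because a product of two matrices has \<open>m\<close>
  summands in each entry; the entries of the \<open>k\<close>-th power are then bounded by \<open>r\<^sup>k\<close>.
\<close>

locale small_matrix =
  fixes m :: nat and q :: "'a::{real_normed_algebra_1,banach} matrix" and r :: real
  assumes m: "1 \<le> m" and r: "0 \<le> r" "r < 1" and q_le: "\<And>i j. norm (q i j) \<le> r / real m"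
    and q_support: "\<And>i j. \<not> (i < m \<and> j < m) \<Longrightarrow> q i j = 0"
begin

abbreviation mm :: "'a matrix \<Rightarrow> 'a matrix \<Rightarrow> 'a matrix" (infixl \<open>\<odot>\<close> 70)
  where "X \<odot> Y \<equiv> mat_mult (*) m X Y"

abbreviation Q :: "nat \<Rightarrow> 'a matrix"
  where "Q \<equiv> mat_power m q"

lemma Q_0: "Q 0 = mat_diag m 1"
  by (simp add: mat_power_def mat_rpow_0)

lemma Q_Suc: "Q (Suc k) = Q k \<odot> q"
  by (simp add: mat_power_def mat_rpow_Suc)

lemma unit_left: "(\<And>i j. \<not> (i < m \<and> j < m) \<Longrightarrow> X i j = 0) \<Longrightarrow> mat_diag m 1 \<odot> X = X"
  by (auto simp: mat_mult_apply mat_diag_def fun_eq_iff if_distrib[of "\<lambda>x. x * _"] cong: if_cong)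

lemma unit_right: "(\<And>i j. \<not> (i < m \<and> j < m) \<Longrightarrow> X i j = 0) \<Longrightarrow> X \<odot> mat_diag m 1 = X"
proof -
  have "mat_diag m (1::'a) l j = (if l = j \<and> j < m then 1 else 0)" for l j by (auto simp: mat_diag_def)
  then show "(\<And>i j. \<not> (i < m \<and> j < m) \<Longrightarrow> X i j = 0) \<Longrightarrow> X \<odot> mat_diag m 1 = X"
    by (auto simp: mat_mult_apply fun_eq_iff if_distrib[of "(*) _"] cong: if_cong)
qed

lemma Q_support: "\<not> (i < m \<and> j < m) \<Longrightarrow> Q k i j = 0"
  by (cases k) (auto simp: Q_0 Q_Suc mat_diag_def mat_mult_apply)

lemma Q_add: "Q a \<odot> Q b = Q (a + b)"
proof (induction b)
  case 0
  show ?case using unit_right[of "Q a"] Q_support by (simp add: Q_0)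
next
  case (Suc b)
  then show ?case by (simp add: Q_Suc flip: mat_mult_assoc)
qed

lemma Q_1: "Q 1 = q"
  using unit_left[of q] q_support by (simp add: Q_0 Q_Suc)

lemma norm_Q: "norm (Q k i j) \<le> r ^ k"
proof (induction k arbitrary: i j)
  case 0
  then show ?case by (simp add: Q_0 mat_diag_def)
next
  case (Suc k)
  show ?case
  proof (cases "i < m \<and> j < m")
    case True
    have "norm (Q (Suc k) i j) \<le> (\<Sum>l<m. norm (Q k i l * q l j))"
      using True by (simp add: Q_Suc mat_mult_apply norm_sum)
    also have "\<dots> \<le> (\<Sum>l<m. r ^ k * (r / real m))"
      using Suc q_le r by (intro sum_mono order_trans[OF norm_mult_ineq] mult_mono) auto
    also have "\<dots> = r ^ Suc k" using m by simp
    finally show ?thesis .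
  qed (use Q_support r in auto)
qed

lemma summable_coeff:
  assumes "\<And>k. \<bar>c k\<bar> \<le> 1"
  shows "summable (\<lambda>k. norm (c k *\<^sub>R Q k i j))"
proof (rule summable_comparison_test')
  show "summable (\<lambda>k. r ^ k)" using r by (intro summable_geometric) auto
  show "norm (norm (c k *\<^sub>R Q k i j)) \<le> r ^ k" for k
  proof -
    have "\<bar>c k\<bar> * norm (Q k i j) \<le> 1 * r ^ k" by (intro mult_mono assms norm_Q) auto
    then show ?thesis by simp
  qed
qed

lemma invsqrt_sums: "(\<lambda>k. invsqrt_coeff k *\<^sub>R Q k i j) sums mat_invsqrt m q i j"
  unfolding mat_invsqrt_def
  by (intro summable_sums summable_norm_cancel[OF summable_coeff] abs_invsqrt_coeff)

lemma geom_sums: "(\<lambda>k. Q k i j) sums geom m q i j"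
  using summable_sums[OF summable_norm_cancel[OF summable_coeff[of "\<lambda>_. 1" i j]]] by (simp add: geom_def)

lemma invsqrt_support: "\<not> (i < m \<and> j < m) \<Longrightarrow> mat_invsqrt m q i j = 0"
  by (simp add: mat_invsqrt_def Q_support)

lemma invsqrt_square: "mat_invsqrt m q \<odot> mat_invsqrt m q = geom m q"
proof (intro ext)
  fix i j
  show "(mat_invsqrt m q \<odot> mat_invsqrt m q) i j = geom m q i j"
  proof (cases "i < m \<and> j < m")
    case True
    have "(\<lambda>k. \<Sum>l<m. \<Sum>a\<le>k. (invsqrt_coeff a *\<^sub>R Q a i l) * (invsqrt_coeff (k - a) *\<^sub>R Q (k - a) l j))
        sums (\<Sum>l<m. mat_invsqrt m q i l * mat_invsqrt m q l j)"
      by (intro sums_sum) (use Cauchy_product_sums[OF summable_coeff[OF abs_invsqrt_coeff] summable_coeff[OF abs_invsqrt_coeff]]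
        in \<open>simp add: mat_invsqrt_def\<close>)
    moreover have "(\<Sum>l<m. \<Sum>a\<le>k. (invsqrt_coeff a *\<^sub>R Q a i l) * (invsqrt_coeff (k - a) *\<^sub>R Q (k - a) l j)) = Q k i j" for k
    proof -
      have "(\<Sum>l<m. \<Sum>a\<le>k. (invsqrt_coeff a *\<^sub>R Q a i l) * (invsqrt_coeff (k - a) *\<^sub>R Q (k - a) l j))
          = (\<Sum>a\<le>k. (invsqrt_coeff a * invsqrt_coeff (k - a)) *\<^sub>R (Q a \<odot> Q (k - a)) i j)"
        using True by (subst sum.swap) (simp add: mat_mult_apply scaleR_sum_right mult.commute)
      also have "\<dots> = Q k i j"
        by (simp add: Q_add invsqrt_coeff_convolution flip: scaleR_sum_left)
      finally show ?thesis .
    qed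
    ultimately have "(\<lambda>k. Q k i j) sums (mat_invsqrt m q \<odot> mat_invsqrt m q) i j"
      using True by (simp add: mat_mult_apply)
    then show ?thesis using geom_sums sums_unique2 by blast
  next
    case False
    then show ?thesis by (auto simp: mat_mult_apply geom_def Q_support)
  qed
qed

lemma geom_inverse: "(mat_diag m 1 - q) \<odot> geom m q = mat_diag m 1"
proof (intro ext)
  fix i j
  show "((mat_diag m 1 - q) \<odot> geom m q) i j = mat_diag m 1 i j"
  proof (cases "i < m \<and> j < m")
    case True
    have "(\<lambda>k. \<Sum>l<m. (mat_diag m 1 - q) i l * Q k l j) sums (\<Sum>l<m. (mat_diag m 1 - q) i l * geom m q l j)"
      by (intro sums_sum sums_mult geom_sums)
    moreover have "(\<Sum>l<m. (mat_diag m 1 - q) i l * Q k l j) = Q k i j - Q (Suc k) i j" for k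
    proof -
      have "(\<Sum>l<m. (mat_diag m 1 - q) i l * Q k l j) = (Q 0 \<odot> Q k) i j - (Q 1 \<odot> Q k) i j"
        using True unfolding Q_0 Q_1 by (simp add: mat_mult_apply left_diff_distrib sum_subtractf)
      then show ?thesis by (simp add: Q_add)
    qed
    ultimately have "(\<lambda>k. Q k i j - Q (Suc k) i j) sums ((mat_diag m 1 - q) \<odot> geom m q) i j"
      using True by (simp add: mat_mult_apply)
    moreover have "(\<lambda>k. Q k i j - Q (Suc k) i j) sums (Q 0 i j - 0)"
      by (intro telescope_sums' summable_LIMSEQ_zero sums_summable[OF geom_sums])
    ultimately show ?thesis using sums_unique2 by (fastforce simp: Q_0)
  qed (auto simp: mat_mult_apply mat_diag_def)
qed

lemma invsqrt_commute:
  assumes z: "z \<odot> q = q \<odot> z" "\<And>i j. \<not> (i < m \<and> j < m) \<Longrightarrow> z i j = 0"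
  shows "z \<odot> mat_invsqrt m q = mat_invsqrt m q \<odot> z"
proof (intro ext)
  fix i j
  have zQ: "z \<odot> Q k = Q k \<odot> z" for k
  proof (induction k)
    case 0
    then show ?case using unit_left[of z] unit_right[of z] z(2) by (simp add: Q_0)
  next
    case (Suc k)
    have "z \<odot> Q (Suc k) = (z \<odot> Q k) \<odot> q" by (simp add: Q_Suc mat_mult_assoc)
    also have "\<dots> = Q k \<odot> (z \<odot> q)" by (simp add: Suc mat_mult_assoc)
    also have "\<dots> = Q (Suc k) \<odot> z" by (simp add: z(1) Q_Suc mat_mult_assoc)
    finally show ?case .
  qed
  show "(z \<odot> mat_invsqrt m q) i j = (mat_invsqrt m q \<odot> z) i j"
  proof (cases "i < m \<and> j < m")
    case True
    have "(\<lambda>k. \<Sum>l<m. z i l * (invsqrt_coeff k *\<^sub>R Q k l j)) sums (\<Sum>l<m. z i l * mat_invsqrt m q l j)"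
      by (intro sums_sum sums_mult invsqrt_sums)
    moreover have "(\<lambda>k. \<Sum>l<m. (invsqrt_coeff k *\<^sub>R Q k i l) * z l j) sums (\<Sum>l<m. mat_invsqrt m q i l * z l j)"
      by (intro sums_sum sums_mult2 invsqrt_sums)
    moreover have "(\<Sum>l<m. z i l * (invsqrt_coeff k *\<^sub>R Q k l j)) = (\<Sum>l<m. (invsqrt_coeff k *\<^sub>R Q k i l) * z l j)" for k
      using arg_cong[OF zQ[of k], of "\<lambda>X. invsqrt_coeff k *\<^sub>R X i j"] True by (simp add: mat_mult_apply scaleR_sum_right)
    ultimately show ?thesis using True sums_unique2 by (fastforce simp: mat_mult_apply)
  qed (auto simp: mat_mult_apply)
qed

text \<open>For \<open>f\<close> the grading or, with a transposition of the indices, the involution.\<close>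

lemma invsqrt_image:
  assumes "bounded_linear f" "\<And>k. f (Q k i j) = Q k i' j'"
  shows "f (mat_invsqrt m q i j) = mat_invsqrt m q i' j'"
proof -
  have "(\<lambda>k. f (invsqrt_coeff k *\<^sub>R Q k i j)) sums f (mat_invsqrt m q i j)"
    by (rule bounded_linear.sums[OF assms(1) invsqrt_sums])
  then have "(\<lambda>k. invsqrt_coeff k *\<^sub>R Q k i' j') sums f (mat_invsqrt m q i j)"
    by (simp add: linear_scale[OF bounded_linear.linear[OF assms(1)]] assms(2))
  then show ?thesis using invsqrt_sums sums_unique2 by blast
qed

end

lemma invsqrt_zero: "mat_invsqrt m (\<lambda>i j. 0) = mat_diag m 1"
proof -
  have "mat_power m (\<lambda>i j. 0) (Suc k) = (\<lambda>i j. 0 :: 'a)" for k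
    by (simp add: mat_power_def mat_rpow_Suc mat_mult_apply fun_eq_iff)
  then have "invsqrt_coeff k *\<^sub>R mat_power m (\<lambda>i j. 0) k i j = (if k = 0 then mat_diag m (1::'a) i j else 0)" for k i j
    by (cases k) (auto simp: mat_power_def mat_rpow_0 invsqrt_coeff_0)
  moreover have "(\<Sum>k::nat. if k = 0 then a else 0) = a" for a :: 'a
    using suminf_finite[of "{0}" "\<lambda>k. if k = 0 then a else 0"] by simp
  ultimately show ?thesis
    by (simp add: mat_invsqrt_def fun_eq_iff)
qed

lemma continuous_on_invsqrt:
  fixes q :: "'x::topological_space \<Rightarrow> 'a::{real_normed_algebra_1,banach} matrix"
  assumes "continuous_on S q" "\<And>t. t \<in> S \<Longrightarrow> small_matrix m (q t) r" "0 \<le> r" "r < 1"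
  shows "continuous_on S (\<lambda>t. mat_invsqrt m (q t))"
proof (rule continuous_on_matrixI)
  fix i j
  have Q: "continuous_on S (\<lambda>t. mat_power m (q t) k)" for k
  proof (induction k)
    case 0
    then show ?case by (simp add: mat_power_def mat_rpow_0 continuous_on_const)
  next
    case (Suc k)
    then show ?case using continuous_on_mat_mult[OF Suc assms(1), of m] by (simp add: mat_power_def mat_rpow_Suc)
  qed
  have "uniform_limit S (\<lambda>n t. \<Sum>k<n. invsqrt_coeff k *\<^sub>R mat_power m (q t) k i j)
      (\<lambda>t. \<Sum>k. invsqrt_coeff k *\<^sub>R mat_power m (q t) k i j) sequentially"
  proof (rule Weierstrass_m_test)
    show "summable (\<lambda>k. r ^ k)" using assms(3,4) by (intro summable_geometric) auto
    fix k t assume "t \<in> S"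
    then interpret small_matrix m "q t" r by (rule assms(2))
    show "norm (invsqrt_coeff k *\<^sub>R mat_power m (q t) k i j) \<le> r ^ k"
    proof -
      have "\<bar>invsqrt_coeff k\<bar> * norm (Q k i j) \<le> 1 * r ^ k" by (intro mult_mono abs_invsqrt_coeff norm_Q) auto
      then show ?thesis by simp
    qed
  qed
  moreover have "continuous_on S (\<lambda>t. \<Sum>k<n. invsqrt_coeff k *\<^sub>R mat_power m (q t) k i j)" for n
    by (intro continuous_on_sum continuous_on_scaleR continuous_on_const Q[THEN continuous_on_entry])
  ultimately show "continuous_on S (\<lambda>t. mat_invsqrt m (q t) i j)"
    unfolding mat_invsqrt_def by (intro uniform_limit_theorem[where F = sequentially]) auto
qed



section \<open>Nearby OSUs are homotopic\<close>

lemma cstar_zero: "cstar 0 = (0::'a::cstar_algebra)"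
  using cstar_add[of 0 "0::'a"] by simp

lemma cstar_minus: "cstar (- a) = - cstar (a::'a::cstar_algebra)"
  using cstar_add[of a "- a"] by (simp add: cstar_zero eq_neg_iff_add_eq_0 add.commute)

lemma cstar_one: "cstar 1 = (1::'a::cstar_algebra)"
  by (metis cstar_cstar cstar_mult mult_1 mult_1_right)

lemma norm_cstar: "norm (cstar a) = norm (a::'a::cstar_algebra)"
proof -
  have le: "norm b \<le> norm (cstar b)" for b :: 'a
  proof (cases "b = 0")
    case False
    have "norm b * norm b \<le> norm (cstar b) * norm b"
      using cstar_identity[of b] norm_mult_ineq[of "cstar b" b] by (simp add: power2_eq_square)
    then show ?thesis using False by simp
  qed simp
  show ?thesis using le[of a] le[of "cstar a"] by (simp add: cstar_cstar)
qed

lemma bounded_linear_cstar: "bounded_linear (cstar :: 'a::cstar_algebra \<Rightarrow> 'a)"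
  by (rule bounded_linear_intro[of _ 1]) (simp_all add: cstar_add scaleR_scaleC cstar_scaleC norm_cstar)

lemma norm_unitary: "cstar u * u = 1 \<Longrightarrow> norm (u::'a::cstar_algebra) = 1"
  using cstar_identity[of u] power2_eq_1_iff[of "norm u"] norm_ge_zero[of u] by auto

lemma scalar_mat_mult: "mat_mult (*) 1 (mat_diag 1 a) (mat_diag 1 b) = mat_diag 1 (a * b :: 'a::ring)"
  by (auto simp: fun_eq_iff mat_mult_apply mat_diag_def)

text \<open>
  The unitary is \<open>h + i (1 - h\<^sup>2)\<^sup>1\<^sup>/\<^sup>2\<close>.  The square root is \<open>(1 - h\<^sup>2) f\<close>, with \<open>f\<close> the inverse square
  root of \<open>1 - h\<^sup>2\<close> obtained from the series for \<open>1 \<times> 1\<close> matrices.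
\<close>

lemma selfadjoint_real_part_unitary:
  fixes h :: "'a::cstar_algebra"
  assumes h: "cstar h = h" "norm h < 1"
  obtains u where "cstar u * u = 1" "h = (1/2 :: complex) *\<^sub>C (u + cstar u)"
proof -
  define q where "q = mat_diag (1::nat) (h * h)"
  have hh: "norm (h * h) \<le> (norm h)\<^sup>2" using norm_mult_ineq[of h h] by (simp add: power2_eq_square)
  have h2: "(norm h)\<^sup>2 < 1" using h(2) by (simp add: power_less_one_iff abs_square_less_1)
  interpret small_matrix 1 q "(norm h)\<^sup>2"
    by unfold_locales (use hh h2 in \<open>auto simp: q_def mat_diag_def\<close>)
  define f where "f = mat_invsqrt 1 q 0 0"
  have F: "mat_invsqrt 1 q = mat_diag 1 f"
  proof (intro ext)
    fix i j
    show "mat_invsqrt 1 q i j = mat_diag 1 f i j"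
      using invsqrt_support[of i j] by (cases "i = 0 \<and> j = 0") (auto simp: mat_diag_def f_def)
  qed
  have "mat_diag 1 1 - q = mat_diag 1 (1 - h * h)"
    by (auto simp: q_def mat_diag_def fun_eq_iff)
  then have "mat_diag 1 ((1 - h * h) * (f * f)) = mat_diag (1::nat) (1::'a)"
    using geom_inverse unfolding invsqrt_square[symmetric] F by (simp only: scalar_mat_mult)
  then have inv: "(1 - h * h) * (f * f) = 1" by (auto simp: mat_diag_def fun_eq_iff split: if_splits)
  have "mat_mult (*) 1 (mat_diag 1 h) (mat_invsqrt 1 q) = mat_mult (*) 1 (mat_invsqrt 1 q) (mat_diag 1 h)"
    by (rule invsqrt_commute, simp only: q_def scalar_mat_mult mult.assoc) (auto simp: mat_diag_def)
  then have comm: "h * f = f * h" unfolding F scalar_mat_mult by (auto simp: mat_diag_def fun_eq_iff split: if_splits)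
  have "\<exists>b. Q k = mat_diag 1 b \<and> cstar b = b \<and> h * b = b * h" for k
  proof (induction k)
    case 0
    then show ?case by (intro exI[of _ 1]) (simp add: Q_0 cstar_one del: One_nat_def)
  next
    case (Suc k)
    then obtain b where b: "Q k = mat_diag 1 b" "cstar b = b" "h * b = b * h" by blast
    have "cstar (b * (h * h)) = b * (h * h)" "h * (b * (h * h)) = b * (h * h) * h"
      using b by (simp_all add: cstar_mult h mult.assoc) (metis mult.assoc)+
    then show ?case
      unfolding Q_Suc b(1) by (intro exI[of _ "b * (h * h)"]) (simp only: q_def scalar_mat_mult)
  qed
  then have "cstar (Q k 0 0) = Q k 0 0" for k
    by (metis mat_diag_def less_one)
  then have fs: "cstar f = f"
    unfolding f_def by (intro invsqrt_image bounded_linear_cstar)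
  define s where "s = (1 - h * h) * f"
  have hs: "h * s = s * h"
    unfolding s_def by (simp add: left_diff_distrib right_diff_distrib comm mult.assoc) (metis comm mult.assoc)
  have fh: "f * (h * h) = h * h * f" by (metis comm mult.assoc)
  have ss: "s * s = 1 - h * h"
  proof -
    have "s * s = (1 - h * h) * (f * (1 - h * h) * f)" by (simp add: s_def mult.assoc)
    also have "f * (1 - h * h) = (1 - h * h) * f" using fh by (simp add: left_diff_distrib right_diff_distrib)
    finally show ?thesis using inv by (simp add: mult.assoc)
  qed
  have sstar: "cstar s = s"
    using fh by (simp add: s_def cstar_mult fs diff_conv_add_uminus cstar_add cstar_minus cstar_one h distrib_left distrib_right
        del: add_uminus_conv_diff)
  show ?thesis
  proof
    let ?u = "h + \<i> *\<^sub>C s"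
    have us: "cstar ?u = h + (- \<i>) *\<^sub>C s" by (simp add: cstar_add cstar_scaleC h sstar)
    show "cstar ?u * ?u = 1"
      unfolding us using hs ss
      by (simp add: distrib_left distrib_right left_diff_distrib right_diff_distrib mult_scaleC_left
          mult_scaleC_right scaleC_scaleC scaleC_one scaleC.scale_right_diff_distrib)
    show "h = (1/2 :: complex) *\<^sub>C (?u + cstar ?u)"
      unfolding us by (simp add: scaleC_add_right scaleC_scaleC) (simp add: scaleC_one flip: scaleC_add_left)
  qed
qed

text \<open>
  Unitaries have norm \<open>1\<close> and are preserved by \<open>\<gamma>\<close>.  So \<open>\<gamma>\<close> maps a self-adjoint \<open>h\<close> with norm below \<open>1\<close>,
  which is the real part of a unitary, to an element of norm at most \<open>1\<close>; the general case follows by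
  scaling and the \<open>C\<^sup>*\<close>-identity.
\<close>

lemma norm_grading: "norm (grading a) \<le> norm (a::'a::graded_cstar_algebra)"
proof -
  interpret base: star_algebra "base_alg :: 'a star_alg" by (rule star_algebra_base)
  have one: "grading (1::'a) = 1" using base.grad_unit by (simp add: base_alg_def)
  have sc: "norm (grading (complex_of_real r *\<^sub>C b)) = \<bar>r\<bar> * norm (grading b)" for r and b :: 'a
    by (simp add: grading_scaleC norm_scaleC)
  have le1: "norm (grading h) \<le> 1" if h: "cstar h = h" "norm h < 1" for h :: 'a
  proof -
    obtain u where u: "cstar u * u = 1" "h = (1/2 :: complex) *\<^sub>C (u + cstar u)"
      using selfadjoint_real_part_unitary[OF h] by blast
    have "cstar (grading u) * grading u = 1"
      using arg_cong[OF u(1), of grading] by (simp add: grading_mult grading_cstar one)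
    then have "norm (grading u) = 1" by (rule norm_unitary)
    moreover have "grading h = (1/2 :: complex) *\<^sub>C (grading u + cstar (grading u))"
      by (simp add: u(2) grading_scaleC grading_add grading_cstar)
    moreover have "norm (grading u + cstar (grading u)) \<le> norm (grading u) + norm (grading u)"
      using norm_triangle_ineq[of "grading u" "cstar (grading u)"] by (simp add: norm_cstar)
    ultimately show ?thesis by (simp add: norm_scaleC)
  qed
  have sa: "norm (grading h) \<le> norm h" if h: "cstar h = h" for h :: 'a
  proof (rule field_le_epsilon)
    fix \<epsilon> :: real assume "0 < \<epsilon>"
    define c where "c = norm h + \<epsilon>"
    have c: "0 < c" "norm h < c" using \<open>0 < \<epsilon>\<close> by (simp_all add: c_def add_nonneg_pos)
    have "norm (grading (complex_of_real (1 / c) *\<^sub>C h)) \<le> 1"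
      using c h by (intro le1) (simp_all add: cstar_scaleC norm_scaleC norm_divide)
    then have "norm (grading h) / c \<le> 1" using sc[of "1 / c" h] c by simp
    then show "norm (grading h) \<le> norm h + \<epsilon>" using c by (simp add: c_def)
  qed
  have "(norm (grading a))\<^sup>2 = norm (grading (cstar a * a))"
    by (simp add: grading_mult grading_cstar cstar_identity)
  also have "\<dots> \<le> norm (cstar a * a)" by (rule sa) (simp add: cstar_mult cstar_cstar)
  also have "\<dots> = (norm a)\<^sup>2" by (rule cstar_identity)
  finally show ?thesis by (rule power2_le_imp_le) simp
qed

lemma bounded_linear_grading: "bounded_linear (grading :: 'a::graded_cstar_algebra \<Rightarrow> 'a)"
  by (rule bounded_linear_intro[of _ 1]) (simp_all add: grading_add scaleR_scaleC grading_scaleC norm_grading)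

text \<open>
  For \<open>z = (1 - t) x + t y\<close> one has \<open>z\<^sup>2 = 1 - t (1 - t) (x - y)\<^sup>2\<close>, where \<open>(x - y)\<^sup>2\<close> commutes with
  \<open>x\<close> and \<open>y\<close>; so \<open>z (z\<^sup>2)\<^sup>-\<^sup>1\<^sup>/\<^sup>2\<close> is a path of OSUs.
\<close>

lemma nearby_OSUs_path_component:
  fixes x y :: "'a::graded_cstar_algebra matrix"
  assumes m: "1 \<le> m" and x: "x \<in> OSU (mat_alg m base_alg)" and y: "y \<in> OSU (mat_alg m base_alg)"
    and near: "\<And>i j. i < m \<Longrightarrow> j < m \<Longrightarrow> norm (y i j - x i j) < 1 / real m"
  shows "path_component (OSU (mat_alg m base_alg)) x y"
proof -
  interpret base: star_algebra "base_alg :: 'a star_alg" by (rule star_algebra_base)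
  define M where "M = mat_alg m (base_alg :: 'a star_alg)"
  interpret M: star_algebra M unfolding M_def by (rule base.star_algebra_mat)
  have Ms: "mat_mult (*) m = mult M" "mat_diag m 1 = unit M" "(\<lambda>i j. cstar (X j i)) = star M X" "(\<lambda>i j. grading (X i j)) = grad M X"
    for X by (simp_all add: M_def mat_alg_def base_alg_def)
  have supp: "X \<in> carr M \<longleftrightarrow> (\<forall>i j. \<not> (i < m \<and> j < m) \<longrightarrow> X i j = 0)" for X
    by (simp add: M_def mat_alg_def base_alg_def)
  have sm: "smul M c X i j = c *\<^sub>C X i j" for c X i j
    by (simp add: M_def mat_alg_def base_alg_def)
  have X: "x \<in> carr M" "grad M x = - x" "star M x = x" "mult M x x = unit M"
    and Y: "y \<in> carr M" "grad M y = - y" "star M y = y" "mult M y y = unit M"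
    using x y by (auto simp: OSU_def M_def)
  \<comment> \<open>\<open>w = (y - x)\<^sup>2 = 2 - d\<close>, and \<open>d\<close> commutes with \<open>x\<close> and \<open>y\<close> as \<open>x\<^sup>2 = y\<^sup>2 = 1\<close>.\<close>
  define d where "d = mult M x y + mult M y x"
  define w where "w = unit M + unit M + - d"
  have d: "mult M x d = mult M d x" "mult M y d = mult M d y"
  proof -
    have "mult M x (mult M x y) = y" "mult M y (mult M y x) = x" "mult M (mult M x y) y = x" "mult M (mult M y x) x = y"
      using X Y M.mult_assoc by (metis M.unit_left M.unit_right)+
    then show "mult M x d = mult M d x" "mult M y d = mult M d y"
      by (simp_all add: d_def M.mult_add_left M.mult_add_right M.mult_assoc add.commute)
  qed
  have w_carr: "w \<in> carr M" unfolding w_def d_def by (intro M.carr_add M.carr_uminus M.carr_mult M.carr_unit X Y)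
  have w: "w = mult M (y - x) (y - x)"
    by (simp add: w_def d_def M.mult_diff_left M.mult_diff_right X Y algebra_simps)
  have star_w: "star M w = w"
    using X Y by (simp only: w_def d_def M.star_add M.star_minus M.star_mult M.star_unit add.commute)
  have grad_w: "grad M w = w"
    using X Y by (simp only: w_def d_def M.grad_add M.grad_minus M.grad_mult M.mult_minus_left
        M.mult_minus_right minus_minus M.grad_unit)
  have comm_w: "mult M x w = mult M w x" "mult M y w = mult M w y"
    by (simp_all only: w_def M.mult_add_left M.mult_add_right M.mult_minus_left M.mult_minus_right
        M.unit_left[OF X(1)] M.unit_right[OF X(1)] M.unit_left[OF Y(1)] M.unit_right[OF Y(1)] d)
  have w_le: "norm (w i j) \<le> 1 / real m" for i j
  proof (cases "i < m \<and> j < m")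
    case True
    have "norm (w i j) \<le> (\<Sum>l<m. norm ((y - x) i l * (y - x) l j))"
      using True by (simp add: w mat_mult_apply norm_sum flip: Ms)
    also have "\<dots> \<le> (\<Sum>l<m. (1 / real m) * (1 / real m))"
      using True near less_imp_le by (intro sum_mono order_trans[OF norm_mult_ineq] mult_mono) auto
    also have "\<dots> = 1 / real m" using m by simp
    finally show ?thesis .
  qed (use w_carr supp in auto)
  define z where "z t = smul M (complex_of_real (1 - t)) x + smul M (complex_of_real t) y" for t
  define q where "q t = smul M (complex_of_real (t * (1 - t))) w" for t
  define F where "F t = mat_invsqrt m (q t)" for t
  have q_carr: "q t \<in> carr M" for t unfolding q_def by (intro M.carr_smul w_carr)
  have z_carr: "z t \<in> carr M" for t unfolding z_def by (intro M.carr_add M.carr_smul X Y)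
  have quarter: "0 \<le> t * (1 - t)" "t * (1 - t) \<le> 1/4" if "t \<in> {0..1}" for t :: real
    using that zero_le_power2[of "t - 1/2"] mult_nonneg_nonneg[of t "1 - t"]
    by (simp_all add: power2_eq_square algebra_simps)
  have small: "small_matrix m (q t) (1/4)" if t: "t \<in> {0..1}" for t
  proof
    fix i j
    have "\<bar>t * (1 - t)\<bar> * norm (w i j) \<le> (1/4) * (1 / real m)"
      using quarter[OF t] w_le by (intro mult_mono) auto
    moreover have "norm (q t i j) = \<bar>t * (1 - t)\<bar> * norm (w i j)"
      unfolding q_def sm norm_scaleC norm_of_real ..
    ultimately show "norm (q t i j) \<le> 1/4 / real m" by simp
    show "q t i j = 0" if "\<not> (i < m \<and> j < m)" using q_carr that supp by auto
  qed (use m in auto)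
  have zq: "mult M (z t) (q t) = mult M (q t) (z t)" for t
    by (simp add: z_def q_def M.mult_add_left M.mult_add_right M.mult_smul_left M.mult_smul_right comm_w M.smul_smul M.smul_add_right mult.commute)
  have zz: "mult M (z t) (z t) = unit M - q t" for t
  proof -
    let ?a = "complex_of_real (1 - t)" and ?b = "complex_of_real t"
    have "mult M (z t) (z t) = smul M (?a * ?a + ?b * ?b) (unit M) + smul M (?a * ?b) d"
      by (simp add: z_def d_def X Y M.mult_add_left M.mult_add_right M.mult_smul_left M.mult_smul_right M.smul_smul
          M.smul_add_left M.smul_add_right ac_simps)
    also have "?a * ?a + ?b * ?b = 1 - (?a * ?b + ?a * ?b)" by (simp add: algebra_simps)
    also have "smul M (1 - (?a * ?b + ?a * ?b)) (unit M) + smul M (?a * ?b) d = unit M - smul M (?a * ?b) w"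
      unfolding w_def M.smul_diff_left M.smul_add_right M.smul_minus_right M.smul_add_left M.smul_one by simp
    finally show ?thesis by (simp add: q_def mult.commute)
  qed
  have F: "F t \<in> carr M" "star M (F t) = F t" "grad M (F t) = F t" "mult M (z t) (F t) = mult M (F t) (z t)"
    "mult M (unit M - q t) (mult M (F t) (F t)) = unit M" if t: "t \<in> {0..1}" for t
  proof -
    interpret small_matrix m "q t" "1/4" by (rule small[OF t])
    have qs: "star M (q t) = q t" "grad M (q t) = q t"
      by (simp_all add: q_def M.star_smul M.grad_smul star_w grad_w)
    have Q: "star M (Q k) = Q k \<and> grad M (Q k) = Q k" for k
    proof (induction k)
      case 0
      then show ?case by (simp add: Q_0 Ms)
    next
      case (Suc k)
      have "star M (Q (Suc k)) = mult M (q t) (Q k)"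
        using Suc qs by (simp add: Q_Suc Ms M.star_mult)
      moreover have "mult M (q t) (Q k) = Q (Suc k)"
        using Q_add[of 1 k] unfolding Q_1 Ms by simp
      ultimately show ?case
        using Suc qs by (simp add: Ms Q_Suc M.grad_mult)
    qed
    show "F t \<in> carr M" using invsqrt_support by (auto simp: supp F_def)
    have "cstar (Q k i j) = Q k j i" "grading (Q k i j) = Q k i j" for k i j
      using Q[of k] unfolding Ms[symmetric] by metis+
    then have "cstar (F t i j) = F t j i" "grading (F t i j) = F t i j" for i j
      unfolding F_def by (auto intro!: invsqrt_image bounded_linear_cstar bounded_linear_grading)
    then show "star M (F t) = F t" "grad M (F t) = F t"
      unfolding Ms[symmetric] by auto
    show "mult M (z t) (F t) = mult M (F t) (z t)"
      using invsqrt_commute[of "z t"] zq z_carr supp unfolding F_def Ms by auto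
    show "mult M (unit M - q t) (mult M (F t) (F t)) = unit M"
      using geom_inverse unfolding F_def invsqrt_square[unfolded Ms] Ms .
  qed
  define p where "p t = mult M (z t) (F t)" for t
  have "p t \<in> OSU M" if t: "t \<in> {0..1}" for t
  proof -
    have zs: "star M (z t) = z t" "grad M (z t) = - z t"
      by (simp_all add: z_def M.star_add M.star_smul M.grad_add M.grad_smul X Y M.smul_minus_right)
    have "mult M (p t) (p t) = mult M (z t) (mult M (mult M (F t) (z t)) (F t))"
      by (simp add: p_def M.mult_assoc)
    also have "\<dots> = mult M (mult M (z t) (z t)) (mult M (F t) (F t))"
      by (simp add: M.mult_assoc flip: F(4)[OF t])
    finally have "mult M (p t) (p t) = unit M" by (simp add: zz F(5)[OF t])
    then show ?thesis
      using zs F[OF t] by (simp add: OSU_def p_def M.carr_mult z_carr M.grad_mult M.mult_minus_left M.mult_minus_right M.star_mult)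
  qed
  moreover have "path p"
  proof -
    have "continuous_on {0..1} z" "continuous_on {0..1} q"
      by (intro continuous_on_matrixI; simp add: z_def q_def sm del: of_real_diff of_real_mult flip: scaleR_scaleC;
          intro continuous_intros)+
    then show ?thesis
      unfolding path_def p_def F_def Ms(1)[symmetric]
      by (intro continuous_on_mat_mult continuous_on_invsqrt[of _ _ _ "1/4"] small) auto
  qed
  moreover have "p 0 = x" "p 1 = y"
  proof -
    have "q 0 = (\<lambda>i j. 0)" "q 1 = (\<lambda>i j. 0)" by (simp_all add: q_def fun_eq_iff)
    moreover have "z 0 = x" "z 1 = y" by (simp_all add: z_def M.smul_one)
    ultimately show "p 0 = x" "p 1 = y"
      using X Y by (simp_all add: p_def F_def invsqrt_zero Ms M.unit_right)
  qed
  ultimately show ?thesis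
    unfolding path_component_def M_def
    by (intro exI[of _ p]) (auto simp: path_image_def pathstart_def pathfinish_def)
qed



section \<open>The suspension formula\<close>

lemma cl_mult_0: "cl_mult 0 mul \<gamma> f g {} = mul (f {}) (g {})"
  by (simp add: cl_mult_def signed_def)

text \<open>
  C4 for \<open>k = 0\<close> provides OSUs over the domain algebra close to \<open>x\<close>, and close OSUs are homotopic.
\<close>

lemma (in n_cycle) smooth_representative:
  assumes "(m, x) \<in> vd_elems (vd_alg e)" and e: "e \<in> OSU base_alg"
  shows "\<exists>y. (m, y) \<in> smooth_osus C \<and> ((m, x), (m, y)) \<in> vd_rel (vd_alg e)"
proof -
  interpret base: star_algebra "base_alg :: 'a star_alg" by (rule star_algebra_base)
  interpret D: vd_monoid "vd_alg e" by (rule vd_monoid_alg[OF e])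
  have m: "1 \<le> m" and x: "x \<in> OSU (mat_alg m base_alg)"
    using assms(1) by (simp_all add: vd_elems_alg_iff)
  have zero: "cstar 0 = (0::'a)" "grading 0 = (0::'a)"
    using base.star_zero base.grad_zero by (simp_all add: base_alg_def)
  have pow: "(grading ^^ k) 0 = (0::'a)" for k
    using zero by (induction k) simp_all
  let ?B = "cl_tensor 0 (base_alg :: 'a star_alg)"
  define x' where "x' = (\<lambda>i j. cl_el (x i j) {})"
  have x': "x' \<in> OSU (mat_alg m ?B)"
  proof -
    have 0: "cl_mult 0 (*) grading f g S = (0::'a)" if "S \<noteq> {}" for f g S
      using that by (simp add: cl_mult_def)
    have "mat_mult (cl_mult 0 (*) grading) m x' x' i j S = mat_diag m (cl_el 1 {}) i j S" for i j S
    proof -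
      have "mat_mult (*) m x x i j = mat_diag m 1 i j" using x by (simp add: OSU_mat_iff base_alg_def)
      then show ?thesis
        unfolding mat_mult_apply by (cases "S = {}")
          (auto simp: fun_sum_apply 0 cl_mult_0 x'_def cl_el_def mat_diag_def split: if_splits)
    qed
    then have "mat_mult (cl_mult 0 (*) grading) m x' x' = mat_diag m (cl_el 1 {})"
      by (intro ext)
    then show ?thesis
      using x by (auto simp: OSU_mat_iff base_alg_def cl_tensor_def x'_def cl_el_def fun_eq_iff signed_def zero pow)
  qed
  \<comment> \<open>the distance at which \<open>nearby_OSUs_path_component\<close> applies\<close>
  define N :: "(nat set \<Rightarrow> 'a) matrix set" where
    "N = (\<Inter>i\<in>{..<m}. \<Inter>j\<in>{..<m}. {Y. norm (Y i j {} - x i j) < 1 / real m})"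
  have "open N"
  proof -
    have "open {Y :: (nat set \<Rightarrow> 'a) matrix. norm (Y i j {} - x i j) < 1 / real m}" for i j
    proof -
      have "continuous_on UNIV (\<lambda>Y :: (nat set \<Rightarrow> 'a) matrix. Y i j {})"
        by (rule continuous_on_product_then_coordinatewise[OF continuous_on_entry[OF continuous_on_id]])
      then show ?thesis
        by (intro open_Collect_less continuous_on_norm continuous_on_diff continuous_on_const)
    qed
    then show ?thesis unfolding N_def by (intro open_INT ballI finite_lessThan)
  qed
  moreover have "x' \<in> N" using m by (simp add: N_def x'_def cl_el_def)
  ultimately obtain y' where y': "y' \<in> OSU (mat_alg m ?B)" "y' \<in> N" "\<And>i j S. y' i j S \<in> cyc_alg C"
    using C4[OF m x'] by blast
  define y where "y = (\<lambda>i j. y' i j {})"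
  have y: "y \<in> OSU (mat_alg m base_alg)"
  proof -
    have "mat_mult (*) m y y i j = mat_diag m 1 i j" for i j
    proof -
      have "mat_mult (cl_mult 0 (*) grading) m y' y' i j {} = mat_diag m (cl_el 1 {}) i j {}"
        using y'(1) by (simp add: OSU_mat_iff cl_tensor_def base_alg_def)
      then show ?thesis
        by (auto simp: mat_mult_apply fun_sum_apply cl_mult_0 y_def mat_diag_def cl_el_def split: if_splits)
    qed
    then have "mat_mult (*) m y y = mat_diag m 1" by (intro ext)
    moreover have "grading (y i j) = - y i j" "cstar (y j i) = y i j" "\<not> (i < m \<and> j < m) \<Longrightarrow> y i j = 0" for i j
    proof -
      have "grad ?B (y' i j) {} = (- y' i j) {}" "star ?B (y' j i) {} = y' i j {}"
        using y'(1) unfolding OSU_mat_iff by simp_all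
      moreover have "y' i j {} = 0" if "\<not> (i < m \<and> j < m)"
        using OSU_mat_support[OF y'(1) that] by simp
      ultimately show "grading (y i j) = - y i j" "cstar (y j i) = y i j" "\<not> (i < m \<and> j < m) \<Longrightarrow> y i j = 0"
        by (simp_all add: cl_tensor_def base_alg_def signed_def y_def)
    qed
    ultimately show ?thesis by (simp add: OSU_mat_iff base_alg_def)
  qed
  have "path_component (OSU (mat_alg m base_alg)) x y"
    using y'(2) by (intro nearby_OSUs_path_component m x y) (simp add: N_def y_def)
  then have "((m, x), (m, y)) \<in> vd_rel (vd_alg e)"
    using m x y by (intro D.vd_rel_htp) (simp_all add: vd_alg_def)
  moreover have "(m, y) \<in> smooth_osus C"
    using m y y'(3) by (simp add: smooth_osus_def y_def)
  ultimately show ?thesis by blast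
qed

lemma sine_integral_nonzero: "integral {0..1} (\<lambda>t::real. sin (pi * t) ^ n) \<noteq> 0"
proof
  assume 0: "integral {0..1} (\<lambda>t::real. sin (pi * t) ^ n) = 0"
  have "\<forall>t\<in>{0..1}. sin (pi * t) ^ n = 0"
  proof (rule iffD1[OF integral_eq_0_iff _])
    show "continuous_on {0..1} (\<lambda>t::real. sin (pi * t) ^ n)" by (intro continuous_intros)
    show "0 \<le> sin (pi * t) ^ n" if "t \<in> {0..1}" for t
      using that by (intro zero_le_power sin_ge_zero) (auto simp: mult_left_le)
  qed (use 0 in auto)
  then have "sin (pi * (1/2)) ^ n = 0" by (rule bspec) simp
  then show False by simp
qed

theorem lemma4p17:
  fixes n :: nat
    and C :: "('a::graded_cstar_algebra, 'w::{complex_algebra, topological_space}) cycle_data"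
    and e :: 'a
  assumes "n_cycle n C"
    and "e \<in> OSU base_alg" and "e \<in> cyc_alg C" and "cyc_d C (cyc_emb C e) = 0"
    and "susp_pairing_well_defined n C"
  shows "\<forall>c \<in> DK (vd_alg e).
     susp_pairing n C (beta e c) =
       (- 1) ^ (n + 1) * kappa * complex_of_real pi * of_nat (n + 1)
         * complex_of_real (integral {0..1} (\<lambda>t::real. sin (pi * t) ^ n))
       * pairing n C e c"
proof
  interpret n_cycle n C by fact
  interpret D: vd_monoid "vd_alg e" by (rule vd_monoid_alg[OF assms(2)])
  define K where "K = (- 1) ^ (n + 1) * kappa * complex_of_real pi * of_nat (n + 1)
         * complex_of_real (integral {0..1} (\<lambda>t::real. sin (pi * t) ^ n))"
  have K: "K \<noteq> 0"
    unfolding K_def using sine_integral_nonzero[of n] by (simp add: kappa_def del: of_nat_Suc)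
  define step where "step p = (fst p, step_loop e (fst p) (snd p))" for p
  define S where "S p = susp_pairing_rep n C (step p)" for p
  have S: "S p = K * pairing_rep n C e p" if "p \<in> smooth_osus C" for p
    using susp_pairing_rep_step[of "fst p" "snd p" e] that assms(2-4) by (simp add: S_def step_def K_def)
  have smooth: "step p \<in> smooth_loops C" if "p \<in> smooth_osus C" for p
    using step_loop_smooth[of "fst p" "snd p" C e] that assms(2,3) one_alg alg_closed(3)
    by (simp add: step_def)
  have beta: "beta e (DK_diff (vd_alg e) p q) = DK_diff vd_susp (step p) (step q)"
    if "p \<in> smooth_osus C" "q \<in> smooth_osus C" for p q
  proof -
    have "p \<in> vd_elems (vd_alg e)" "q \<in> vd_elems (vd_alg e)"
      using that by (auto simp: smooth_osus_def vd_elems_alg_iff)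
    then show ?thesis unfolding step_def by (rule beta_DK_diff[OF assms(2)])
  qed
  fix c assume "c \<in> DK (vd_alg e)"
  then obtain m x l y where mxly: "(m, x) \<in> vd_elems (vd_alg e)" "(l, y) \<in> vd_elems (vd_alg e)"
    "c = DK_diff (vd_alg e) (m, x) (l, y)"
    by (rule D.DK_cases)
  obtain x' where x': "(m, x') \<in> smooth_osus C" "((m, x), (m, x')) \<in> vd_rel (vd_alg e)"
    using smooth_representative[OF mxly(1) assms(2)] by blast
  obtain y' where y': "(l, y') \<in> smooth_osus C" "((l, y), (l, y')) \<in> vd_rel (vd_alg e)"
    using smooth_representative[OF mxly(2) assms(2)] by blast
  let ?p = "(m, x')" and ?q = "(l, y')"
  have c: "c = DK_diff (vd_alg e) ?p ?q"
    unfolding mxly(3) by (rule D.DK_diff_cong[OF x'(2) y'(2)])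
  have "susp_pairing n C (beta e c) = S ?p - S ?q"
    unfolding susp_pairing_def
  proof (rule the_equality)
    show "\<exists>p\<in>smooth_loops C. \<exists>q\<in>smooth_loops C. beta e c = DK_diff vd_susp p q \<and>
        S ?p - S ?q = susp_pairing_rep n C p - susp_pairing_rep n C q"
      using smooth[OF x'(1)] smooth[OF y'(1)] beta[OF x'(1) y'(1)] by (auto simp: c S_def)
    fix z assume "\<exists>p\<in>smooth_loops C. \<exists>q\<in>smooth_loops C. beta e c = DK_diff vd_susp p q \<and>
        z = susp_pairing_rep n C p - susp_pairing_rep n C q"
    then show "z = S ?p - S ?q"
      using assms(5) smooth[OF x'(1)] smooth[OF y'(1)] beta[OF x'(1) y'(1)]
      unfolding susp_pairing_well_defined_def c S_def by metis
  qed
  moreover have "pairing n C e c = pairing_rep n C e ?p - pairing_rep n C e ?q"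
    unfolding pairing_def
  proof (rule the_equality)
    show "\<exists>p\<in>smooth_osus C. \<exists>q\<in>smooth_osus C. c = DK_diff (vd_alg e) p q \<and>
        pairing_rep n C e ?p - pairing_rep n C e ?q = pairing_rep n C e p - pairing_rep n C e q"
      using x'(1) y'(1) c by blast
    fix z assume "\<exists>p\<in>smooth_osus C. \<exists>q\<in>smooth_osus C. c = DK_diff (vd_alg e) p q \<and>
        z = pairing_rep n C e p - pairing_rep n C e q"
    then obtain p q where pq: "p \<in> smooth_osus C" "q \<in> smooth_osus C" "c = DK_diff (vd_alg e) p q"
      "z = pairing_rep n C e p - pairing_rep n C e q" by blast
    \<comment> \<open>The value does not depend on the representatives: compare after suspension and cancel \<open>K\<close>.\<close>
    have "DK_diff vd_susp (step p) (step q) = DK_diff vd_susp (step ?p) (step ?q)"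
      using beta[OF pq(1,2)] beta[OF x'(1) y'(1)] pq(3) c by simp
    then have "S p - S q = S ?p - S ?q"
      using assms(5) smooth pq(1,2) x'(1) y'(1) unfolding susp_pairing_well_defined_def S_def by metis
    then have "K * (pairing_rep n C e p - pairing_rep n C e q) = K * (pairing_rep n C e ?p - pairing_rep n C e ?q)"
      using S[OF pq(1)] S[OF pq(2)] S[OF x'(1)] S[OF y'(1)] by (simp only: right_diff_distrib)
    then show "z = pairing_rep n C e ?p - pairing_rep n C e ?q"
      using K pq(4) by simp
  qed
  ultimately show "susp_pairing n C (beta e c) =
       (- 1) ^ (n + 1) * kappa * complex_of_real pi * of_nat (n + 1)
         * complex_of_real (integral {0..1} (\<lambda>t::real. sin (pi * t) ^ n))
       * pairing n C e c"
    using S[OF x'(1)] S[OF y'(1)] unfolding K_def[symmetric] by (simp only: right_diff_distrib)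
qed

end
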